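(* Let $G$ be a finite group, let $p$ be a prime number, let $\sigma \in \operatorname{Gal}(\mathbb{Q}_{|G|}/\mathbb{Q})$ be an element of order $p$ and let $P$ be a Sylow $p$-subgroup of $G$. Suppose that $p$ does not divide the degree of any $\sigma$-invariant irreducible character of $G$. Then $\operatorname{N}_G(P)$ intersects every chief factor of $G$ non-trivially; that is, for every chief factor $M/K$ of $G$, one has $\operatorname{N}_G(P) \cap M \not\leq K$.
   Context: For a positive integer $n$, $\mathbb{Q}_n = \mathbb{Q}(e^{2\pi i/n})$ is the $n$-th cyclotomic field. Characters are complex characters; $\operatorname{Irr}(G)$ is the set of irreducible complex characters of $G$. The values of each $\chi \in \operatorname{Irr}(G)$ lie in $\mathbb{Q}_{|G|}$, and $\sigma \in \operatorname{Gal}(\mathbb{Q}_{|G|}/\mathbb{Q})$ acts on $\operatorname{Irr}(G)$ by $\chi^{\sigma}(g) = \sigma(\chi(g))$ for $g \in G$. The character $\chi$ is $\sigma$-invariant if $\chi^\sigma=\chi$. The degree of $\chi$ is $\chi(1)$. A chief factor of $G$ is a quotient $M/K$ where $K < M$ are normal subgroups of $G$ and $M/K$ is a minimal normal subgroup of $G/K$. $\operatorname{N}_G(P)$ is the normalizer of $P$ in $G$. *)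

theory Defs
  imports
    "HOL-Algebra.Algebra"
    "HOL-Computational_Algebra.Primes"
    "Jordan_Normal_Form.VS_Connect"
begin

section \<open>Complex representations and characters\<close>

definition GL :: "nat \<Rightarrow> complex mat monoid" where
  "GL n = units_of (ring_mat TYPE(complex) n ())"

definition mat_trace :: "complex mat \<Rightarrow> complex" where
  "mat_trace A = (\<Sum>i<dim_row A. A $$ (i, i))"

text \<open>A representation of degree \<open>n\<close> is a homomorphism \<open>\<rho>\<close> into \<^const>\<open>GL\<close> \<open>n\<close>. The zero
  representation is not irreducible, whence \<open>0 < n\<close>.\<close>

definition irreducible_rep ::
  "('a, 'b) monoid_scheme \<Rightarrow> nat \<Rightarrow> ('a \<Rightarrow> complex mat) \<Rightarrow> bool" where
  "irreducible_rep G n \<rho> \<longleftrightarrow>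
     \<rho> \<in> hom G (GL n) \<and> 0 < n \<and>
     (\<forall>W. subspace class_ring W (module_vec TYPE(complex) n) \<and>
          (\<forall>g\<in>carrier G. \<forall>w\<in>W. \<rho> g *\<^sub>v w \<in> W) \<longrightarrow>
          W = {0\<^sub>v n} \<or> W = carrier_vec n)"

text \<open>Class functions are kept extensional on the carrier, so that equality of characters is
  equality of functions.\<close>

definition character_of ::
  "('a, 'b) monoid_scheme \<Rightarrow> ('a \<Rightarrow> complex mat) \<Rightarrow> 'a \<Rightarrow> complex" where
  "character_of G \<rho> = (\<lambda>g\<in>carrier G. mat_trace (\<rho> g))"

definition Irr :: "('a, 'b) monoid_scheme \<Rightarrow> ('a \<Rightarrow> complex) set" where
  "Irr G = {character_of G \<rho> |n \<rho>. irreducible_rep G n \<rho>}"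

definition char_degree :: "('a, 'b) monoid_scheme \<Rightarrow> ('a \<Rightarrow> complex) \<Rightarrow> nat" where
  "char_degree G \<chi> = (THE d. \<chi> \<one>\<^bsub>G\<^esub> = of_nat d)"

lemma char_degree_character_of:
  assumes "Group.group G" and "\<rho> \<in> hom G (GL n)"
  shows "char_degree G (character_of G \<rho>) = n"
proof -
  interpret G: Group.group G by fact
  interpret R: Ring.ring "ring_mat TYPE(complex) n ()" by (rule ring_mat)
  have "Group.group (GL n)"
    unfolding GL_def by (rule R.units_group)
  then have "\<rho> \<one>\<^bsub>G\<^esub> = \<one>\<^bsub>GL n\<^esub>"
    using assms(2) G.group_axioms by (metis hom_one)
  then have "\<rho> \<one>\<^bsub>G\<^esub> = 1\<^sub>m n"
    by (simp add: GL_def units_of_one ring_mat_simps)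
  then show ?thesis
    by (simp add: char_degree_def character_of_def mat_trace_def)
qed

section \<open>Cyclotomic fields and Galois action\<close>

definition cyclotomic_field :: "nat \<Rightarrow> complex set" where
  "cyclotomic_field n =
     generate_field class_ring (\<rat> \<union> {exp (2 * of_real pi * \<i> / of_nat n)})"

text \<open>The Galois group of a subfield \<open>F\<close> of the complex numbers over the rationals. Its elements
  are extensional functions on \<open>F\<close>, as for \<^const>\<open>AutoGroup\<close>.\<close>

definition Gal :: "complex set \<Rightarrow> (complex \<Rightarrow> complex) monoid" where
  "Gal F = BijGroup F
     \<lparr>carrier := {\<sigma> \<in> Bij F. \<sigma> \<in> Ring.ring_hom (class_ring\<lparr>carrier := F\<rparr>) (class_ring\<lparr>carrier := F\<rparr>) \<and>
                          (\<forall>q\<in>\<rat>. \<sigma> q = q)}\<rparr>"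

definition galois_conj ::
  "('a, 'b) monoid_scheme \<Rightarrow> (complex \<Rightarrow> complex) \<Rightarrow> ('a \<Rightarrow> complex) \<Rightarrow> 'a \<Rightarrow> complex" where
  "galois_conj G \<sigma> \<chi> = (\<lambda>g\<in>carrier G. \<sigma> (\<chi> g))"

lemma cyclotomic_field_closed:
  shows "\<rat> \<subseteq> cyclotomic_field n"
    and "x \<in> cyclotomic_field n \<Longrightarrow> y \<in> cyclotomic_field n \<Longrightarrow> x + y \<in> cyclotomic_field n"
    and "x \<in> cyclotomic_field n \<Longrightarrow> y \<in> cyclotomic_field n \<Longrightarrow> x * y \<in> cyclotomic_field n"
  using generate_field.eng_add[of x class_ring _ y] generate_field.eng_mult[of x class_ring _ y]
  by (auto simp: cyclotomic_field_def class_ring_simps intro: generate_field.incl)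

lemma group_Gal_cyclotomic_field: "Group.group (Gal (cyclotomic_field n))"
proof -
  define F where "F = cyclotomic_field n"
  let ?A = "{\<sigma> \<in> Bij F. \<sigma> \<in> Ring.ring_hom (class_ring\<lparr>carrier := F\<rparr>) (class_ring\<lparr>carrier := F\<rparr>) \<and>
                    (\<forall>q\<in>\<rat>. \<sigma> q = q)}"
  have Q: "q \<in> F" if "q \<in> \<rat>" for q
    using that cyclotomic_field_closed(1) by (auto simp: F_def)
  have add: "x + y \<in> F" and mult: "x * y \<in> F" if "x \<in> F" "y \<in> F" for x y
    using that cyclotomic_field_closed(2,3) by (auto simp: F_def)
  have hom: "\<sigma> \<in> Ring.ring_hom (class_ring\<lparr>carrier := F\<rparr>) (class_ring\<lparr>carrier := F\<rparr>) \<longleftrightarrow>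
      (\<forall>x\<in>F. \<sigma> x \<in> F) \<and> (\<forall>x\<in>F. \<forall>y\<in>F. \<sigma> (x * y) = \<sigma> x * \<sigma> y) \<and>
      (\<forall>x\<in>F. \<forall>y\<in>F. \<sigma> (x + y) = \<sigma> x + \<sigma> y) \<and> \<sigma> 1 = 1" for \<sigma>
    by (auto simp: Ring.ring_hom_def class_ring_simps)
  interpret B: Group.group "BijGroup F" by (rule group_BijGroup)
  have "subgroup ?A (BijGroup F)"
  proof (rule B.subgroupI)
    show "?A \<subseteq> carrier (BijGroup F)" by (auto simp: BijGroup_def)
    have "(\<lambda>x\<in>F. x) \<in> ?A"
      unfolding hom using add mult Q by (auto simp: id_Bij)
    then show "?A \<noteq> {}" by blast
  next
    fix \<sigma> assume s: "\<sigma> \<in> ?A"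
    then have b: "bij_betw \<sigma> F F" and sB: "\<sigma> \<in> Bij F" by (auto simp: Bij_def)
    have inv: "inv\<^bsub>BijGroup F\<^esub> \<sigma> = (\<lambda>x\<in>F. (inv_into F \<sigma>) x)"
      using sB by (rule inv_BijGroup)
    let ?t = "inv_into F \<sigma>"
    have inj: "inj_on \<sigma> F" and im: "\<sigma> ` F = F" using b by (auto simp: bij_betw_def)
    have t: "?t x \<in> F" "\<sigma> (?t x) = x" if "x \<in> F" for x
      using that im by (auto intro: inv_into_into f_inv_into_f)
    have ts: "?t (\<sigma> x) = x" if "x \<in> F" for x
      using that inj by simp
    have tmult: "?t (x * y) = ?t x * ?t y" if "x \<in> F" "y \<in> F" for x y
      using s t that ts[of "?t x * ?t y"] mult unfolding hom by auto
    have tadd: "?t (x + y) = ?t x + ?t y" if "x \<in> F" "y \<in> F" for x y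
      using s t that ts[of "?t x + ?t y"] add unfolding hom by auto
    have tq: "?t q = q" if "q \<in> \<rat>" for q
      using s ts[OF Q[OF that]] that by auto
    have "(\<lambda>x\<in>F. ?t x) \<in> Bij F"
      using sB by (rule restrict_inv_into_Bij)
    moreover have "(\<lambda>x\<in>F. ?t x) \<in> Ring.ring_hom (class_ring\<lparr>carrier := F\<rparr>) (class_ring\<lparr>carrier := F\<rparr>)"
      unfolding hom using t tmult tadd tq add mult Q by auto
    ultimately show "inv\<^bsub>BijGroup F\<^esub> \<sigma> \<in> ?A"
      unfolding inv using tq Q by auto
  next
    fix \<sigma> \<tau> assume s: "\<sigma> \<in> ?A" and t: "\<tau> \<in> ?A"
    then have eq: "\<sigma> \<otimes>\<^bsub>BijGroup F\<^esub> \<tau> = compose F \<sigma> \<tau>"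
      by (simp add: BijGroup_def)
    have "compose F \<sigma> \<tau> \<in> Bij F"
      using s t by (auto intro: compose_Bij)
    moreover have "compose F \<sigma> \<tau> \<in>
        Ring.ring_hom (class_ring\<lparr>carrier := F\<rparr>) (class_ring\<lparr>carrier := F\<rparr>)"
      using s t add mult Q unfolding hom mem_Collect_eq by (auto simp: compose_def)
    ultimately show "\<sigma> \<otimes>\<^bsub>BijGroup F\<^esub> \<tau> \<in> ?A"
      unfolding eq using s t Q by (auto simp: compose_eq)
  qed
  then have "Group.group (BijGroup F\<lparr>carrier := ?A\<rparr>)"
    by (rule B.subgroup_imp_group)
  then show ?thesis
    by (simp add: Gal_def F_def)
qed

section \<open>Sylow subgroups and chief factors\<close>

definition sylow_subgroup :: "nat \<Rightarrow> 'a set \<Rightarrow> ('a, 'b) monoid_scheme \<Rightarrow> bool" where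
  "sylow_subgroup p P G \<longleftrightarrow> subgroup P G \<and> card P = p ^ multiplicity p (Coset.order G)"

definition minimal_normal :: "'a set \<Rightarrow> ('a, 'b) monoid_scheme \<Rightarrow> bool" where
  "minimal_normal N G \<longleftrightarrow>
     N \<lhd> G \<and> N \<noteq> {\<one>\<^bsub>G\<^esub>} \<and> (\<forall>L. L \<lhd> G \<and> L \<subseteq> N \<longrightarrow> L = {\<one>\<^bsub>G\<^esub>} \<or> L = N)"

definition chief_factor :: "('a, 'b) monoid_scheme \<Rightarrow> 'a set \<Rightarrow> 'a set \<Rightarrow> bool" where
  "chief_factor G M K \<longleftrightarrow>
     K \<lhd> G \<and> M \<lhd> G \<and> K \<subset> M \<and>
     minimal_normal (carrier (G\<lparr>carrier := M\<rparr> Mod K)) (G Mod K)"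

end

theory Submission
  imports Defs
    "Jordan_Normal_Form.Char_Poly"
    "Jordan_Normal_Form.Schur_Decomposition"
    "HOL-Number_Theory.Cong"
begin

text \<open>
  Let \<open>M/K\<close> be a chief factor with \<open>N\<^sub>G(P) \<inter> M \<le> K\<close>. The proof produces a \<open>\<sigma>\<close>-invariant irreducible
  character of degree divisible by \<open>p\<close>.

  Write \<open>H = G/K\<close> and \<open>N = M/K\<close>, and let \<open>Q\<close> be the image of \<open>P\<close> in \<open>H\<close>. If \<open>Q\<close> centralised some
  \<open>m K \<noteq> K\<close> in \<open>N\<close>, then \<open>P\<close> and \<open>m P m\<^sup>-\<^sup>1\<close> would be Sylow subgroups of the preimage of \<open>Q\<close>, hence
  conjugate there, and correcting \<open>m\<close> by an element of \<open>K\<close> would give an element of \<open>N\<^sub>G(P) \<inter> M\<close>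
  outside \<open>K\<close> (\<open>frattini_fixed_coset\<close>). So \<open>Q\<close> fixes only the identity of \<open>N\<close>; in particular
  \<open>\<bar>N\<bar>\<close> is congruent to 1 modulo \<open>p\<close>. Irreducible characters of \<open>H\<close> inflate to \<open>G\<close>, so it suffices to
  find the character for \<open>H\<close>. Two facts are combined.

  \<^emph>\<open>Degrees.\<close> If \<open>\<chi>\<close> is irreducible and nontrivial on \<open>N\<close>, then \<open>\<chi>\<close> sums to 0 over \<open>N\<close>. It is constant
  on the \<open>Q\<close>-orbits in \<open>N - {1}\<close>, and these have lengths divisible by \<open>p\<close>. Hence \<open>\<chi>(1)/p\<close> is an
  integral combination of roots of unity; being rational, it is an integer
  (\<open>dvd_degree_of_no_fixed_points\<close>).

  \<^emph>\<open>Invariant characters.\<close> On \<open>\<bar>G\<bar>\<close>-th roots of unity \<open>\<sigma>\<close> is a power map with some exponent \<open>k\<close>, and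
  \<open>k\<^sup>p\<close> is 1 modulo \<open>\<bar>G\<bar>\<close>; therefore \<open>\<chi>\<^sup>\<sigma>(g) = \<chi>(g\<^sup>k)\<close>. As in Brauer's permutation lemma,
  the \<open>\<sigma>\<close>-invariant irreducible characters of \<open>H\<close> are as numerous as the conjugacy classes
  that are stable under the \<open>k\<close>-th power map, and those that are trivial on \<open>N\<close> are counted by the
  stable classes of \<open>H/N\<close>. If all invariant characters were trivial on \<open>N\<close>, both numbers would agree;
  \<open>fixed_Irr_class_count\<close> states this as an equality between numbers of pairs of elements. But there are
  strictly more stable classes in \<open>H\<close> (\<open>power_class_count_less\<close>): every stable class of \<open>H/N\<close>
  lifts, because \<open>y \<mapsto> u y\<^sup>l u\<^sup>-\<^sup>1\<close>, with \<open>u\<close> a suitable \<open>p\<close>-element and \<open>l\<close> inverse to \<open>k\<close>, permutes a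
  coset of \<open>N\<close> with order a power of \<open>p\<close>, and \<open>p\<close> does not divide \<open>\<bar>N\<bar>\<close>; and two stable classes lie over
  the identity, since some \<open>x \<noteq> 1\<close> in \<open>N\<close> is conjugate to \<open>x\<^sup>k\<close> (\<open>exists_power_conjugate\<close>). Such an
  \<open>x\<close> is an eigenvector with eigenvalue \<open>k\<close> of a \<open>p\<close>-element acting on the centre of a \<open>Q\<close>-invariant
  Sylow subgroup of \<open>N\<close>.

  The character theory is built from Schur's lemma. The irreducible characters span the class functions
  (\<open>class_fun_eq_0\<close>): a class function \<open>f\<close> orthogonal to all of them acts as 0 in every irreducible
  representation, while the convolution of \<open>f\<close> with its adjoint acts on the regular representation with
  nonzero trace, so it has a nonzero eigenvalue, and its eigenspace contains an irreducible
  subrepresentation. That \<open>\<chi>\<^sup>\<sigma>\<close> is again irreducible is read off from the functional equation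
  \<open>\<bar>H\<bar> \<chi>(a) \<chi>(b) = \<chi>(1) \<Sum>\<^sub>h \<chi>(a h b h\<^sup>-\<^sup>1)\<close>, which characterises irreducible characters up to a factor and is
  preserved by field automorphisms (\<open>ring_automorphism_Irr\<close>).
\<close>

section \<open>Traces and eigenvalues of complex matrices\<close>

lemma mat_trace_mult_comm:
  assumes "A \<in> carrier_mat n m" and "B \<in> carrier_mat m n"
  shows "mat_trace (A * B) = mat_trace (B * A)"
proof -
  have "mat_trace (A * B) = (\<Sum>i<n. \<Sum>j<m. A $$ (i, j) * B $$ (j, i))"
    using assms by (auto simp: mat_trace_def scalar_prod_def lessThan_atLeast0 intro!: sum.cong)
  also have "\<dots> = (\<Sum>j<m. \<Sum>i<n. B $$ (j, i) * A $$ (i, j))"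
    by (subst sum.swap) (simp add: mult.commute)
  also have "\<dots> = mat_trace (B * A)"
    using assms by (auto simp: mat_trace_def scalar_prod_def lessThan_atLeast0 intro!: sum.cong)
  finally show ?thesis .
qed

lemma mat_trace_one [simp]: "mat_trace (1\<^sub>m n) = of_nat n"
  by (simp add: mat_trace_def)

lemma mat_trace_smult: "mat_trace (c \<cdot>\<^sub>m A) = c * mat_trace A"
  if "A \<in> carrier_mat n n"
  using that by (auto simp: mat_trace_def sum_distrib_left)

lemma upper_triangular_mult:
  fixes A B :: "'a :: semiring_1 mat"
  assumes "A \<in> carrier_mat n n" "B \<in> carrier_mat n n" "upper_triangular A" "upper_triangular B"
  shows "upper_triangular (A * B)" "i < n \<Longrightarrow> (A * B) $$ (i, i) = A $$ (i, i) * B $$ (i, i)"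
proof -
  have z: "A $$ (i, k) * B $$ (k, j) = 0" if "i < n" "k < n" "j < n" "k < i \<or> j < k" for i j k
    using that upper_triangularD[OF assms(3), of k i] upper_triangularD[OF assms(4), of j k] assms(1,2)
    by auto
  show "upper_triangular (A * B)"
  proof (rule upper_triangularI)
    fix i j assume ij: "j < i" "i < dim_row (A * B)"
    then show "(A * B) $$ (i, j) = 0"
      using assms(1,2) z by (auto simp: scalar_prod_def intro!: sum.neutral)
        (metis linorder_neqE_nat order.strict_trans)
  qed
  show "(A * B) $$ (i, i) = A $$ (i, i) * B $$ (i, i)" if "i < n"
  proof -
    have "(A * B) $$ (i, i) = (\<Sum>k\<in>{0..<n}. A $$ (i, k) * B $$ (k, i))"
      using assms(1,2) that by (simp add: scalar_prod_def)
    also have "\<dots> = (\<Sum>k\<in>{i}. A $$ (i, k) * B $$ (k, i))"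
      using that z by (intro sum.mono_neutral_right) (auto simp: nat_neq_iff)
    finally show ?thesis by simp
  qed
qed

lemma upper_triangular_pow:
  fixes A :: "'a :: semiring_1 mat"
  assumes "A \<in> carrier_mat n n" "upper_triangular A"
  shows "upper_triangular (A ^\<^sub>m k) \<and> (\<forall>i<n. (A ^\<^sub>m k) $$ (i, i) = (A $$ (i, i)) ^ k)"
proof (induction k)
  case 0 then show ?case using assms by auto
next
  case (Suc k)
  have "A ^\<^sub>m k \<in> carrier_mat n n" using assms by simp
  from upper_triangular_mult[OF this assms(1) _ assms(2)] Suc show ?case
    by (auto simp: power_commutes)
qed

text \<open>A similarity transformation makes the matrix upper triangular, and powers of a
  triangular matrix have the powers of its diagonal entries on the diagonal. One list of eigenvalues
  thus gives the traces of all powers.\<close>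

lemma mat_trace_pow_eigenvalues:
  fixes A :: "complex mat"
  assumes A: "A \<in> carrier_mat n n"
  obtains es where "length es = n" "\<And>e. e \<in> set es \<Longrightarrow> eigenvalue A e"
    "\<And>k. mat_trace (A ^\<^sub>m k) = (\<Sum>e\<leftarrow>es. e ^ k)"
proof -
  obtain es where es: "char_poly A = (\<Prod>a\<leftarrow>es. [:- a, 1:])" "length es = n"
    using char_poly_factorized[OF A] by auto
  obtain B P Q where "schur_decomposition A es = (B, P, Q)"
    by (metis prod_cases3)
  then have sim: "similar_mat_wit A B P Q" and ut: "upper_triangular B" and dg: "diag_mat B = es"
    using schur_decomposition[OF A es(1)] by auto
  note w = similar_mat_witD2[OF A sim]
  have B: "B \<in> carrier_mat n n" using w by auto
  have "mat_trace (A ^\<^sub>m k) = (\<Sum>e\<leftarrow>es. e ^ k)" for k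
  proof -
    have Bk: "B ^\<^sub>m k \<in> carrier_mat n n" using B by simp
    have "mat_trace (A ^\<^sub>m k) = mat_trace (P * B ^\<^sub>m k * Q)"
      using similar_mat_wit_pow_id[OF sim] by simp
    also have "\<dots> = mat_trace (Q * (P * B ^\<^sub>m k))"
      using w Bk by (intro mat_trace_mult_comm[of _ n n]) auto
    also have "Q * (P * B ^\<^sub>m k) = Q * P * B ^\<^sub>m k"
      using w Bk by (metis assoc_mult_mat)
    also have "\<dots> = B ^\<^sub>m k" using w Bk by simp
    also have "mat_trace (B ^\<^sub>m k) = (\<Sum>i<n. (B $$ (i, i)) ^ k)"
      using upper_triangular_pow[OF B ut, of k] Bk by (auto simp: mat_trace_def)
    also have "\<dots> = (\<Sum>e\<leftarrow>es. e ^ k)"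
      using dg B es(2) by (auto simp: diag_mat_def sum_list_sum_nth lessThan_atLeast0)
    finally show ?thesis .
  qed
  moreover have "eigenvalue A e" if "e \<in> set es" for e
    unfolding eigenvalue_root_char_poly[OF A] es(1) using that
    by (simp add: poly_prod_list prod_list_zero_iff o_def)
  ultimately show ?thesis using that es(2) by blast
qed

lemma eigenvectorE:
  assumes "eigenvalue A e" "A \<in> carrier_mat n n"
  obtains v where "v \<in> carrier_vec n" "v \<noteq> 0\<^sub>v n" "A *\<^sub>v v = e \<cdot>\<^sub>v v"
  using assms unfolding eigenvalue_def eigenvector_def by (metis carrier_matD(1))

text \<open>The eigenvalues of an idempotent are 0 and 1. This serves as a dimension bound in
  \<open>subspace_frame\<close>.\<close>

lemma idempotent_mat_trace_le:
  fixes A :: "complex mat"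
  assumes A: "A \<in> carrier_mat n n" and id: "A * A = A"
  shows "Re (mat_trace A) \<le> real n"
proof -
  obtain es where es: "length es = n" "\<And>e. e \<in> set es \<Longrightarrow> eigenvalue A e"
    and tr: "\<And>k. mat_trace (A ^\<^sub>m k) = (\<Sum>e\<leftarrow>es. e ^ k)"
    using mat_trace_pow_eigenvalues[OF A] by blast
  have e01: "Re e \<le> 1" if e: "e \<in> set es" for e
  proof -
    obtain v where v: "v \<in> carrier_vec n" "v \<noteq> 0\<^sub>v n" "A *\<^sub>v v = e \<cdot>\<^sub>v v"
      using eigenvectorE[OF es(2)[OF e] A] by blast
    have "e \<cdot>\<^sub>v v = (A * A) *\<^sub>v v" using id v by simp
    also have "\<dots> = A *\<^sub>v (e \<cdot>\<^sub>v v)" using v A by simp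
    also have "\<dots> = e \<cdot>\<^sub>v (e \<cdot>\<^sub>v v)" using v A by (simp add: mult_mat_vec)
    finally have eq: "e \<cdot>\<^sub>v v = (e * e) \<cdot>\<^sub>v v" using v by (simp add: smult_smult_assoc)
    obtain i where i: "i < n" "v $ i \<noteq> 0"
      using v(1,2) by (metis carrier_vecD eq_vecI index_zero_vec)
    have "e * v $ i = e * e * v $ i" using arg_cong[OF eq, of "\<lambda>u. u $ i"] i v(1) by simp
    then have "e = 0 \<or> e = 1" using i by simp
    then show ?thesis by auto
  qed
  have "mat_trace A = (\<Sum>e\<leftarrow>es. e)" using tr[of 1] A by simp
  also have "Re \<dots> = (\<Sum>e\<leftarrow>es. Re e)" by (induction es) auto
  also have "\<dots> \<le> (\<Sum>e\<leftarrow>es. 1)" by (intro sum_list_mono e01)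
  finally show ?thesis using es(1) by (simp add: sum_list_triv)
qed

lemma subspace_vec_iff:
  "VectorSpace.subspace class_ring W (module_vec TYPE(complex) n) \<longleftrightarrow>
     W \<subseteq> carrier_vec n \<and> 0\<^sub>v n \<in> W \<and> (\<forall>v\<in>W. \<forall>w\<in>W. v + w \<in> W) \<and> (\<forall>c. \<forall>v\<in>W. c \<cdot>\<^sub>v v \<in> W)"
proof -
  have "vectorspace class_ring (module_vec TYPE(complex) n)" by (rule vec_vs)
  moreover have "module class_ring (module_vec TYPE(complex) n)" by (rule vec_module)
  moreover have "carrier (class_ring :: complex ring) = UNIV" by (simp add: class_ring_simps)
  ultimately show ?thesis
    unfolding VectorSpace.subspace_def submodule_def module_vec_simps by simp fast
qed

text \<open>The columns of \<open>B\<close> form a basis of \<open>W\<close> and the rows of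
  \<open>L\<close> are a dual family of functionals, so that \<open>B * L\<close> is a projection
  onto \<open>W\<close>. Such a pair turns the restriction of a linear action to \<open>W\<close>
  into matrices. The proof takes a pair with \<open>d\<close> maximal: if a vector of
  \<open>W\<close> were not reproduced by \<open>B * L\<close>, its defect would be a further basis
  vector. The trace of the idempotent \<open>B * L\<close> is \<open>d\<close>, which bounds
  \<open>d\<close> by \<open>n\<close>.\<close>

lemma subspace_frame:
  assumes "VectorSpace.subspace class_ring W (module_vec TYPE(complex) n)"
  obtains d and B L :: "complex mat" where "B \<in> carrier_mat n d" "L \<in> carrier_mat d n" "L * B = 1\<^sub>m d"
    "\<And>v. v \<in> carrier_vec d \<Longrightarrow> B *\<^sub>v v \<in> W" "\<And>w. w \<in> W \<Longrightarrow> B *\<^sub>v (L *\<^sub>v w) = w" "d \<le> n"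
proof -
  have W: "W \<subseteq> carrier_vec n" "0\<^sub>v n \<in> W" and add: "\<And>v w. v \<in> W \<Longrightarrow> w \<in> W \<Longrightarrow> v + w \<in> W"
    and sm: "\<And>c v. v \<in> W \<Longrightarrow> c \<cdot>\<^sub>v v \<in> W"
    using assms by (auto simp: subspace_vec_iff)
  let ?F = "\<lambda>d. \<exists>B\<in>(carrier_mat n d :: complex mat set). \<exists>L\<in>carrier_mat d n. L * B = 1\<^sub>m d \<and> (\<forall>v\<in>carrier_vec d. B *\<^sub>v v \<in> W)"
  have bound: "d \<le> n" if F: "?F d" for d
  proof -
    from F obtain B L :: "complex mat" where BL: "B \<in> carrier_mat n d" "L \<in> carrier_mat d n" "L * B = 1\<^sub>m d" by blast
    have "(B * L) * (B * L) = B * (L * (B * L))" using BL by (intro assoc_mult_mat) auto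
    also have "L * (B * L) = (L * B) * L" using BL by (intro assoc_mult_mat[symmetric]) auto
    finally have "(B * L) * (B * L) = B * L" using BL by simp
    then have "Re (mat_trace (B * L)) \<le> n" using BL by (intro idempotent_mat_trace_le) auto
    also have "mat_trace (B * L) = of_nat d" using mat_trace_mult_comm[OF BL(1,2)] BL by simp
    finally show ?thesis by simp
  qed
  have "?F 0"
  proof (intro bexI conjI ballI)
    fix v :: "complex vec" assume "v \<in> carrier_vec 0"
    then have "0\<^sub>m n 0 *\<^sub>v v = 0\<^sub>v n" by (intro eq_vecI) (auto simp: scalar_prod_def)
    then show "0\<^sub>m n 0 *\<^sub>v v \<in> W" using W by simp
  qed auto
  then obtain d where d: "?F d" "\<And>d'. ?F d' \<Longrightarrow> d' \<le> d"
    using that[OF GreatestI_nat[of ?F 0 n, OF _ bound] Greatest_le_nat[of ?F _ n, OF _ bound]] by presburger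
  then obtain B L :: "complex mat" where B: "B \<in> carrier_mat n d" and L: "L \<in> carrier_mat d n" and LB: "L * B = 1\<^sub>m d"
    and BW: "\<And>v. v \<in> carrier_vec d \<Longrightarrow> B *\<^sub>v v \<in> W" by blast
  have "B *\<^sub>v (L *\<^sub>v w) = w" if w: "w \<in> W" for w
  proof (rule ccontr)
    assume ne: "B *\<^sub>v (L *\<^sub>v w) \<noteq> w"
    have wc: "w \<in> carrier_vec n" using w W by auto
    (* The defect of w, which the functionals in L annihilate; it becomes the new column. *)
    define u where "u = w + (-1) \<cdot>\<^sub>v (B *\<^sub>v (L *\<^sub>v w))"
    have uW: "u \<in> W" unfolding u_def using w wc L by (intro add sm BW) auto
    then have u: "u \<in> carrier_vec n" using W by auto
    have Lu: "L *\<^sub>v u = 0\<^sub>v d"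
    proof -
      have "L *\<^sub>v u = L *\<^sub>v w + (-1) \<cdot>\<^sub>v (L *\<^sub>v (B *\<^sub>v (L *\<^sub>v w)))"
        unfolding u_def using wc L B by (subst mult_add_distrib_mat_vec[of _ d n]) (auto simp: mult_mat_vec)
      also have "L *\<^sub>v (B *\<^sub>v (L *\<^sub>v w)) = (L * B) *\<^sub>v (L *\<^sub>v w)"
        using wc L B by (intro assoc_mult_mat_vec[symmetric]) auto
      finally show ?thesis using LB wc L by auto
    qed
    obtain i0 where i0: "i0 < n" "u $ i0 \<noteq> 0"
    proof -
      have "\<exists>i<n. u $ i \<noteq> 0"
      proof (rule ccontr)
        assume a: "\<not> ?thesis"
        have "w $ i = (B *\<^sub>v (L *\<^sub>v w)) $ i" if "i < n" for i
        proof -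
          have "u $ i = w $ i - (B *\<^sub>v (L *\<^sub>v w)) $ i" unfolding u_def using that B wc by simp
          then show ?thesis using a that by auto
        qed
        then have "w = B *\<^sub>v (L *\<^sub>v w)" using wc B by (intro eq_vecI) auto
        then show False using ne by simp
      qed
      then show ?thesis using that by blast
    qed
    (* The new functional: coordinate i0, corrected to vanish on the old columns and scaled to be
    1 on u. *)
    define l where "l k = ((if k = i0 then 1 else 0) - (B * L) $$ (i0, k)) / u $ i0" for k
    define B' where "B' = mat n (Suc d) (\<lambda>(i, j). if j < d then B $$ (i, j) else u $ i)"
    define L' where "L' = mat (Suc d) n (\<lambda>(i, j). if i < d then L $$ (i, j) else l j)"
    have lsum: "(\<Sum>k<n. l k * f k) = (f i0 - (\<Sum>k<n. (B * L) $$ (i0, k) * f k)) / u $ i0" for f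
      using i0(1) by (simp add: l_def left_diff_distrib sum_subtractf flip: sum_divide_distrib)
        (simp add: if_distrib[of "\<lambda>x. x * _"] cong: if_cong)
    have lB: "(\<Sum>k<n. l k * B $$ (k, j)) = 0" if "j < d" for j
    proof -
      have "(\<Sum>k<n. (B * L) $$ (i0, k) * B $$ (k, j)) = ((B * L) * B) $$ (i0, j)"
        using that i0 B L by (subst index_mult_mat) (auto simp: scalar_prod_def lessThan_atLeast0)
      also have "(B * L) * B = B * (L * B)" using B L by (intro assoc_mult_mat) auto
      finally show ?thesis unfolding lsum using LB B by simp
    qed
    have lu: "(\<Sum>k<n. l k * u $ k) = 1"
    proof -
      have "(\<Sum>k<n. (B * L) $$ (i0, k) * u $ k) = ((B * L) *\<^sub>v u) $ i0"
        using i0 B L u by (subst index_mult_mat_vec) (auto simp: scalar_prod_def lessThan_atLeast0)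
      also have "(B * L) *\<^sub>v u = B *\<^sub>v (L *\<^sub>v u)" using B L u by (intro assoc_mult_mat_vec) auto
      also have "\<dots> $ i0 = 0" unfolding Lu using B i0(1) by (simp add: scalar_prod_def)
      finally show ?thesis unfolding lsum using i0 by simp
    qed
    have B'c: "B' \<in> carrier_mat n (Suc d)" and L'c: "L' \<in> carrier_mat (Suc d) n"
      by (auto simp: B'_def L'_def)
    have "L' * B' = 1\<^sub>m (Suc d)"
    proof (rule eq_matI)
      fix i j assume "i < dim_row (1\<^sub>m (Suc d))" "j < dim_col (1\<^sub>m (Suc d))"
      then have ij: "i < Suc d" "j < Suc d" by auto
      have "(L' * B') $$ (i, j) = (\<Sum>k<n. L' $$ (i, k) * B' $$ (k, j))"
        using ij B'c L'c by (simp add: scalar_prod_def lessThan_atLeast0)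
      also have "\<dots> = 1\<^sub>m (Suc d) $$ (i, j)"
      proof (cases "i < d")
        case True
        show ?thesis
        proof (cases "j < d")
          case j: True
          have "(\<Sum>k<n. L' $$ (i, k) * B' $$ (k, j)) = (L * B) $$ (i, j)"
            using True j B L ij by (subst index_mult_mat) (auto simp: L'_def B'_def scalar_prod_def lessThan_atLeast0)
          then show ?thesis using LB True j by simp
        next
          case j: False
          have "(\<Sum>k<n. L' $$ (i, k) * B' $$ (k, j)) = (L *\<^sub>v u) $ i"
            using True j L u ij by (subst index_mult_mat_vec) (auto simp: L'_def B'_def scalar_prod_def lessThan_atLeast0)
          then show ?thesis using Lu True j ij by simp
        qed
      next
        case False
        then have i: "i = d" using ij by simp
        have "(\<Sum>k<n. L' $$ (i, k) * B' $$ (k, j)) = (\<Sum>k<n. l k * (if j < d then B $$ (k, j) else u $ k))"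
          using i ij by (auto simp: L'_def B'_def intro!: sum.cong)
        also have "\<dots> = (if j < d then 0 else 1)" using lB lu by auto
        finally show ?thesis using i ij by auto
      qed
      finally show "(L' * B') $$ (i, j) = 1\<^sub>m (Suc d) $$ (i, j)" .
    qed (use B'c L'c in auto)
    moreover have "B' *\<^sub>v v \<in> W" if v: "v \<in> carrier_vec (Suc d)" for v
    proof -
      have "B' *\<^sub>v v = B *\<^sub>v (vec d (\<lambda>i. v $ i)) + v $ d \<cdot>\<^sub>v u"
      proof (rule eq_vecI)
        fix i assume "i < dim_vec (B *\<^sub>v vec d (\<lambda>i. v $ i) + v $ d \<cdot>\<^sub>v u)"
        then have i: "i < n" using u by simp
        then show "(B' *\<^sub>v v) $ i = (B *\<^sub>v vec d (\<lambda>i. v $ i) + v $ d \<cdot>\<^sub>v u) $ i"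
          using v B u by (simp add: B'_def scalar_prod_def)
      qed (use u B'c in auto)
      then show ?thesis using uW BW by (auto intro!: add sm)
    qed
    ultimately have "?F (Suc d)" using B'c L'c by blast
    then show False using d(2) by force
  qed
  then show ?thesis using that[OF B L LB] BW bound[OF d(1)] by blast
qed

section \<open>Schur's lemma\<close>

lemma GL_carrierD: "A \<in> carrier (GL n) \<Longrightarrow> A \<in> carrier_mat n n"
  by (auto simp: GL_def units_of_def Units_def ring_mat_simps)

lemma mult_GL [simp]: "A \<otimes>\<^bsub>GL n\<^esub> B = A * B"
  by (simp add: GL_def units_of_def ring_mat_simps)

lemma one_GL [simp]: "\<one>\<^bsub>GL n\<^esub> = 1\<^sub>m n"
  by (simp add: GL_def units_of_def ring_mat_simps)

lemma group_GL: "Group.group (GL n)"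
proof -
  interpret R: Ring.ring "ring_mat TYPE(complex) n ()" by (rule ring_mat)
  show ?thesis unfolding GL_def by (rule R.units_group)
qed

lemma matrix_eq_0I:
  fixes S :: "complex mat"
  assumes "S \<in> carrier_mat n m" "\<And>v. v \<in> carrier_vec m \<Longrightarrow> S *\<^sub>v v = 0\<^sub>v n"
  shows "S = 0\<^sub>m n m"
proof (rule eq_matI)
  fix i j assume "i < dim_row (0\<^sub>m n m)" "j < dim_col (0\<^sub>m n m)"
  then have ij: "i < n" "j < m" by auto
  have "S $$ (i, j) = (S *\<^sub>v unit_vec m j) $ i" using ij assms(1) by simp
  then show "S $$ (i, j) = 0\<^sub>m n m $$ (i, j)" using assms(2)[of "unit_vec m j"] ij by simp
qed (use assms in auto)

lemma minus_mat_eq_0D: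
  fixes A B :: "complex mat"
  assumes A: "A \<in> carrier_mat n m" and B: "B \<in> carrier_mat n m" and eq: "A - B = 0\<^sub>m n m"
  shows "A = B"
proof (rule eq_matI)
  fix i j assume "i < dim_row B" "j < dim_col B"
  then have ij: "i < n" "j < m" using B by auto
  have "A $$ (i, j) - B $$ (i, j) = (A - B) $$ (i, j)" using ij A B by simp
  then show "A $$ (i, j) = B $$ (i, j)" using ij unfolding eq by simp
qed (use A B in auto)

lemma mult_mat_zero_vec [simp]:
  fixes A :: "complex mat"
  shows "A \<in> carrier_mat n m \<Longrightarrow> A *\<^sub>v 0\<^sub>v m = 0\<^sub>v n"
  by (intro eq_vecI) (auto simp: scalar_prod_def)

lemma irreducible_repD:
  assumes "irreducible_rep G n \<rho>"
  shows "\<rho> \<in> hom G (GL n)" "0 < n"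
    "VectorSpace.subspace class_ring W (module_vec TYPE(complex) n) \<Longrightarrow>
      (\<And>g w. g \<in> carrier G \<Longrightarrow> w \<in> W \<Longrightarrow> \<rho> g *\<^sub>v w \<in> W) \<Longrightarrow> W = {0\<^sub>v n} \<or> W = carrier_vec n"
  using assms unfolding irreducible_rep_def by metis+

text \<open>The entrywise sum with explicit dimensions, because matrices of unspecified dimensions
  have no common zero and form no additive monoid.\<close>

definition msum :: "nat \<Rightarrow> nat \<Rightarrow> ('g \<Rightarrow> complex mat) \<Rightarrow> 'g set \<Rightarrow> complex mat" where
  "msum n m f A = mat n m (\<lambda>(i, j). \<Sum>g\<in>A. f g $$ (i, j))"

lemma msum_carrier [simp]: "msum n m f A \<in> carrier_mat n m"
  by (simp add: msum_def)

lemma msum_cong: "(\<And>g. g \<in> A \<Longrightarrow> f g = f' g) \<Longrightarrow> msum n m f A = msum n m f' A"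
  by (simp add: msum_def)

lemma msum_reindex: "bij_betw h B A \<Longrightarrow> msum n m f A = msum n m (\<lambda>g. f (h g)) B"
  by (auto simp: msum_def intro!: eq_matI sum.reindex_bij_betw[symmetric])

lemma mult_msum:
  assumes "C \<in> carrier_mat k n" "\<And>g. g \<in> A \<Longrightarrow> f g \<in> carrier_mat n m"
  shows "C * msum n m f A = msum k m (\<lambda>g. C * f g) A"
proof (rule eq_matI)
  fix i j assume "i < dim_row (msum k m (\<lambda>g. C * f g) A)" "j < dim_col (msum k m (\<lambda>g. C * f g) A)"
  then have ij: "i < k" "j < m" by (auto simp: msum_def)
  have "(C * msum n m f A) $$ (i, j) = (\<Sum>l\<in>{0..<n}. \<Sum>g\<in>A. C $$ (i, l) * f g $$ (l, j))"
    using ij assms(1) by (simp add: msum_def scalar_prod_def sum_distrib_left)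
  also have "\<dots> = (\<Sum>g\<in>A. \<Sum>l\<in>{0..<n}. C $$ (i, l) * f g $$ (l, j))" by (rule sum.swap)
  also have "\<dots> = (\<Sum>g\<in>A. (C * f g) $$ (i, j))"
  proof (intro sum.cong refl)
    fix g assume "g \<in> A"
    then show "(\<Sum>l\<in>{0..<n}. C $$ (i, l) * f g $$ (l, j)) = (C * f g) $$ (i, j)"
      using ij assms(1) assms(2)[of g] by (simp add: scalar_prod_def)
  qed
  finally show "(C * msum n m f A) $$ (i, j) = msum k m (\<lambda>g. C * f g) A $$ (i, j)"
    using ij by (simp add: msum_def)
qed (use assms in \<open>auto simp: msum_def\<close>)

lemma msum_mult:
  assumes "C \<in> carrier_mat m k" "\<And>g. g \<in> A \<Longrightarrow> f g \<in> carrier_mat n m"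
  shows "msum n m f A * C = msum n k (\<lambda>g. f g * C) A"
proof (rule eq_matI)
  fix i j assume "i < dim_row (msum n k (\<lambda>g. f g * C) A)" "j < dim_col (msum n k (\<lambda>g. f g * C) A)"
  then have ij: "i < n" "j < k" by (auto simp: msum_def)
  have "(msum n m f A * C) $$ (i, j) = (\<Sum>l\<in>{0..<m}. \<Sum>g\<in>A. f g $$ (i, l) * C $$ (l, j))"
    using ij assms(1) by (simp add: msum_def scalar_prod_def sum_distrib_right)
  also have "\<dots> = (\<Sum>g\<in>A. \<Sum>l\<in>{0..<m}. f g $$ (i, l) * C $$ (l, j))" by (rule sum.swap)
  also have "\<dots> = (\<Sum>g\<in>A. (f g * C) $$ (i, j))"
  proof (intro sum.cong refl)
    fix g assume "g \<in> A"
    then show "(\<Sum>l\<in>{0..<m}. f g $$ (i, l) * C $$ (l, j)) = (f g * C) $$ (i, j)"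
      using ij assms(1) assms(2)[of g] by (simp add: scalar_prod_def)
  qed
  finally show "(msum n m f A * C) $$ (i, j) = msum n k (\<lambda>g. f g * C) A $$ (i, j)"
    using ij by (simp add: msum_def)
qed (use assms in \<open>auto simp: msum_def\<close>)

lemma mat_trace_msum:
  assumes "\<And>g. g \<in> A \<Longrightarrow> f g \<in> carrier_mat n n"
  shows "mat_trace (msum n n f A) = (\<Sum>g\<in>A. mat_trace (f g))"
proof -
  have "mat_trace (msum n n f A) = (\<Sum>i<n. \<Sum>g\<in>A. f g $$ (i, i))"
    by (simp add: mat_trace_def msum_def)
  also have "\<dots> = (\<Sum>g\<in>A. \<Sum>i<n. f g $$ (i, i))" by (rule sum.swap)
  also have "\<dots> = (\<Sum>g\<in>A. mat_trace (f g))"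
    using assms by (intro sum.cong) (auto simp: mat_trace_def)
  finally show ?thesis .
qed

locale finite_group = Group.group G for G (structure) +
  assumes fin [simp]: "finite (carrier G)"
begin

lemma order_pos: "Coset.order G > 0"
  using fin order_gt_0_iff_finite by simp

lemma rep_carrier: "\<rho> \<in> hom G (GL n) \<Longrightarrow> g \<in> carrier G \<Longrightarrow> \<rho> g \<in> carrier_mat n n"
  by (rule GL_carrierD[OF hom_in_carrier])

lemma rep_mult: "\<rho> \<in> hom G (GL n) \<Longrightarrow> g \<in> carrier G \<Longrightarrow> h \<in> carrier G \<Longrightarrow> \<rho> (g \<otimes> h) = \<rho> g * \<rho> h"
  by (simp add: hom_mult)

lemma rep_one: "\<rho> \<in> hom G (GL n) \<Longrightarrow> \<rho> \<one> = 1\<^sub>m n"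
  using hom_one[of \<rho> G "GL n"] group_GL is_group by simp

lemma repI:
  assumes "\<And>g. g \<in> carrier G \<Longrightarrow> \<rho> g \<in> carrier_mat n n"
    and "\<And>g h. g \<in> carrier G \<Longrightarrow> h \<in> carrier G \<Longrightarrow> \<rho> (g \<otimes> h) = \<rho> g * \<rho> h" and "\<rho> \<one> = 1\<^sub>m n"
  shows "\<rho> \<in> hom G (GL n)"
proof (rule homI)
  fix g assume g: "g \<in> carrier G"
  have "\<rho> (inv g) * \<rho> g = 1\<^sub>m n" "\<rho> g * \<rho> (inv g) = 1\<^sub>m n"
    using g assms(2)[of g "inv g"] assms(2)[of "inv g" g] assms(3) by auto
  then show "\<rho> g \<in> carrier (GL n)"
    using assms(1) g by (auto simp: GL_def units_of_def Units_def ring_mat_simps intro!: bexI[of _ "\<rho> (inv g)"])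
qed (use assms in auto)

lemma rep_pow:
  assumes "\<rho> \<in> hom G (GL n)" "g \<in> carrier G"
  shows "\<rho> (g [^] (k::nat)) = \<rho> g ^\<^sub>m k"
  using assms rep_carrier[OF assms] by (induction k) (auto simp: rep_one rep_mult)

text \<open>The kernel and the range of an intertwiner are invariant subspaces, so a nonzero
  intertwiner has trivial kernel and full range.\<close>

lemma schur_intertwiner:
  assumes r: "irreducible_rep G n \<rho>" and r': "irreducible_rep G m \<rho>'"
    and S: "S \<in> carrier_mat n m" and int: "\<And>g. g \<in> carrier G \<Longrightarrow> \<rho> g * S = S * \<rho>' g"
    and nz: "S \<noteq> 0\<^sub>m n m"
  obtains Y where "Y \<in> carrier_mat m n" "S * Y = 1\<^sub>m n" "Y * S = 1\<^sub>m m"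
proof -
  have h: "\<rho> \<in> hom G (GL n)" and h': "\<rho>' \<in> hom G (GL m)" using r r' by (simp_all add: irreducible_repD(1))
  note c = rep_carrier[OF h] and c' = rep_carrier[OF h']
  have act: "\<rho> g *\<^sub>v (S *\<^sub>v v) = S *\<^sub>v (\<rho>' g *\<^sub>v v)" if "g \<in> carrier G" "v \<in> carrier_vec m" for g v
    using assoc_mult_mat_vec[OF c[OF that(1)] S that(2)] assoc_mult_mat_vec[OF S c'[OF that(1)] that(2)]
      int[OF that(1)] by simp
  let ?K = "{v \<in> carrier_vec m. S *\<^sub>v v = 0\<^sub>v n}"
  have "VectorSpace.subspace class_ring ?K (module_vec TYPE(complex) m)"
    using S by (auto simp: subspace_vec_iff mult_add_distrib_mat_vec[OF S] mult_mat_vec[OF S])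
  moreover have "\<rho>' g *\<^sub>v w \<in> ?K" if "g \<in> carrier G" "w \<in> ?K" for g w
    using act[OF that(1), of w] that c'[OF that(1)] mult_mat_zero_vec[OF c[OF that(1)]] by auto
  ultimately have "?K = {0\<^sub>v m} \<or> ?K = carrier_vec m"
    by (intro irreducible_repD(3)[OF r'])
  moreover have "?K \<noteq> carrier_vec m" using matrix_eq_0I[OF S] nz by blast
  ultimately have K: "?K = {0\<^sub>v m}" by blast
  let ?I = "(\<lambda>v. S *\<^sub>v v) ` carrier_vec m"
  have "VectorSpace.subspace class_ring ?I (module_vec TYPE(complex) n)"
    unfolding subspace_vec_iff
  proof (intro conjI ballI allI)
    have "S *\<^sub>v 0\<^sub>v m = 0\<^sub>v n" by (rule mult_mat_zero_vec[OF S])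
    then show "0\<^sub>v n \<in> ?I" by (metis imageI zero_carrier_vec)
    fix v w assume "v \<in> ?I" "w \<in> ?I"
    then obtain a b where ab: "a \<in> carrier_vec m" "b \<in> carrier_vec m" "v = S *\<^sub>v a" "w = S *\<^sub>v b" by auto
    then have "v + w = S *\<^sub>v (a + b)" using S by (simp add: mult_add_distrib_mat_vec)
    then show "v + w \<in> ?I" using ab(1,2) by (intro image_eqI[of _ _ "a + b"]) auto
  next
    fix v and k :: complex assume "v \<in> ?I"
    then obtain a where a: "a \<in> carrier_vec m" "v = S *\<^sub>v a" by auto
    then have "k \<cdot>\<^sub>v v = S *\<^sub>v (k \<cdot>\<^sub>v a)" using S by (simp add: mult_mat_vec)
    then show "k \<cdot>\<^sub>v v \<in> ?I" using a(1) by (intro image_eqI[of _ _ "k \<cdot>\<^sub>v a"]) auto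
  qed (use S in auto)
  moreover have "\<rho> g *\<^sub>v w \<in> ?I" if "g \<in> carrier G" "w \<in> ?I" for g w
    using act[OF that(1)] that c'[OF that(1)] by auto
  ultimately have "?I = {0\<^sub>v n} \<or> ?I = carrier_vec n"
    by (intro irreducible_repD(3)[OF r])
  moreover have "?I \<noteq> {0\<^sub>v n}"
  proof
    assume "?I = {0\<^sub>v n}"
    then have "S = 0\<^sub>m n m" by (intro matrix_eq_0I[OF S]) blast
    then show False using nz by simp
  qed
  ultimately have I: "?I = carrier_vec n" by blast
  have "\<forall>i. \<exists>y. y \<in> carrier_vec m \<and> S *\<^sub>v y = unit_vec n i"
  proof
    fix i
    have "unit_vec n i \<in> ?I" unfolding I by simp
    then show "\<exists>y. y \<in> carrier_vec m \<and> S *\<^sub>v y = unit_vec n i" by (metis imageE)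
  qed
  then obtain y where y: "\<And>i. y i \<in> carrier_vec m" "\<And>i. S *\<^sub>v y i = unit_vec n i" by metis
  define Y where "Y = mat m n (\<lambda>(i, j). y j $ i)"
  have Y: "Y \<in> carrier_mat m n" by (simp add: Y_def)
  have colY: "col Y j = y j" if "j < n" for j using that y(1)[of j] by (auto simp: Y_def)
  have XY: "S * Y = 1\<^sub>m n"
  proof (rule eq_matI)
    fix i j assume "i < dim_row (1\<^sub>m n)" "j < dim_col (1\<^sub>m n)"
    then have ij: "i < n" "j < n" by auto
    have "(S * Y) $$ (i, j) = (S *\<^sub>v y j) $ i" using ij S Y colY by simp
    then show "(S * Y) $$ (i, j) = 1\<^sub>m n $$ (i, j)" using y(2)[of j] ij by simp
  qed (use S Y in auto)
  have "Y * S - 1\<^sub>m m = 0\<^sub>m m m"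
  proof (rule matrix_eq_0I)
    fix v :: "complex vec" assume v: "v \<in> carrier_vec m"
    let ?w = "Y *\<^sub>v (S *\<^sub>v v) - v"
    have "S *\<^sub>v ?w = S *\<^sub>v (Y *\<^sub>v (S *\<^sub>v v)) - S *\<^sub>v v"
      using S Y v by (intro mult_minus_distrib_mat_vec) auto
    also have "S *\<^sub>v (Y *\<^sub>v (S *\<^sub>v v)) = S * Y *\<^sub>v (S *\<^sub>v v)"
      using S Y v by (intro assoc_mult_mat_vec[symmetric]) auto
    finally have "S *\<^sub>v ?w = 0\<^sub>v n" using XY S v by simp
    then have "?w \<in> ?K" using S Y v by auto
    then have "?w = 0\<^sub>v m" using K by blast
    moreover have "(Y * S - 1\<^sub>m m) *\<^sub>v v = Y * S *\<^sub>v v - 1\<^sub>m m *\<^sub>v v"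
      by (rule minus_mult_distrib_mat_vec[OF mult_carrier_mat[OF Y S] one_carrier_mat v])
    moreover have "Y * S *\<^sub>v v = Y *\<^sub>v (S *\<^sub>v v)" by (rule assoc_mult_mat_vec[OF Y S v])
    ultimately show "(Y * S - 1\<^sub>m m) *\<^sub>v v = 0\<^sub>v m" using v by simp
  qed (use S Y in auto)
  then have "Y * S = 1\<^sub>m m" by (rule minus_mat_eq_0D[OF mult_carrier_mat[OF Y S] one_carrier_mat])
  then show ?thesis using that[OF Y XY] by blast
qed

text \<open>Subtracting an eigenvalue leaves an intertwiner with nontrivial kernel, which must be
  0.\<close>

lemma schur_scalar:
  assumes r: "irreducible_rep G n \<rho>" and S: "S \<in> carrier_mat n n"
    and int: "\<And>g. g \<in> carrier G \<Longrightarrow> \<rho> g * S = S * \<rho> g"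
  obtains c where "S = c \<cdot>\<^sub>m 1\<^sub>m n"
proof -
  have h: "\<rho> \<in> hom G (GL n)" and n: "n > 0" using irreducible_repD[OF r] by auto
  note c = rep_carrier[OF h]
  obtain es where es: "length es = n" "\<And>e. e \<in> set es \<Longrightarrow> eigenvalue S e"
    using mat_trace_pow_eigenvalues[OF S] by blast
  obtain e where e: "eigenvalue S e" using es n by (cases es) auto
  obtain v where v: "v \<in> carrier_vec n" "v \<noteq> 0\<^sub>v n" "S *\<^sub>v v = e \<cdot>\<^sub>v v" using eigenvectorE[OF e S] by blast
  let ?Z = "S - e \<cdot>\<^sub>m 1\<^sub>m n"
  have Z: "?Z \<in> carrier_mat n n" using S by auto
  have Zv: "?Z *\<^sub>v v = 0\<^sub>v n"
    proof -
    have "(e \<cdot>\<^sub>m 1\<^sub>m n) *\<^sub>v v = e \<cdot>\<^sub>v v"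
      using v by (intro eq_vecI) auto
    then show ?thesis
      using minus_mult_distrib_mat_vec[of S n n "e \<cdot>\<^sub>m 1\<^sub>m n" v] S v by simp
  qed
  have "?Z = 0\<^sub>m n n"
  proof (rule ccontr)
    assume nz: "?Z \<noteq> 0\<^sub>m n n"
    have "\<rho> g * ?Z = ?Z * \<rho> g" if g: "g \<in> carrier G" for g
      using c[OF g] S int[OF g] mult_smult_distrib[OF c[OF g] one_carrier_mat[of n], of e]
        mult_smult_assoc_mat[OF one_carrier_mat c[OF g], of e]
      by (simp add: mult_minus_distrib_mat[of _ n n] minus_mult_distrib_mat[of _ n n])
    then obtain Y where Y: "Y \<in> carrier_mat n n" "Y * ?Z = 1\<^sub>m n"
      using schur_intertwiner[OF r r Z _ nz] by metis
    have "v = (Y * ?Z) *\<^sub>v v" unfolding Y(2) using v by simp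
    also have "\<dots> = Y *\<^sub>v (?Z *\<^sub>v v)" using Y Z v by (intro assoc_mult_mat_vec) auto
    also have "\<dots> = 0\<^sub>v n" unfolding Zv by (rule mult_mat_zero_vec[OF Y(1)])
    finally show False using v(2) by contradiction
  qed
  then have "S = e \<cdot>\<^sub>m 1\<^sub>m n" by (intro minus_mat_eq_0D[OF S]) auto
  then show ?thesis using that by blast
qed

end

section \<open>Orthogonality of irreducible characters\<close>

context finite_group
begin

lemma bij_left_mult: "a \<in> carrier G \<Longrightarrow> bij_betw (\<lambda>g. a \<otimes> g) (carrier G) (carrier G)"
  by (rule bij_betw_byWitness[where f' = "\<lambda>g. inv a \<otimes> g"]) (auto simp: m_assoc[symmetric])

lemma bij_right_mult: "a \<in> carrier G \<Longrightarrow> bij_betw (\<lambda>g. g \<otimes> a) (carrier G) (carrier G)"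
  by (rule bij_betw_byWitness[where f' = "\<lambda>g. g \<otimes> inv a"]) (auto simp: m_assoc)

lemma bij_conj: "a \<in> carrier G \<Longrightarrow> bij_betw (\<lambda>g. a \<otimes> g \<otimes> inv a) (carrier G) (carrier G)"
  by (rule bij_betw_byWitness[where f' = "\<lambda>g. inv a \<otimes> g \<otimes> a"])
    (auto simp: m_assoc inv_mult_group simp flip: m_assoc[of "inv a" a] m_assoc[of a "inv a"])

lemmas sum_left_mult = sum.reindex_bij_betw[OF bij_left_mult]
lemmas sum_right_mult = sum.reindex_bij_betw[OF bij_right_mult]
lemmas sum_conj = sum.reindex_bij_betw[OF bij_conj]

definition class_fun :: "('a \<Rightarrow> complex) \<Rightarrow> bool" where
  "class_fun f \<longleftrightarrow> (\<forall>g\<in>carrier G. \<forall>h\<in>carrier G. f (h \<otimes> g \<otimes> inv h) = f g)"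

lemma class_funD: "class_fun f \<Longrightarrow> g \<in> carrier G \<Longrightarrow> h \<in> carrier G \<Longrightarrow> f (h \<otimes> g \<otimes> inv h) = f g"
  by (simp add: class_fun_def)

lemma class_fun_swap:
  assumes "class_fun f" "g \<in> carrier G" "h \<in> carrier G"
  shows "f (g \<otimes> h) = f (h \<otimes> g)"
  using class_funD[OF assms(1), of "g \<otimes> h" "h"] assms by (simp add: m_assoc)

lemma rep_inv:
  assumes "\<rho> \<in> hom G (GL n)" "g \<in> carrier G"
  shows "\<rho> g * \<rho> (inv g) = 1\<^sub>m n" "\<rho> (inv g) * \<rho> g = 1\<^sub>m n"
  using rep_mult[OF assms(1), of g "inv g"] rep_mult[OF assms(1), of "inv g" g] rep_one[OF assms(1)] assms(2)
  by auto

lemma mat_trace_rep_swap: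
  assumes "\<rho> \<in> hom G (GL n)" "g \<in> carrier G" "h \<in> carrier G"
  shows "mat_trace (\<rho> (g \<otimes> h)) = mat_trace (\<rho> (h \<otimes> g))"
  using mat_trace_mult_comm[OF rep_carrier[OF assms(1,2)] rep_carrier[OF assms(1,3)]]
    rep_mult[OF assms(1)] assms(2,3) by simp

lemma class_fun_mat_trace:
  assumes "\<rho> \<in> hom G (GL n)"
  shows "class_fun (\<lambda>g. mat_trace (\<rho> g))"
  unfolding class_fun_def
proof (intro ballI)
  fix g h assume gh: "g \<in> carrier G" "h \<in> carrier G"
  have "mat_trace (\<rho> (h \<otimes> g \<otimes> inv h)) = mat_trace (\<rho> (inv h \<otimes> (h \<otimes> g)))"
    using gh by (intro mat_trace_rep_swap[OF assms]) auto
  then show "mat_trace (\<rho> (h \<otimes> g \<otimes> inv h)) = mat_trace (\<rho> g)"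
    using gh by (simp add: m_assoc[symmetric])
qed

lemma IrrE:
  assumes "\<chi> \<in> Irr G"
  obtains n \<rho> where "irreducible_rep G n \<rho>" "\<And>g. g \<in> carrier G \<Longrightarrow> \<chi> g = mat_trace (\<rho> g)"
  using assms unfolding Irr_def character_of_def by (smt (verit, best) mem_Collect_eq restrict_apply')

lemma Irr_class_fun: "\<chi> \<in> Irr G \<Longrightarrow> class_fun \<chi>"
proof -
  assume "\<chi> \<in> Irr G"
  then obtain n \<rho> where r: "irreducible_rep G n \<rho>" and c: "\<And>g. g \<in> carrier G \<Longrightarrow> \<chi> g = mat_trace (\<rho> g)"
    using IrrE[of \<chi>] by metis
  show ?thesis
    using class_fun_mat_trace[OF irreducible_repD(1)[OF r]] c by (simp add: class_fun_def)
qed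

lemma Irr_ext: "\<chi> \<in> Irr G \<Longrightarrow> \<chi> \<in> extensional (carrier G)"
  unfolding Irr_def character_of_def by auto

lemma Irr_eqI:
  assumes "\<chi> \<in> Irr G" "\<psi> \<in> Irr G" "\<And>g. g \<in> carrier G \<Longrightarrow> \<chi> g = \<psi> g"
  shows "\<chi> = \<psi>"
  using extensionalityI[OF Irr_ext[OF assms(1)] Irr_ext[OF assms(2)]] assms(3) by blast

text \<open>The scalar of Schur's lemma is determined by the trace. This is the form in which the
  lemma is applied below.\<close>

lemma schur_trace:
  assumes r: "irreducible_rep G n \<rho>" and S: "S \<in> carrier_mat n n"
    and int: "\<And>g. g \<in> carrier G \<Longrightarrow> \<rho> g * S = S * \<rho> g"
  shows "S = (mat_trace S / of_nat n) \<cdot>\<^sub>m 1\<^sub>m n"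
proof -
  obtain c where c: "S = c \<cdot>\<^sub>m 1\<^sub>m n" using schur_scalar[OF r S int] by metis
  then have "mat_trace S = c * of_nat n" by (simp add: mat_trace_smult[of _ n])
  then show ?thesis using c irreducible_repD(2)[OF r] by simp
qed

definition unit_mat :: "nat \<Rightarrow> nat \<Rightarrow> nat \<Rightarrow> nat \<Rightarrow> complex mat" where
  "unit_mat n m i k = mat n m (\<lambda>(a, b). if a = i \<and> b = k then 1 else 0)"

lemma mult_unit_mat_mult:
  assumes A: "A \<in> carrier_mat n n" and B: "B \<in> carrier_mat m m" and "i < n" "k < m"
  shows "(A * unit_mat n m i k * B) $$ (i, k) = A $$ (i, i) * B $$ (k, k)"
proof -
  have AU: "(A * unit_mat n m i k) $$ (i, b) = (if b = k then A $$ (i, i) else 0)" if "b < m" for b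
    using assms that by (simp add: unit_mat_def scalar_prod_def if_distrib cong: if_cong)
  have "(A * unit_mat n m i k * B) $$ (i, k) = (\<Sum>b\<in>{0..<m}. (A * unit_mat n m i k) $$ (i, b) * B $$ (b, k))"
    using assms by (subst index_mult_mat) (auto simp: scalar_prod_def unit_mat_def)
  also have "\<dots> = (\<Sum>b\<in>{0..<m}. if b = k then A $$ (i, i) * B $$ (k, k) else 0)"
    using AU by (intro sum.cong) auto
  finally show ?thesis using assms by simp
qed

text \<open>Expresses the product of two traces through averages of the matrix units, to which
  Schur's lemma applies.\<close>

lemma mat_trace_rep_prod_sum:
  assumes h: "\<rho> \<in> hom G (GL n)" and h': "\<rho>' \<in> hom G (GL m)"
  shows "(\<Sum>g\<in>carrier G. mat_trace (\<rho> g) * mat_trace (\<rho>' (inv g))) =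
    (\<Sum>i<n. \<Sum>k<m. msum n m (\<lambda>g. \<rho> g * unit_mat n m i k * \<rho>' (inv g)) (carrier G) $$ (i, k))"
proof -
  have "mat_trace (\<rho> g) * mat_trace (\<rho>' (inv g)) =
      (\<Sum>i<n. \<Sum>k<m. (\<rho> g * unit_mat n m i k * \<rho>' (inv g)) $$ (i, k))" if g: "g \<in> carrier G" for g
  proof -
    have c: "\<rho> g \<in> carrier_mat n n" "\<rho>' (inv g) \<in> carrier_mat m m"
      using rep_carrier[OF h g] rep_carrier[OF h'] g by auto
    then have "mat_trace (\<rho> g) * mat_trace (\<rho>' (inv g)) = (\<Sum>i<n. \<Sum>k<m. \<rho> g $$ (i, i) * \<rho>' (inv g) $$ (k, k))"
      by (simp add: mat_trace_def sum_product)
    then show ?thesis using mult_unit_mat_mult[OF c] by simp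
  qed
  then have "(\<Sum>g\<in>carrier G. mat_trace (\<rho> g) * mat_trace (\<rho>' (inv g))) =
    (\<Sum>g\<in>carrier G. \<Sum>i<n. \<Sum>k<m. (\<rho> g * unit_mat n m i k * \<rho>' (inv g)) $$ (i, k))" by simp
  also have "\<dots> = (\<Sum>i<n. \<Sum>g\<in>carrier G. \<Sum>k<m. (\<rho> g * unit_mat n m i k * \<rho>' (inv g)) $$ (i, k))"
    by (rule sum.swap)
  also have "\<dots> = (\<Sum>i<n. \<Sum>k<m. \<Sum>g\<in>carrier G. (\<rho> g * unit_mat n m i k * \<rho>' (inv g)) $$ (i, k))"
    by (intro sum.cong refl sum.swap)
  finally show ?thesis by (simp add: msum_def)
qed

text \<open>Left multiplication by \<open>a\<close> permutes the summands.\<close>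

lemma averaged_intertwiner:
  assumes h: "\<rho> \<in> hom G (GL n)" and h': "\<rho>' \<in> hom G (GL m)" and U: "U \<in> carrier_mat n m"
    and a: "a \<in> carrier G"
  defines "S \<equiv> msum n m (\<lambda>g. \<rho> g * U * \<rho>' (inv g)) (carrier G)"
  shows "\<rho> a * S = S * \<rho>' a"
proof -
  note c = rep_carrier[OF h] and c' = rep_carrier[OF h']
  have car: "\<rho> g * U * \<rho>' (inv g) \<in> carrier_mat n m" if "g \<in> carrier G" for g
    using mult_carrier_mat[OF mult_carrier_mat[OF c[OF that] U] c'[OF inv_closed[OF that]]] .
  have "\<rho> a * S = msum n m (\<lambda>g. \<rho> a * (\<rho> g * U * \<rho>' (inv g))) (carrier G)"
    unfolding S_def by (rule mult_msum[OF c[OF a] car])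
  also have "\<dots> = msum n m (\<lambda>g. \<rho> (a \<otimes> g) * U * \<rho>' (inv (a \<otimes> g)) * \<rho>' a) (carrier G)"
  proof (rule msum_cong)
    fix g assume g: "g \<in> carrier G"
    have ia: "inv g = inv (a \<otimes> g) \<otimes> a" using g a by (simp add: inv_mult_group m_assoc)
    have agc: "a \<otimes> g \<in> carrier G" and ig: "inv g \<in> carrier G" "inv (a \<otimes> g) \<in> carrier G" using a g by auto
    have "\<rho> a * (\<rho> g * U * \<rho>' (inv g)) = \<rho> a * (\<rho> g * U) * \<rho>' (inv g)"
      by (rule assoc_mult_mat[OF c[OF a] mult_carrier_mat[OF c[OF g] U] c'[OF ig(1)], symmetric])
    also have "\<rho> a * (\<rho> g * U) = \<rho> (a \<otimes> g) * U"
      unfolding rep_mult[OF h a g] by (rule assoc_mult_mat[OF c[OF a] c[OF g] U, symmetric])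
    finally have e1: "\<rho> a * (\<rho> g * U * \<rho>' (inv g)) = \<rho> (a \<otimes> g) * U * \<rho>' (inv g)" .
    have e2: "\<rho>' (inv g) = \<rho>' (inv (a \<otimes> g)) * \<rho>' a"
      using rep_mult[OF h' ig(2) a] ia by simp
    have "\<rho> (a \<otimes> g) * U * (\<rho>' (inv (a \<otimes> g)) * \<rho>' a) = \<rho> (a \<otimes> g) * U * \<rho>' (inv (a \<otimes> g)) * \<rho>' a"
      by (rule assoc_mult_mat[OF mult_carrier_mat[OF c[OF agc] U] c'[OF ig(2)] c'[OF a], symmetric])
    then show "\<rho> a * (\<rho> g * U * \<rho>' (inv g)) = \<rho> (a \<otimes> g) * U * \<rho>' (inv (a \<otimes> g)) * \<rho>' a"
      unfolding e1 by (simp only: e2)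
  qed
  also have "\<dots> = msum n m (\<lambda>g. \<rho> g * U * \<rho>' (inv g) * \<rho>' a) (carrier G)"
    by (rule msum_reindex[OF bij_left_mult[OF a], symmetric])
  also have "\<dots> = S * \<rho>' a"
    unfolding S_def by (rule msum_mult[OF c'[OF a] car, symmetric])
  finally show ?thesis .
qed

text \<open>An averaged matrix that is not 0 would be an invertible intertwiner and make the two
  characters equal. Inverses take the place of complex conjugates, which keeps the form
  bilinear.\<close>

lemma Irr_orthogonal:
  assumes "\<chi> \<in> Irr G" "\<psi> \<in> Irr G" "\<chi> \<noteq> \<psi>"
  shows "(\<Sum>g\<in>carrier G. \<chi> g * \<psi> (inv g)) = 0"
proof -
  obtain n \<rho> where r: "irreducible_rep G n \<rho>" and c: "\<And>g. g \<in> carrier G \<Longrightarrow> \<chi> g = mat_trace (\<rho> g)"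
    using IrrE[OF assms(1)] by metis
  obtain m \<rho>' where r': "irreducible_rep G m \<rho>'" and c': "\<And>g. g \<in> carrier G \<Longrightarrow> \<psi> g = mat_trace (\<rho>' g)"
    using IrrE[OF assms(2)] by metis
  note h = irreducible_repD(1)[OF r] and h' = irreducible_repD(1)[OF r']
  have "msum n m (\<lambda>g. \<rho> g * U * \<rho>' (inv g)) (carrier G) = 0\<^sub>m n m" (is "?S = _") if U: "U \<in> carrier_mat n m" for U
  proof (rule ccontr)
    assume nz: "?S \<noteq> 0\<^sub>m n m"
    have int: "\<rho> g * ?S = ?S * \<rho>' g" if "g \<in> carrier G" for g
      by (rule averaged_intertwiner[OF h h' U that])
    obtain Y where Y: "Y \<in> carrier_mat m n" "?S * Y = 1\<^sub>m n" "Y * ?S = 1\<^sub>m m"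
      by (rule schur_intertwiner[OF r r' msum_carrier int nz])
    have "\<chi> g = \<psi> g" if g: "g \<in> carrier G" for g
    proof -
      note cg = rep_carrier[OF h g] and cg' = rep_carrier[OF h' g]
      have "\<psi> g = mat_trace (Y * ?S * \<rho>' g)"
        unfolding Y(3) c'[OF g] left_mult_one_mat[OF cg'] ..
      also have "Y * ?S * \<rho>' g = Y * (\<rho> g * ?S)"
        by (simp only: assoc_mult_mat[OF Y(1) msum_carrier cg'] int[OF g])
      also have "\<dots> = Y * \<rho> g * ?S" by (rule assoc_mult_mat[OF Y(1) cg msum_carrier, symmetric])
      also have "mat_trace (Y * \<rho> g * ?S) = mat_trace (?S * (Y * \<rho> g))"
        by (rule mat_trace_mult_comm[OF mult_carrier_mat[OF Y(1) cg] msum_carrier])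
      also have "?S * (Y * \<rho> g) = ?S * Y * \<rho> g" by (rule assoc_mult_mat[OF msum_carrier Y(1) cg, symmetric])
      also have "\<dots> = \<rho> g" unfolding Y(2) by (rule left_mult_one_mat[OF cg])
      finally show ?thesis using c[OF g] by simp
    qed
    then show False using Irr_eqI[OF assms(1,2)] assms(3) by metis
  qed
  then have z: "msum n m (\<lambda>g. \<rho> g * unit_mat n m i k * \<rho>' (inv g)) (carrier G) = 0\<^sub>m n m" for i k
    by (simp add: unit_mat_def)
  have "(\<Sum>g\<in>carrier G. \<chi> g * \<psi> (inv g)) = (\<Sum>g\<in>carrier G. mat_trace (\<rho> g) * mat_trace (\<rho>' (inv g)))"
    using c c' by (intro sum.cong) auto
  also have "\<dots> = (\<Sum>i<n. \<Sum>k<m. 0)"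
    unfolding mat_trace_rep_prod_sum[OF h h'] z by simp
  finally show ?thesis by simp
qed

lemma Irr_norm:
  assumes "\<chi> \<in> Irr G"
  shows "(\<Sum>g\<in>carrier G. \<chi> g * \<chi> (inv g)) = of_nat (Coset.order G)"
proof -
  obtain n \<rho> where r: "irreducible_rep G n \<rho>" and c: "\<And>g. g \<in> carrier G \<Longrightarrow> \<chi> g = mat_trace (\<rho> g)"
    using IrrE[OF assms(1)] by metis
  note h = irreducible_repD(1)[OF r]
  have S: "msum n n (\<lambda>g. \<rho> g * U * \<rho> (inv g)) (carrier G) =
      (of_nat (Coset.order G) * mat_trace U / of_nat n) \<cdot>\<^sub>m 1\<^sub>m n" (is "?S = _") if U: "U \<in> carrier_mat n n" for U
  proof -
    have car: "\<rho> g * U * \<rho> (inv g) \<in> carrier_mat n n" if "g \<in> carrier G" for g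
      using rep_carrier[OF h] U that by (meson mult_carrier_mat inv_closed)
    have "mat_trace (\<rho> g * U * \<rho> (inv g)) = mat_trace U" if g: "g \<in> carrier G" for g
    proof -
      note cg = rep_carrier[OF h g] and ci = rep_carrier[OF h inv_closed[OF g]]
      have "mat_trace (\<rho> g * U * \<rho> (inv g)) = mat_trace (\<rho> (inv g) * (\<rho> g * U))"
        by (rule mat_trace_mult_comm[OF mult_carrier_mat[OF cg U] ci])
      also have "\<rho> (inv g) * (\<rho> g * U) = \<rho> (inv g) * \<rho> g * U"
        by (rule assoc_mult_mat[OF ci cg U, symmetric])
      finally show ?thesis using rep_inv[OF h g] U by simp
    qed
    then have "mat_trace ?S = of_nat (Coset.order G) * mat_trace U"
      using mat_trace_msum[of "carrier G" "\<lambda>g. \<rho> g * U * \<rho> (inv g)" n] car by (simp add: Coset.order_def)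
    then show ?thesis
      using schur_trace[OF r msum_carrier averaged_intertwiner[OF h h U]] by simp
  qed
  have n: "n > 0" by (rule irreducible_repD(2)[OF r])
  have tr: "mat_trace (unit_mat n n i k) = (if i = k then 1 else 0)" if "i < n" for i k
    using that by (auto simp: mat_trace_def unit_mat_def)
  have "(\<Sum>g\<in>carrier G. \<chi> g * \<chi> (inv g)) = (\<Sum>g\<in>carrier G. mat_trace (\<rho> g) * mat_trace (\<rho> (inv g)))"
    using c by (intro sum.cong) auto
  also have "\<dots> = (\<Sum>i<n. \<Sum>k<n. ((of_nat (Coset.order G) * mat_trace (unit_mat n n i k) / of_nat n) \<cdot>\<^sub>m 1\<^sub>m n) $$ (i, k))"
    unfolding mat_trace_rep_prod_sum[OF h h] using S by (simp add: unit_mat_def)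
  also have "\<dots> = (\<Sum>i<n. \<Sum>k<n. if i = k then of_nat (Coset.order G) / of_nat n else 0)"
    using tr by (intro sum.cong refl) auto
  also have "\<dots> = of_nat (Coset.order G)" using n by simp
  finally show ?thesis .
qed

end

section \<open>Character values as sums of roots of unity\<close>

lemma smult_vec_cancel:
  fixes v :: "complex vec"
  assumes v: "v \<in> carrier_vec n" "v \<noteq> 0\<^sub>v n" and eq: "a \<cdot>\<^sub>v v = b \<cdot>\<^sub>v v"
  shows "a = b"
proof (rule ccontr)
  assume ne: "a \<noteq> b"
  have "v = 0\<^sub>v n"
  proof (rule eq_vecI)
    fix i assume "i < dim_vec (0\<^sub>v n)"
    then have i: "i < n" by simp
    then have "a * v $ i = b * v $ i" using arg_cong[OF eq, of "\<lambda>u. u $ i"] v(1) by simp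
    then show "v $ i = 0\<^sub>v n $ i" using ne i by simp
  qed (use v in auto)
  then show False using v(2) by contradiction
qed

context finite_group
begin

lemma pow_order_one: "g \<in> carrier G \<Longrightarrow> g [^] Coset.order G = \<one>"
  using pow_order_eq_1 by simp

text \<open>Eigenvalues of \<open>\<rho> g\<close> are \<open>\<bar>G\<bar>\<close>-th roots of
  unity, because \<open>g\<close> has order dividing \<open>\<bar>G\<bar>\<close>; the same list of
  eigenvalues serves for all powers of \<open>g\<close>. The action of a Galois automorphism on
  character values is computed from this.\<close>

lemma rep_power_trace:
  assumes h: "\<rho> \<in> hom G (GL n)" and g: "g \<in> carrier G"
  obtains es where "length es = n" "\<And>e. e \<in> set es \<Longrightarrow> e ^ Coset.order G = 1"
    "\<And>k::nat. mat_trace (\<rho> (g [^] k)) = (\<Sum>e\<leftarrow>es. e ^ k)"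
proof -
  note c = rep_carrier[OF h g]
  obtain es where es: "length es = n" "\<And>e. e \<in> set es \<Longrightarrow> eigenvalue (\<rho> g) e"
    and tr: "\<And>k. mat_trace (\<rho> g ^\<^sub>m k) = (\<Sum>e\<leftarrow>es. e ^ k)"
    using mat_trace_pow_eigenvalues[OF c] by metis
  have root: "e ^ Coset.order G = 1" if e: "e \<in> set es" for e
  proof -
    obtain v where v: "v \<in> carrier_vec n" "v \<noteq> 0\<^sub>v n" "\<rho> g *\<^sub>v v = e \<cdot>\<^sub>v v"
      by (rule eigenvectorE[OF es(2)[OF e] c])
    have pw: "\<rho> g ^\<^sub>m k *\<^sub>v v = e ^ k \<cdot>\<^sub>v v" for k
    proof (induction k)
      case 0
      then show ?case using c v by auto
    next
      case (Suc k)
      have "\<rho> g ^\<^sub>m Suc k *\<^sub>v v = \<rho> g ^\<^sub>m k *\<^sub>v (\<rho> g *\<^sub>v v)"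
        using c v(1) by (simp add: assoc_mult_mat_vec[of _ n n _ n])
      also have "\<dots> = e \<cdot>\<^sub>v (\<rho> g ^\<^sub>m k *\<^sub>v v)"
        unfolding v(3) by (rule mult_mat_vec[of _ n n]) (use c v(1) in auto)
      finally show ?case unfolding Suc by (simp add: smult_smult_assoc)
    qed
    have "\<rho> g ^\<^sub>m Coset.order G = 1\<^sub>m n"
      using rep_pow[OF h g, of "Coset.order G"] pow_order_one[OF g] rep_one[OF h] by simp
    then have "e ^ Coset.order G \<cdot>\<^sub>v v = 1 \<cdot>\<^sub>v v"
      unfolding pw[symmetric] using v(1) by (simp only: one_mult_mat_vec one_smult_vec)
    then show ?thesis by (rule smult_vec_cancel[OF v(1,2)])
  qed
  show ?thesis by (rule that[OF es(1) root tr[folded rep_pow[OF h g]]])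
qed

lemma Irr_power_trace:
  assumes "\<chi> \<in> Irr G" and g: "g \<in> carrier G"
  obtains es where "\<And>e. e \<in> set es \<Longrightarrow> e ^ Coset.order G = 1"
    "\<And>k::nat. \<chi> (g [^] k) = (\<Sum>e\<leftarrow>es. e ^ k)"
proof -
  obtain n \<rho> where r: "irreducible_rep G n \<rho>" and c: "\<And>g. g \<in> carrier G \<Longrightarrow> \<chi> g = mat_trace (\<rho> g)"
    using IrrE[OF assms(1)] by metis
  obtain es where "length es = n" and es: "\<And>e. e \<in> set es \<Longrightarrow> e ^ Coset.order G = 1"
    and tr: "\<And>k::nat. mat_trace (\<rho> (g [^] k)) = (\<Sum>e\<leftarrow>es. e ^ k)"
    using rep_power_trace[OF irreducible_repD(1)[OF r] g] by blast
  have "\<chi> (g [^] k) = (\<Sum>e\<leftarrow>es. e ^ k)" for k :: nat using c tr g by simp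
  with es show ?thesis by (rule that)
qed

text \<open>Complex conjugation inverts roots of unity.\<close>

lemma Irr_inv:
  assumes "\<chi> \<in> Irr G" and g: "g \<in> carrier G"
  shows "\<chi> (inv g) = cnj (\<chi> g)"
proof -
  obtain es where es: "\<And>e. e \<in> set es \<Longrightarrow> e ^ Coset.order G = 1"
    and tr: "\<And>k::nat. \<chi> (g [^] k) = (\<Sum>e\<leftarrow>es. e ^ k)"
    using Irr_power_trace[OF assms] by blast
  let ?k = "Coset.order G - 1"
  have "g [^] ?k \<otimes> g = \<one>"
    using order_pos pow_order_one[OF g] nat_pow_Suc[of g ?k] by simp
  then have inv: "inv g = g [^] ?k" using g by (simp add: inv_equality)
  have "e ^ ?k = cnj e" if e: "e \<in> set es" for e
  proof -
    have "norm e ^ Coset.order G = 1" using arg_cong[OF es[OF e], of norm] by (simp add: norm_power)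
    then have "norm e = 1" using order_pos power_eq_imp_eq_base[of "norm e" "Coset.order G" 1] by simp
    then have 1: "e * cnj e = 1" using complex_norm_square[of e] by simp
    have "e * e ^ ?k = 1" using es[OF e] order_pos by (simp flip: power_Suc)
    then have "e * e ^ ?k = e * cnj e" using 1 by simp
    moreover have "e \<noteq> 0" using 1 by auto
    ultimately show ?thesis by simp
  qed
  then have "\<chi> (inv g) = (\<Sum>e\<leftarrow>es. cnj e)" unfolding inv tr by (simp cong: map_cong)
  also have "\<dots> = cnj (\<Sum>e\<leftarrow>es. e ^ 1)" by (induction es) auto
  also have "\<dots> = cnj (\<chi> g)" unfolding tr[symmetric] using g by simp
  finally show ?thesis .
qed

lemma Irr_one:
  assumes "\<chi> \<in> Irr G"
  obtains d where "d > 0" "\<chi> \<one> = of_nat d"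
proof -
  obtain n \<rho> where r: "irreducible_rep G n \<rho>" and c: "\<And>g. g \<in> carrier G \<Longrightarrow> \<chi> g = mat_trace (\<rho> g)"
    using IrrE[OF assms(1)] by metis
  then show ?thesis using that[of n] irreducible_repD(2)[OF r] rep_one[OF irreducible_repD(1)[OF r]] by simp
qed

text \<open>Bessel's inequality for the function that is \<open>\<bar>G\<bar>\<close> at the
  identity and 0 elsewhere: its projection to the span of \<open>T\<close> has coefficients
  \<open>\<chi>(1)\<close>, so the squares of the degrees sum to at most
  \<open>\<bar>G\<bar>\<close>.\<close>

lemma finite_subset_Irr_card:
  assumes T: "finite T" "T \<subseteq> Irr G"
  shows "card T \<le> Coset.order G"
proof -
  let ?N = "of_nat (Coset.order G) :: complex"
  define s where "s g = (\<Sum>\<chi>\<in>T. \<chi> \<one> * \<chi> g)" for g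
  have d: "\<exists>d>0. \<chi> \<one> = of_nat d" if "\<chi> \<in> T" for \<chi>
    using Irr_one[of \<chi>] T that by (metis subsetD)
  have s_inv: "s (inv g) = cnj (s g)" if g: "g \<in> carrier G" for g
    unfolding s_def cnj_sum
  proof (intro sum.cong refl)
    fix \<chi> assume x: "\<chi> \<in> T"
    then show "\<chi> \<one> * \<chi> (inv g) = cnj (\<chi> \<one> * \<chi> g)"
      using Irr_inv[of \<chi> g] T g d[OF x] by auto
  qed
  have ss: "(\<Sum>g\<in>carrier G. s g * s (inv g)) = ?N * s \<one>"
  proof -
    have "(\<Sum>g\<in>carrier G. s g * s (inv g)) =
        (\<Sum>g\<in>carrier G. \<Sum>\<chi>\<in>T. \<Sum>\<psi>\<in>T. (\<chi> \<one> * \<psi> \<one>) * (\<chi> g * \<psi> (inv g)))"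
      by (simp add: s_def sum_product mult_ac)
    also have "\<dots> = (\<Sum>\<chi>\<in>T. \<Sum>g\<in>carrier G. \<Sum>\<psi>\<in>T. (\<chi> \<one> * \<psi> \<one>) * (\<chi> g * \<psi> (inv g)))" by (rule sum.swap)
    also have "\<dots> = (\<Sum>\<chi>\<in>T. \<Sum>\<psi>\<in>T. \<Sum>g\<in>carrier G. (\<chi> \<one> * \<psi> \<one>) * (\<chi> g * \<psi> (inv g)))"
      by (intro sum.cong refl sum.swap)
    also have "\<dots> = (\<Sum>\<chi>\<in>T. \<Sum>\<psi>\<in>T. if \<psi> = \<chi> then \<chi> \<one> * \<chi> \<one> * ?N else 0)"
    proof (intro sum.cong refl)
      fix \<chi> \<psi> assume "\<chi> \<in> T" "\<psi> \<in> T"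
      then have "\<chi> \<in> Irr G" "\<psi> \<in> Irr G" using T(2) by auto
      then show "(\<Sum>g\<in>carrier G. (\<chi> \<one> * \<psi> \<one>) * (\<chi> g * \<psi> (inv g))) = (if \<psi> = \<chi> then \<chi> \<one> * \<chi> \<one> * ?N else 0)"
        using Irr_norm[of \<chi>] Irr_orthogonal[of \<chi> \<psi>] by (cases "\<psi> = \<chi>") (simp_all flip: sum_distrib_left)
    qed
    also have "\<dots> = (\<Sum>\<chi>\<in>T. \<chi> \<one> * \<chi> \<one> * ?N)"
      using T(1) by simp
    also have "\<dots> = ?N * s \<one>" by (simp add: s_def sum_distrib_left mult_ac)
    finally show ?thesis .
  qed
  define t where "t g = ?N * (if g = \<one> then 1 else 0) - s g" for g
  have t_inv: "t (inv g) = cnj (t g)" if g: "g \<in> carrier G" for g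
    using s_inv[OF g] g by (auto simp: t_def)
  have "(\<Sum>g\<in>carrier G. t g * t (inv g)) =
      (\<Sum>g\<in>carrier G. (if g = \<one> then ?N * ?N - 2 * ?N * s \<one> else 0) + s g * s (inv g))"
    by (intro sum.cong refl) (auto simp: t_def algebra_simps)
  also have "\<dots> = ?N * ?N - ?N * s \<one>"
    by (simp add: sum.distrib ss)
  finally have "?N * (?N - s \<one>) = (\<Sum>g\<in>carrier G. t g * cnj (t g))"
    using t_inv by (simp add: algebra_simps)
  also have "\<dots> = of_real (\<Sum>g\<in>carrier G. (norm (t g))\<^sup>2)"
    by (simp add: complex_norm_square del: of_real_power)
  finally have eq: "?N * (?N - s \<one>) = of_real (\<Sum>g\<in>carrier G. (norm (t g))\<^sup>2)" .
  have "\<exists>e::nat. s \<one> = of_nat e \<and> card T \<le> e"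
  proof -
    obtain d where d: "\<And>\<chi>. \<chi> \<in> T \<Longrightarrow> d \<chi> > (0::nat) \<and> \<chi> \<one> = of_nat (d \<chi>)" using d by metis
    have "s \<one> = of_nat (\<Sum>\<chi>\<in>T. d \<chi> * d \<chi>)" unfolding s_def using d by simp
    moreover have "(\<Sum>\<chi>\<in>T. 1) \<le> (\<Sum>\<chi>\<in>T. d \<chi> * d \<chi>)" using d by (intro sum_mono) (simp add: Suc_le_eq)
    ultimately show ?thesis by (intro exI[of _ "\<Sum>\<chi>\<in>T. d \<chi> * d \<chi>"]) simp
  qed
  then obtain e where e: "s \<one> = of_nat e" "card T \<le> e" by blast
  have "real (Coset.order G) * (real (Coset.order G) - real e) = (\<Sum>g\<in>carrier G. (norm (t g))\<^sup>2)"
    using arg_cong[OF eq[unfolded e(1)], of Re] by simp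
  also have "\<dots> \<ge> 0" by (intro sum_nonneg) simp
  finally have "e \<le> Coset.order G" using order_pos by (simp add: zero_le_mult_iff)
  then show ?thesis using e by simp
qed

lemma finite_Irr: "finite (Irr G)"
proof (rule ccontr)
  assume "infinite (Irr G)"
  from infinite_arbitrarily_large[OF this, of "Suc (Coset.order G)"]
  obtain T where "finite T" "card T = Suc (Coset.order G)" "T \<subseteq> Irr G" by auto
  then show False using finite_subset_Irr_card[of T] by simp
qed

text \<open>The sum of \<open>\<rho>\<close> over the conjugates of \<open>b\<close> is a scalar
  matrix; multiply it by \<open>\<rho> a\<close> and take traces. Equivalently,
  \<open>\<chi>/\<chi>(1)\<close> is multiplicative on the centre of the group algebra.\<close>

lemma Irr_functional_equation:
  assumes "\<chi> \<in> Irr G" and a: "a \<in> carrier G" and b: "b \<in> carrier G"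
  shows "of_nat (Coset.order G) * (\<chi> a * \<chi> b) = \<chi> \<one> * (\<Sum>h\<in>carrier G. \<chi> (a \<otimes> (h \<otimes> b \<otimes> inv h)))"
proof -
  obtain n \<rho> where r: "irreducible_rep G n \<rho>" and c: "\<And>g. g \<in> carrier G \<Longrightarrow> \<chi> g = mat_trace (\<rho> g)"
    using IrrE[OF assms(1)] by metis
  note h = irreducible_repD(1)[OF r] and n = irreducible_repD(2)[OF r]
  note rc = rep_carrier[OF h]
  define S where "S = msum n n (\<lambda>g. \<rho> g * \<rho> b * \<rho> (inv g)) (carrier G)"
  have Sc: "S \<in> carrier_mat n n" by (simp add: S_def)
  have conj: "\<rho> g * \<rho> b * \<rho> (inv g) = \<rho> (g \<otimes> b \<otimes> inv g)" if "g \<in> carrier G" for g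
    using that b by (simp add: rep_mult[OF h])
  then have S: "S = msum n n (\<lambda>g. \<rho> (g \<otimes> b \<otimes> inv g)) (carrier G)" unfolding S_def by (rule msum_cong)
  have "mat_trace S = (\<Sum>g\<in>carrier G. mat_trace (\<rho> (g \<otimes> b \<otimes> inv g)))"
    unfolding S using b by (intro mat_trace_msum rc) auto
  also have "\<dots> = of_nat (Coset.order G) * \<chi> b"
    using class_funD[OF class_fun_mat_trace[OF h] b] c[OF b] by (simp add: Coset.order_def)
  finally have trS: "mat_trace S = of_nat (Coset.order G) * \<chi> b" .
  have sc: "S = (mat_trace S / of_nat n) \<cdot>\<^sub>m 1\<^sub>m n"
    using averaged_intertwiner[OF h h rc[OF b]] by (intro schur_trace[OF r Sc]) (simp add: S_def)
  have "\<rho> a * S = (mat_trace S / of_nat n) \<cdot>\<^sub>m \<rho> a"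
    by (subst sc) (use mult_smult_distrib[OF rc[OF a] one_carrier_mat] right_mult_one_mat[OF rc[OF a]] in simp)
  then have "mat_trace (\<rho> a * S) = mat_trace S / of_nat n * \<chi> a"
    using mat_trace_smult[OF rc[OF a]] c[OF a] by simp
  moreover have "\<rho> a * S = msum n n (\<lambda>g. \<rho> (a \<otimes> (g \<otimes> b \<otimes> inv g))) (carrier G)"
  proof -
    have "\<rho> a * S = msum n n (\<lambda>g. \<rho> a * \<rho> (g \<otimes> b \<otimes> inv g)) (carrier G)"
      unfolding S using b by (intro mult_msum[OF rc[OF a]] rc) auto
    also have "\<dots> = msum n n (\<lambda>g. \<rho> (a \<otimes> (g \<otimes> b \<otimes> inv g))) (carrier G)"
      using a b by (intro msum_cong) (simp add: rep_mult[OF h])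
    finally show ?thesis .
  qed
  moreover have "mat_trace (msum n n (\<lambda>g. \<rho> (a \<otimes> (g \<otimes> b \<otimes> inv g))) (carrier G)) =
      (\<Sum>g\<in>carrier G. \<chi> (a \<otimes> (g \<otimes> b \<otimes> inv g)))"
    using a b c by (subst mat_trace_msum) (auto intro!: rc)
  ultimately have "(\<Sum>g\<in>carrier G. \<chi> (a \<otimes> (g \<otimes> b \<otimes> inv g))) = of_nat (Coset.order G) * \<chi> b / of_nat n * \<chi> a"
    using trS by simp
  moreover have "\<chi> \<one> = of_nat n" using c rep_one[OF h] by simp
  ultimately show ?thesis using n by (simp add: field_simps)
qed

end

section \<open>Irreducible subrepresentations\<close>

lemma matrix_eq_on_vecI:
  fixes A B :: "complex mat"
  assumes A: "A \<in> carrier_mat n m" and B: "B \<in> carrier_mat n m"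
    and eq: "\<And>v. v \<in> carrier_vec m \<Longrightarrow> A *\<^sub>v v = B *\<^sub>v v"
  shows "A = B"
proof (rule eq_matI)
  fix i j assume "i < dim_row B" "j < dim_col B"
  then have ij: "i < n" "j < m" using B by auto
  have "A $$ (i, j) = (A *\<^sub>v unit_vec m j) $ i" using ij A by simp
  also have "\<dots> = (B *\<^sub>v unit_vec m j) $ i" by (simp only: eq[OF unit_vec_carrier])
  finally show "A $$ (i, j) = B $$ (i, j)" using ij B by simp
qed (use A B in auto)

context finite_group
begin

text \<open>A subrepresentation needs coordinates to be given by matrices: \<open>\<tau> g = L *
  \<rho> g * B\<close> for a frame \<open>(B, L)\<close> of the subspace.\<close>

lemma restrict_rep:
  assumes h: "\<rho> \<in> hom G (GL n)"
    and W: "VectorSpace.subspace class_ring W (module_vec TYPE(complex) n)"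
    and inv: "\<And>g w. g \<in> carrier G \<Longrightarrow> w \<in> W \<Longrightarrow> \<rho> g *\<^sub>v w \<in> W"
    and nz: "w0 \<in> W" "w0 \<noteq> 0\<^sub>v n"
  obtains d and B L :: "complex mat" and \<tau> where "d > 0" "d \<le> n" "B \<in> carrier_mat n d" "L \<in> carrier_mat d n"
    "L * B = 1\<^sub>m d" "\<tau> \<in> hom G (GL d)" "\<And>g. g \<in> carrier G \<Longrightarrow> \<rho> g * B = B * \<tau> g"
    "\<And>v. v \<in> carrier_vec d \<Longrightarrow> B *\<^sub>v v \<in> W" "\<And>w. w \<in> W \<Longrightarrow> B *\<^sub>v (L *\<^sub>v w) = w"
proof -
  obtain d and B L :: "complex mat" where B: "B \<in> carrier_mat n d" and L: "L \<in> carrier_mat d n"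
    and LB: "L * B = 1\<^sub>m d" and BW: "\<And>v. v \<in> carrier_vec d \<Longrightarrow> B *\<^sub>v v \<in> W"
    and BL: "\<And>w. w \<in> W \<Longrightarrow> B *\<^sub>v (L *\<^sub>v w) = w" and dn: "d \<le> n"
    by (rule subspace_frame[OF W], rule that)
  note rc = rep_carrier[OF h]
  define \<tau> where "\<tau> g = L * (\<rho> g * B)" for g
  have tc: "\<tau> g \<in> carrier_mat d d" if "g \<in> carrier G" for g
    unfolding \<tau>_def by (rule mult_carrier_mat[OF L mult_carrier_mat[OF rc[OF that] B]])
  have Wc: "w \<in> carrier_vec n" if "w \<in> W" for w using W that by (auto simp: subspace_vec_iff)
  have d0: "d > 0"
  proof (rule ccontr)
    assume "\<not> d > 0"
    then have "L *\<^sub>v w0 = 0\<^sub>v d" using L by (intro eq_vecI) auto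
    then have "w0 = 0\<^sub>v n" using BL[OF nz(1)] mult_mat_zero_vec[OF B] by simp
    then show False using nz(2) by contradiction
  qed
  have int: "\<rho> g * B = B * \<tau> g" if g: "g \<in> carrier G" for g
  proof (rule matrix_eq_on_vecI[OF mult_carrier_mat[OF rc[OF g] B] mult_carrier_mat[OF B tc[OF g]]])
    fix v :: "complex vec" assume v: "v \<in> carrier_vec d"
    have e1: "\<tau> g *\<^sub>v v = L *\<^sub>v ((\<rho> g * B) *\<^sub>v v)"
      unfolding \<tau>_def by (rule assoc_mult_mat_vec[OF L mult_carrier_mat[OF rc[OF g] B] v])
    have e2: "(\<rho> g * B) *\<^sub>v v = \<rho> g *\<^sub>v (B *\<^sub>v v)" by (rule assoc_mult_mat_vec[OF rc[OF g] B v])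
    have "(B * \<tau> g) *\<^sub>v v = B *\<^sub>v (\<tau> g *\<^sub>v v)" by (rule assoc_mult_mat_vec[OF B tc[OF g] v])
    then show "(\<rho> g * B) *\<^sub>v v = (B * \<tau> g) *\<^sub>v v"
      unfolding e1 e2 BL[OF inv[OF g BW[OF v]]] by (rule sym)
  qed
  have "\<tau> \<in> hom G (GL d)"
  proof (rule repI)
    show "\<tau> g \<in> carrier_mat d d" if "g \<in> carrier G" for g by (rule tc[OF that])
    show "\<tau> \<one> = 1\<^sub>m d" unfolding \<tau>_def rep_one[OF h] left_mult_one_mat[OF B] by (rule LB)
    fix a b assume a: "a \<in> carrier G" and b: "b \<in> carrier G"
    have "\<rho> (a \<otimes> b) * B = \<rho> a * (\<rho> b * B)"
      unfolding rep_mult[OF h a b] by (rule assoc_mult_mat[OF rc[OF a] rc[OF b] B])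
    also have "\<dots> = \<rho> a * B * \<tau> b"
      unfolding int[OF b] by (rule assoc_mult_mat[OF rc[OF a] B tc[OF b], symmetric])
    finally have "\<tau> (a \<otimes> b) = L * (\<rho> a * B * \<tau> b)" by (simp only: \<tau>_def)
    also have "\<dots> = L * (\<rho> a * B) * \<tau> b"
      by (rule assoc_mult_mat[OF L mult_carrier_mat[OF rc[OF a] B] tc[OF b], symmetric])
    finally show "\<tau> (a \<otimes> b) = \<tau> a * \<tau> b" by (simp only: \<tau>_def)
  qed
  from that[OF d0 dn B L LB this int BW BL] show ?thesis .
qed

text \<open>Eigenspaces of an operator that commutes with the group are invariant, and an invariant
  subspace of least positive dimension is irreducible. Minimality is taken over the pairs of
  injections \<open>B\<close> and left inverses \<open>L\<close>, so that subspaces of subspaces are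
  composites of matrices.\<close>

lemma irreducible_in_eigenspace:
  assumes h: "\<rho> \<in> hom G (GL n)" and U: "U \<in> carrier_mat n n"
    and int: "\<And>g. g \<in> carrier G \<Longrightarrow> \<rho> g * U = U * \<rho> g" and ev: "eigenvalue U l"
  obtains d \<tau> and B L :: "complex mat" where "irreducible_rep G d \<tau>" "B \<in> carrier_mat n d" "L \<in> carrier_mat d n"
    "L * B = 1\<^sub>m d" "\<And>g. g \<in> carrier G \<Longrightarrow> \<rho> g * B = B * \<tau> g" "U * B = l \<cdot>\<^sub>m B"
proof -
  note rc = rep_carrier[OF h]
  define Q where "Q d B L \<tau> \<longleftrightarrow> d > 0 \<and> B \<in> carrier_mat n d \<and> L \<in> carrier_mat d n \<and> L * B = 1\<^sub>m d \<and>
    \<tau> \<in> hom G (GL d) \<and> (\<forall>g\<in>carrier G. \<rho> g * B = B * \<tau> g) \<and> U * B = l \<cdot>\<^sub>m B"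
    for d B L \<tau>
  have "\<exists>d B L \<tau>. Q d B L \<tau>"
  proof -
    let ?W = "{v \<in> carrier_vec n. U *\<^sub>v v = l \<cdot>\<^sub>v v}"
    obtain w0 where w0: "w0 \<in> carrier_vec n" "w0 \<noteq> 0\<^sub>v n" "U *\<^sub>v w0 = l \<cdot>\<^sub>v w0" by (rule eigenvectorE[OF ev U])
    have W: "VectorSpace.subspace class_ring ?W (module_vec TYPE(complex) n)"
      using U by (auto simp: subspace_vec_iff mult_add_distrib_mat_vec[OF U] mult_mat_vec[OF U]
          smult_add_distrib_vec[of _ n] smult_smult_assoc mult.commute)
    have inv: "\<rho> g *\<^sub>v w \<in> ?W" if g: "g \<in> carrier G" and w: "w \<in> ?W" for g w
    proof -
      have wc: "w \<in> carrier_vec n" and Uw: "U *\<^sub>v w = l \<cdot>\<^sub>v w" using w by auto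
      have "U *\<^sub>v (\<rho> g *\<^sub>v w) = (\<rho> g * U) *\<^sub>v w"
        unfolding int[OF g] by (rule assoc_mult_mat_vec[OF U rc[OF g] wc, symmetric])
      also have "\<dots> = l \<cdot>\<^sub>v (\<rho> g *\<^sub>v w)"
        unfolding assoc_mult_mat_vec[OF rc[OF g] U wc] Uw by (rule mult_mat_vec[OF rc[OF g] wc])
      finally show ?thesis using mult_mat_vec_carrier[OF rc[OF g] wc] by simp
    qed
    have "w0 \<in> ?W" using w0 by simp
    note restr = restrict_rep[OF h W inv this w0(2)]
    obtain d and B L :: "complex mat" and \<tau> where *: "d > 0" "B \<in> carrier_mat n d" "L \<in> carrier_mat d n"
      "L * B = 1\<^sub>m d" "\<tau> \<in> hom G (GL d)" "\<And>g. g \<in> carrier G \<Longrightarrow> \<rho> g * B = B * \<tau> g"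
      and BW: "\<And>v. v \<in> carrier_vec d \<Longrightarrow> B *\<^sub>v v \<in> ?W" by (rule restr; assumption?; rule that)
    have "U * B = l \<cdot>\<^sub>m B"
    proof (rule matrix_eq_on_vecI[of _ n d])
      fix v :: "complex vec" assume v: "v \<in> carrier_vec d"
      have "U * B *\<^sub>v v = l \<cdot>\<^sub>v (B *\<^sub>v v)"
        unfolding assoc_mult_mat_vec[OF U *(2) v] using BW[OF v] by simp
      also have "\<dots> = l \<cdot>\<^sub>m B *\<^sub>v v" using *(2) v by (intro eq_vecI) auto
      finally show "U * B *\<^sub>v v = l \<cdot>\<^sub>m B *\<^sub>v v" .
    qed (use U * in auto)
    with * show ?thesis unfolding Q_def by (intro exI conjI ballI)
  qed
  then have "\<exists>d. \<exists>B L \<tau>. Q d B L \<tau>" .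
  then obtain d where d: "\<exists>B L \<tau>. Q d B L \<tau>" "\<And>d'. \<exists>B L \<tau>. Q d' B L \<tau> \<Longrightarrow> d \<le> d'"
    using exists_least_iff[of "\<lambda>d. \<exists>B L \<tau>. Q d B L \<tau>"] by (metis not_less)
  then obtain B L \<tau> where Q: "Q d B L \<tau>" by auto
  then have B: "B \<in> carrier_mat n d" and L: "L \<in> carrier_mat d n" and LB: "L * B = 1\<^sub>m d" and d0: "d > 0"
    and t: "\<tau> \<in> hom G (GL d)" and Bt: "\<And>g. g \<in> carrier G \<Longrightarrow> \<rho> g * B = B * \<tau> g"
    and UB: "U * B = l \<cdot>\<^sub>m B" by (auto simp: Q_def)
  have "irreducible_rep G d \<tau>"
    unfolding irreducible_rep_def
  proof (intro conjI allI impI t d0)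
    fix W assume "VectorSpace.subspace class_ring W (module_vec TYPE(complex) d) \<and>
      (\<forall>g\<in>carrier G. \<forall>w\<in>W. \<tau> g *\<^sub>v w \<in> W)"
    then have W: "VectorSpace.subspace class_ring W (module_vec TYPE(complex) d)"
      and inv: "\<And>g w. g \<in> carrier G \<Longrightarrow> w \<in> W \<Longrightarrow> \<tau> g *\<^sub>v w \<in> W" by auto
    show "W = {0\<^sub>v d} \<or> W = carrier_vec d"
    proof (rule disjCI)
      assume nW: "W \<noteq> carrier_vec d"
      have W': "W \<subseteq> carrier_vec d" "0\<^sub>v d \<in> W" using W by (auto simp: subspace_vec_iff)
      show "W = {0\<^sub>v d}"
      proof (rule ccontr)
        assume "W \<noteq> {0\<^sub>v d}"
        then obtain w0 where w0: "w0 \<in> W" "w0 \<noteq> 0\<^sub>v d" using W'(2) by auto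
        note restr = restrict_rep[OF t W inv w0]
        obtain d' and B' L' :: "complex mat" and \<tau>' where d': "d' > 0" "d' \<le> d"
          and B': "B' \<in> carrier_mat d d'" and L': "L' \<in> carrier_mat d' d"
          and LB': "L' * B' = 1\<^sub>m d'" and t': "\<tau>' \<in> hom G (GL d')"
          and Bt': "\<And>g. g \<in> carrier G \<Longrightarrow> \<tau> g * B' = B' * \<tau>' g"
          and BW': "\<And>v. v \<in> carrier_vec d' \<Longrightarrow> B' *\<^sub>v v \<in> W" by (rule restr; assumption?; rule that)
        note BB' = mult_carrier_mat[OF B B']
        have "Q d' (B * B') (L' * L) \<tau>'"
          unfolding Q_def
        proof (intro conjI ballI d' t' BB' mult_carrier_mat[OF L' L])
          have "L' * L * (B * B') = L' * (L * (B * B'))" by (rule assoc_mult_mat[OF L' L BB'])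
          also have "L * (B * B') = L * B * B'" by (rule assoc_mult_mat[OF L B B', symmetric])
          finally show "L' * L * (B * B') = 1\<^sub>m d'" unfolding LB left_mult_one_mat[OF B'] LB' .
          have "U * (B * B') = U * B * B'" by (rule assoc_mult_mat[OF U B B', symmetric])
          then show "U * (B * B') = l \<cdot>\<^sub>m (B * B')" unfolding UB mult_smult_assoc_mat[OF B B'] .
          fix g assume g: "g \<in> carrier G"
          note tc = rep_carrier[OF t g] and tc' = rep_carrier[OF t' g]
          have "\<rho> g * (B * B') = \<rho> g * B * B'" by (rule assoc_mult_mat[OF rc[OF g] B B', symmetric])
          also have "\<dots> = B * (B' * \<tau>' g)" unfolding Bt[OF g] Bt'[OF g, symmetric] by (rule assoc_mult_mat[OF B tc B'])
          also have "\<dots> = B * B' * \<tau>' g" by (rule assoc_mult_mat[OF B B' tc', symmetric])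
          finally show "\<rho> g * (B * B') = B * B' * \<tau>' g" .
        qed
        then have "d' = d" using d(2)[of d'] d'(2) by (meson le_antisym)
        then have sq: "B' \<in> carrier_mat d d" "L' \<in> carrier_mat d d" "L' * B' = 1\<^sub>m d" using B' L' LB' by auto
        have BL': "B' * L' = 1\<^sub>m d" by (rule mat_mult_left_right_inverse[OF sq(2,1,3)])
        have "v \<in> W" if v: "v \<in> carrier_vec d" for v
        proof -
          have "v = B' * L' *\<^sub>v v" unfolding BL' using v by simp
          also have "\<dots> = B' *\<^sub>v (L' *\<^sub>v v)" by (rule assoc_mult_mat_vec[OF sq(1,2) v])
          finally show ?thesis using BW'[of "L' *\<^sub>v v"] sq(2) v \<open>d' = d\<close> by simp
        qed
        then show False using nW W' by auto
      qed
    qed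
  qed
  from that[OF this B L LB Bt UB] show ?thesis .
qed

text \<open>A class function is a central element of the group algebra.\<close>

lemma rep_weighted_sum_commute:
  assumes h: "\<rho> \<in> hom G (GL n)" and f: "class_fun f" and a: "a \<in> carrier G"
  shows "\<rho> a * msum n n (\<lambda>g. f g \<cdot>\<^sub>m \<rho> (inv g)) (carrier G) = msum n n (\<lambda>g. f g \<cdot>\<^sub>m \<rho> (inv g)) (carrier G) * \<rho> a"
proof -
  note rc = rep_carrier[OF h]
  have "\<rho> a * msum n n (\<lambda>g. f g \<cdot>\<^sub>m \<rho> (inv g)) (carrier G) =
      msum n n (\<lambda>g. \<rho> a * (f g \<cdot>\<^sub>m \<rho> (inv g))) (carrier G)"
    by (rule mult_msum[OF rc[OF a]]) (use rc in auto)
  also have "\<dots> = msum n n (\<lambda>g. f (a \<otimes> g \<otimes> inv a) \<cdot>\<^sub>m \<rho> (inv (a \<otimes> g \<otimes> inv a)) * \<rho> a) (carrier G)"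
  proof (rule msum_cong)
    fix g assume g: "g \<in> carrier G"
    have ig: "inv g \<in> carrier G" and c2: "inv (a \<otimes> g \<otimes> inv a) \<in> carrier G" using a g by auto
    have "\<rho> a * (f g \<cdot>\<^sub>m \<rho> (inv g)) = f g \<cdot>\<^sub>m (\<rho> a * \<rho> (inv g))"
      by (rule mult_smult_distrib[OF rc[OF a] rc[OF ig]])
    also have "\<rho> a * \<rho> (inv g) = \<rho> (inv (a \<otimes> g \<otimes> inv a)) * \<rho> a"
      using a g by (simp add: rep_mult[OF h, symmetric] inv_mult_group m_assoc)
    also have "f g \<cdot>\<^sub>m (\<rho> (inv (a \<otimes> g \<otimes> inv a)) * \<rho> a) = f g \<cdot>\<^sub>m \<rho> (inv (a \<otimes> g \<otimes> inv a)) * \<rho> a"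
      by (rule mult_smult_assoc_mat[OF rc[OF c2] rc[OF a], symmetric])
    finally show "\<rho> a * (f g \<cdot>\<^sub>m \<rho> (inv g)) = f (a \<otimes> g \<otimes> inv a) \<cdot>\<^sub>m \<rho> (inv (a \<otimes> g \<otimes> inv a)) * \<rho> a"
      unfolding class_funD[OF f g a] .
  qed
  also have "\<dots> = msum n n (\<lambda>g. f g \<cdot>\<^sub>m \<rho> (inv g) * \<rho> a) (carrier G)"
    by (rule msum_reindex[OF bij_conj[OF a], symmetric])
  also have "\<dots> = msum n n (\<lambda>g. f g \<cdot>\<^sub>m \<rho> (inv g)) (carrier G) * \<rho> a"
    by (rule msum_mult[OF rc[OF a], symmetric]) (use rc in auto)
  finally show ?thesis .
qed

end

section \<open>Completeness of the irreducible characters\<close>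

context finite_group
begin

text \<open>The permutation matrices of left multiplication: an element other than the identity
  moves every point, so its matrix has trace 0.\<close>

lemma regular_rep:
  obtains R where "R \<in> hom G (GL (Coset.order G))"
    "\<And>g. g \<in> carrier G \<Longrightarrow> mat_trace (R g) = (if g = \<one> then of_nat (Coset.order G) else 0)"
proof -
  let ?N = "Coset.order G"
  obtain e where e: "bij_betw e {0..<?N} (carrier G)"
    using ex_bij_betw_nat_finite[OF fin] by (auto simp: Coset.order_def)
  have ec: "e i \<in> carrier G" if "i < ?N" for i using bij_betwE[OF e] that by simp
  define R where "R g = mat ?N ?N (\<lambda>(i, j). if e i = g \<otimes> e j then 1 else (0::complex))" for g
  have Rc: "R g \<in> carrier_mat ?N ?N" for g by (simp add: R_def)
  have hom: "R \<in> hom G (GL ?N)"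
  proof (rule repI)
    show "R g \<in> carrier_mat ?N ?N" for g by (rule Rc)
    show "R \<one> = 1\<^sub>m ?N"
    proof (rule eq_matI)
      fix i j assume "i < dim_row (1\<^sub>m ?N)" "j < dim_col (1\<^sub>m ?N)"
      then have ij: "i < ?N" "j < ?N" by auto
      then have "e i = e j \<longleftrightarrow> i = j" using bij_betw_imp_inj_on[OF e] by (auto simp: inj_on_def)
      then show "R \<one> $$ (i, j) = 1\<^sub>m ?N $$ (i, j)" using ij ec by (simp add: R_def)
    qed (simp_all add: R_def)
    fix g h assume g: "g \<in> carrier G" and h: "h \<in> carrier G"
    show "R (g \<otimes> h) = R g * R h"
    proof (rule eq_matI)
      fix i j assume "i < dim_row (R g * R h)" "j < dim_col (R g * R h)"
      then have ij: "i < ?N" "j < ?N" by (auto simp: R_def)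
      have "(R g * R h) $$ (i, j) = (\<Sum>k\<in>{0..<?N}. (if e i = g \<otimes> e k then 1 else 0) * (if e k = h \<otimes> e j then 1 else 0))"
        using ij by (simp add: R_def scalar_prod_def)
      also have "\<dots> = (\<Sum>x\<in>carrier G. (if e i = g \<otimes> x then 1 else 0) * (if x = h \<otimes> e j then 1 else 0))"
        by (rule sum.reindex_bij_betw[OF e, of "\<lambda>x. (if e i = g \<otimes> x then 1 else 0) * (if x = h \<otimes> e j then 1 else 0)"])
      also have "\<dots> = (\<Sum>x\<in>carrier G. if x = h \<otimes> e j then (if e i = g \<otimes> (h \<otimes> e j) then 1 else 0) else 0)"
        by (intro sum.cong) auto
      also have "\<dots> = (if e i = g \<otimes> (h \<otimes> e j) then 1 else 0)" using h ec[OF ij(2)] by simp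
      finally show "R (g \<otimes> h) $$ (i, j) = (R g * R h) $$ (i, j)"
        using ij g h ec by (simp add: R_def m_assoc)
    qed (simp_all add: R_def)
  qed
  have "mat_trace (R g) = (if g = \<one> then of_nat ?N else 0)" if g: "g \<in> carrier G" for g
  proof -
    have "mat_trace (R g) = (\<Sum>i\<in>{0..<?N}. if e i = g \<otimes> e i then 1 else 0)"
      by (simp add: mat_trace_def R_def lessThan_atLeast0)
    also have "\<dots> = (\<Sum>x\<in>carrier G. if x = g \<otimes> x then 1 else 0)"
      by (rule sum.reindex_bij_betw[OF e, of "\<lambda>x. if x = g \<otimes> x then 1 else 0"])
    also have "\<dots> = (\<Sum>x\<in>carrier G. if g = \<one> then 1 else 0)"
    proof (intro sum.cong refl)
      fix x assume x: "x \<in> carrier G"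
      have "x = g \<otimes> x \<longleftrightarrow> g = \<one>" using g x r_cancel[of g x "\<one>"] by auto
      then show "(if x = g \<otimes> x then 1 else 0) = (if g = \<one> then 1 else (0::complex))" by simp
    qed
    finally show ?thesis by (simp add: Coset.order_def)
  qed
  with hom show ?thesis by (rule that)
qed

text \<open>The convolution \<open>u\<close> of \<open>f\<close> with its adjoint is a class
  function with \<open>u(1) = \<Sum> \<bar>f\<bar>\<^sup>2\<close>. If \<open>f\<close> is not 0,
  then \<open>u\<close> acts on the regular representation with trace \<open>\<bar>G\<bar> u(1)
  \<noteq> 0\<close>, hence with a nonzero eigenvalue, and therefore as a nonzero scalar on some
  irreducible representation. But \<open>f\<close> acts there as a scalar of trace 0, hence as 0,
  and so does \<open>u\<close>.\<close>

lemma class_fun_eq_0: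
  assumes f: "class_fun f" and orth: "\<And>\<chi>. \<chi> \<in> Irr G \<Longrightarrow> (\<Sum>g\<in>carrier G. f g * \<chi> (inv g)) = 0"
    and x: "x \<in> carrier G"
  shows "f x = 0"
proof (rule ccontr)
  assume fx: "f x \<noteq> 0"
  let ?N = "Coset.order G"
  define u where "u g = (\<Sum>h\<in>carrier G. cnj (f h) * f (h \<otimes> g))" for g
  have cu: "class_fun u" unfolding class_fun_def
  proof (intro ballI)
    fix g a assume g: "g \<in> carrier G" and a: "a \<in> carrier G"
    have "u (a \<otimes> g \<otimes> inv a) = (\<Sum>h\<in>carrier G. cnj (f (a \<otimes> h \<otimes> inv a)) * f ((a \<otimes> h \<otimes> inv a) \<otimes> (a \<otimes> g \<otimes> inv a)))"
      unfolding u_def by (rule sum_conj[OF a, symmetric])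
    also have "\<dots> = u g" unfolding u_def
    proof (intro sum.cong refl)
      fix h assume h: "h \<in> carrier G"
      have "(a \<otimes> h \<otimes> inv a) \<otimes> (a \<otimes> g \<otimes> inv a) = a \<otimes> (h \<otimes> g) \<otimes> inv a"
      proof -
        have "inv a \<otimes> (a \<otimes> y) = y" if "y \<in> carrier G" for y using a that by (simp flip: m_assoc)
        then show ?thesis using a g h by (simp add: m_assoc)
      qed
      then show "cnj (f (a \<otimes> h \<otimes> inv a)) * f ((a \<otimes> h \<otimes> inv a) \<otimes> (a \<otimes> g \<otimes> inv a)) = cnj (f h) * f (h \<otimes> g)"
        using class_funD[OF f] a g h by simp
    qed
    finally show "u (a \<otimes> g \<otimes> inv a) = u g" .
  qed
  have "u \<one> = of_real (\<Sum>h\<in>carrier G. (norm (f h))\<^sup>2)"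
    unfolding u_def of_real_sum complex_norm_square by (intro sum.cong) (auto simp: mult.commute)
  moreover have "(\<Sum>h\<in>carrier G. (norm (f h))\<^sup>2) > 0"
    using x fx by (intro sum_pos2[of _ x]) auto
  ultimately have u1: "u \<one> \<noteq> 0" by (metis of_real_eq_0_iff less_irrefl)
  obtain R where R: "R \<in> hom G (GL ?N)"
    and trR: "\<And>g. g \<in> carrier G \<Longrightarrow> mat_trace (R g) = (if g = \<one> then of_nat ?N else 0)"
    by (rule regular_rep, rule that)
  note Rc = rep_carrier[OF R]
  define U where "U = msum ?N ?N (\<lambda>g. u g \<cdot>\<^sub>m R (inv g)) (carrier G)"
  have Uc: "U \<in> carrier_mat ?N ?N" by (simp add: U_def)
  have "mat_trace U = (\<Sum>g\<in>carrier G. mat_trace (u g \<cdot>\<^sub>m R (inv g)))"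
    unfolding U_def by (rule mat_trace_msum) (use Rc in auto)
  also have "\<dots> = (\<Sum>g\<in>carrier G. if g = \<one> then u \<one> * of_nat ?N else 0)"
  proof (intro sum.cong refl)
    fix g assume g: "g \<in> carrier G"
    then show "mat_trace (u g \<cdot>\<^sub>m R (inv g)) = (if g = \<one> then u \<one> * of_nat ?N else 0)"
      using mat_trace_smult[OF Rc[OF inv_closed[OF g]], of "u g"] trR[of "inv g"] by auto
  qed
  also have "\<dots> = u \<one> * of_nat ?N" by simp
  finally have trU: "mat_trace U \<noteq> 0" using u1 order_pos by simp
  obtain es where es: "length es = ?N" "\<And>e. e \<in> set es \<Longrightarrow> eigenvalue U e"
    "\<And>k. mat_trace (U ^\<^sub>m k) = (\<Sum>e\<leftarrow>es. e ^ k)"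
    by (rule mat_trace_pow_eigenvalues[OF Uc], rule that)
  have "mat_trace U = sum_list es" using es(3)[of 1] Uc by simp
  then have "\<exists>l\<in>set es. l \<noteq> 0" using trU by (metis sum_list_0 map_idI map_cong list.map_ident)
  then obtain l where l: "l \<noteq> 0" "eigenvalue U l" using es(2) by auto
  have int: "R g * U = U * R g" if "g \<in> carrier G" for g
    unfolding U_def by (rule rep_weighted_sum_commute[OF R cu that])
  obtain d \<tau> and B L :: "complex mat" where irr: "irreducible_rep G d \<tau>" and B: "B \<in> carrier_mat ?N d"
    and L: "L \<in> carrier_mat d ?N" and LB: "L * B = 1\<^sub>m d"
    and Bt: "\<And>g. g \<in> carrier G \<Longrightarrow> R g * B = B * \<tau> g" and UB: "U * B = l \<cdot>\<^sub>m B"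
    by (rule irreducible_in_eigenspace[OF R Uc int l(2)]; assumption?; rule that)
  note t = irreducible_repD(1)[OF irr] and d0 = irreducible_repD(2)[OF irr]
  note tc = rep_carrier[OF t]
  define V where "V = msum d d (\<lambda>g. u g \<cdot>\<^sub>m \<tau> (inv g)) (carrier G)"
  have Vc: "V \<in> carrier_mat d d" by (simp add: V_def)
  have "U * B = msum ?N d (\<lambda>g. u g \<cdot>\<^sub>m R (inv g) * B) (carrier G)"
    unfolding U_def by (rule msum_mult[OF B]) (use Rc in auto)
  also have "\<dots> = msum ?N d (\<lambda>g. B * (u g \<cdot>\<^sub>m \<tau> (inv g))) (carrier G)"
  proof (rule msum_cong)
    fix g assume "g \<in> carrier G"
    then have ig: "inv g \<in> carrier G" by simp
    show "u g \<cdot>\<^sub>m R (inv g) * B = B * (u g \<cdot>\<^sub>m \<tau> (inv g))"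
      unfolding mult_smult_assoc_mat[OF Rc[OF ig] B] Bt[OF ig] mult_smult_distrib[OF B tc[OF ig]] ..
  qed
  also have "\<dots> = B * V"
    unfolding V_def by (rule mult_msum[OF B, symmetric]) (use tc in auto)
  finally have "L * (B * V) = L * (l \<cdot>\<^sub>m B)" by (simp only: UB)
  then have "V = l \<cdot>\<^sub>m 1\<^sub>m d"
    unfolding mult_smult_distrib[OF L B] assoc_mult_mat[OF L B Vc, symmetric] LB left_mult_one_mat[OF Vc] .
  then have trV: "mat_trace V \<noteq> 0" using l(1) d0 mat_trace_smult[of "1\<^sub>m d" d l] by simp
  have chi: "character_of G \<tau> \<in> Irr G" using irr by (auto simp: Irr_def)
  have "mat_trace V = (\<Sum>g\<in>carrier G. mat_trace (u g \<cdot>\<^sub>m \<tau> (inv g)))"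
    unfolding V_def by (rule mat_trace_msum) (use tc in auto)
  also have "\<dots> = (\<Sum>g\<in>carrier G. u g * character_of G \<tau> (inv g))"
    by (intro sum.cong refl) (simp add: character_of_def mat_trace_smult[OF tc])
  also have "\<dots> = (\<Sum>g\<in>carrier G. \<Sum>h\<in>carrier G. cnj (f h) * (f (h \<otimes> g) * character_of G \<tau> (inv g)))"
    by (simp add: u_def sum_distrib_right mult.assoc)
  also have "\<dots> = (\<Sum>h\<in>carrier G. \<Sum>g\<in>carrier G. cnj (f h) * (f (h \<otimes> g) * character_of G \<tau> (inv g)))"
    by (rule sum.swap)
  also have "\<dots> = (\<Sum>h\<in>carrier G. cnj (f h) * (\<Sum>g\<in>carrier G. f (h \<otimes> g) * character_of G \<tau> (inv g)))"
    by (simp add: sum_distrib_left)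
  also have "\<dots> = 0"
  proof (intro sum.neutral ballI)
    fix h assume h: "h \<in> carrier G"
    define W where "W = msum d d (\<lambda>g. f g \<cdot>\<^sub>m \<tau> (inv g)) (carrier G)"
    have Wc: "W \<in> carrier_mat d d" by (simp add: W_def)
    have "mat_trace W = (\<Sum>g\<in>carrier G. mat_trace (f g \<cdot>\<^sub>m \<tau> (inv g)))"
      unfolding W_def by (rule mat_trace_msum) (use tc in auto)
    also have "\<dots> = (\<Sum>g\<in>carrier G. f g * character_of G \<tau> (inv g))"
      by (intro sum.cong refl) (simp add: character_of_def mat_trace_smult[OF tc])
    finally have "mat_trace W = 0" using orth[OF chi] by simp
    moreover have "W = (mat_trace W / of_nat d) \<cdot>\<^sub>m 1\<^sub>m d"
      by (rule schur_trace[OF irr Wc]) (simp only: W_def rep_weighted_sum_commute[OF t f])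
    ultimately have W0: "W = 0\<^sub>m d d" by (simp add: mat_eq_iff)
    have "(\<Sum>g\<in>carrier G. f (h \<otimes> g) * character_of G \<tau> (inv g)) =
        (\<Sum>g\<in>carrier G. f (h \<otimes> g) * mat_trace (\<tau> (inv (h \<otimes> g) \<otimes> h)))"
      using h by (intro sum.cong refl) (simp add: character_of_def inv_mult_group m_assoc)
    also have "\<dots> = (\<Sum>g\<in>carrier G. f g * mat_trace (\<tau> (inv g \<otimes> h)))"
      by (rule sum_left_mult[OF h])
    also have "\<dots> = (\<Sum>g\<in>carrier G. mat_trace (f g \<cdot>\<^sub>m \<tau> (inv g) * \<tau> h))"
    proof (intro sum.cong refl)
      fix g assume "g \<in> carrier G"
      then have ig: "inv g \<in> carrier G" by simp
      show "f g * mat_trace (\<tau> (inv g \<otimes> h)) = mat_trace (f g \<cdot>\<^sub>m \<tau> (inv g) * \<tau> h)"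
        unfolding mult_smult_assoc_mat[OF tc[OF ig] tc[OF h]] rep_mult[OF t ig h]
        by (rule mat_trace_smult[OF mult_carrier_mat[OF tc[OF ig] tc[OF h]], symmetric])
    qed
    also have "\<dots> = mat_trace (msum d d (\<lambda>g. f g \<cdot>\<^sub>m \<tau> (inv g) * \<tau> h) (carrier G))"
      by (rule mat_trace_msum[symmetric]) (use tc h in \<open>auto intro!: mult_carrier_mat[of _ _ d]\<close>)
    also have "msum d d (\<lambda>g. f g \<cdot>\<^sub>m \<tau> (inv g) * \<tau> h) (carrier G) = W * \<tau> h"
      unfolding W_def by (rule msum_mult[OF tc[OF h], symmetric]) (use tc in auto)
    also have "\<dots> = 0\<^sub>m d d" unfolding W0 by (rule left_mult_zero_mat[OF tc[OF h]])
    also have "mat_trace (0\<^sub>m d d) = 0" by (simp add: mat_trace_def)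
    finally show "cnj (f h) * (\<Sum>g\<in>carrier G. f (h \<otimes> g) * character_of G \<tau> (inv g)) = 0" by simp
  qed
  finally show False using trV by contradiction
qed

text \<open>Both sides are class functions of \<open>a\<close> with the same inner products with all
  irreducible characters.\<close>

lemma second_orthogonality:
  assumes a: "a \<in> carrier G" and b: "b \<in> carrier G"
  shows "(\<Sum>\<chi>\<in>Irr G. \<chi> a * \<chi> (inv b)) = of_nat (card {h \<in> carrier G. h \<otimes> a \<otimes> inv h = b})"
proof -
  let ?N = "of_nat (Coset.order G) :: complex"
  define \<phi> where "\<phi> x = (\<Sum>h\<in>carrier G. if h \<otimes> x \<otimes> inv h = b then 1 else 0 :: complex)" for x
  define f where "f x = \<phi> x - (\<Sum>\<chi>\<in>Irr G. \<chi> x * \<chi> (inv b))" for x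
  have "class_fun f" unfolding class_fun_def
  proof (intro ballI)
    fix g y assume g: "g \<in> carrier G" and y: "y \<in> carrier G"
    have "\<phi> (y \<otimes> g \<otimes> inv y) = (\<Sum>h\<in>carrier G. if (h \<otimes> y) \<otimes> g \<otimes> inv (h \<otimes> y) = b then 1 else 0)"
      unfolding \<phi>_def using g y by (intro sum.cong refl) (simp add: m_assoc inv_mult_group)
    also have "\<dots> = \<phi> g" unfolding \<phi>_def
      by (rule sum_right_mult[OF y, of "\<lambda>h. if h \<otimes> g \<otimes> inv h = b then 1 else 0"])
    finally show "f (y \<otimes> g \<otimes> inv y) = f g"
      unfolding f_def by (simp add: class_funD[OF Irr_class_fun g y] cong: sum.cong)
  qed
  moreover have "(\<Sum>g\<in>carrier G. f g * \<psi> (inv g)) = 0" if psi: "\<psi> \<in> Irr G" for \<psi>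
  proof -
    have cf: "class_fun \<psi>" by (rule Irr_class_fun[OF psi])
    have "(\<Sum>g\<in>carrier G. \<phi> g * \<psi> (inv g)) =
        (\<Sum>g\<in>carrier G. \<Sum>h\<in>carrier G. if h \<otimes> g \<otimes> inv h = b then \<psi> (inv g) else 0)"
      unfolding \<phi>_def sum_distrib_right by (intro sum.cong) auto
    also have "\<dots> = (\<Sum>h\<in>carrier G. \<Sum>g\<in>carrier G. if h \<otimes> g \<otimes> inv h = b then \<psi> (inv g) else 0)"
      by (rule sum.swap)
    also have "\<dots> = (\<Sum>h\<in>carrier G. \<psi> (inv b))"
    proof (intro sum.cong refl)
      fix h assume h: "h \<in> carrier G"
      have "(\<Sum>g\<in>carrier G. if h \<otimes> g \<otimes> inv h = b then \<psi> (inv g) else 0) =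
          (\<Sum>g\<in>carrier G. if h \<otimes> g \<otimes> inv h = b then \<psi> (inv (h \<otimes> g \<otimes> inv h)) else 0)"
      proof (intro sum.cong refl)
        fix g assume g: "g \<in> carrier G"
        have "inv (h \<otimes> g \<otimes> inv h) = h \<otimes> inv g \<otimes> inv h" using g h by (simp add: inv_mult_group m_assoc)
        then show "(if h \<otimes> g \<otimes> inv h = b then \<psi> (inv g) else 0) =
            (if h \<otimes> g \<otimes> inv h = b then \<psi> (inv (h \<otimes> g \<otimes> inv h)) else 0)"
          by (simp only: class_funD[OF cf inv_closed[OF g] h])
      qed
      also have "\<dots> = (\<Sum>g\<in>carrier G. if g = b then \<psi> (inv g) else 0)"
        by (rule sum_conj[OF h, of "\<lambda>g. if g = b then \<psi> (inv g) else 0"])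
      finally show "(\<Sum>g\<in>carrier G. if h \<otimes> g \<otimes> inv h = b then \<psi> (inv g) else 0) = \<psi> (inv b)"
        using b by simp
    qed
    finally have 1: "(\<Sum>g\<in>carrier G. \<phi> g * \<psi> (inv g)) = ?N * \<psi> (inv b)" by (simp add: Coset.order_def)
    have "(\<Sum>g\<in>carrier G. (\<Sum>\<chi>\<in>Irr G. \<chi> g * \<chi> (inv b)) * \<psi> (inv g)) =
        (\<Sum>g\<in>carrier G. \<Sum>\<chi>\<in>Irr G. \<chi> (inv b) * (\<chi> g * \<psi> (inv g)))"
      unfolding sum_distrib_right by (intro sum.cong refl) (simp add: mult_ac)
    also have "\<dots> = (\<Sum>\<chi>\<in>Irr G. \<chi> (inv b) * (\<Sum>g\<in>carrier G. \<chi> g * \<psi> (inv g)))"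
      by (subst sum.swap) (simp add: sum_distrib_left)
    also have "\<dots> = (\<Sum>\<chi>\<in>Irr G. if \<chi> = \<psi> then \<psi> (inv b) * ?N else 0)"
      using Irr_norm[OF psi] Irr_orthogonal[OF _ psi] by (intro sum.cong refl) auto
    also have "\<dots> = ?N * \<psi> (inv b)" using psi finite_Irr by simp
    finally show ?thesis using 1 by (simp add: f_def left_diff_distrib sum_subtractf)
  qed
  ultimately have "f a = 0" by (rule class_fun_eq_0[OF _ _ a])
  moreover have "\<phi> a = of_nat (card {h \<in> carrier G. h \<otimes> a \<otimes> inv h = b})"
    unfolding \<phi>_def by (simp add: sum.If_cases Int_def)
  ultimately show ?thesis by (simp add: f_def)
qed

end

section \<open>Galois conjugation and characters trivial on a normal subgroup\<close>

context finite_group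
begin

text \<open>Converse of \<open>Irr_functional_equation\<close>. By completeness
  \<open>\<phi>\<close> has a nonzero inner product \<open>c\<close> with some irreducible
  \<open>\<psi>\<close>. Evaluating \<open>\<Sum>\<^sub>b \<phi>(a b)
  \<psi>(b\<^sup>-\<^sup>1)\<close> once by the equation for \<open>\<phi>\<close> and once by that
  for \<open>\<psi>\<close> gives \<open>c \<phi>(a) = c \<psi>(a)/\<psi>(1)\<close>.\<close>

lemma functional_equation_imp_Irr:
  assumes f: "class_fun \<phi>" and x: "x \<in> carrier G" "\<phi> x \<noteq> 0"
    and eq: "\<And>a b. a \<in> carrier G \<Longrightarrow> b \<in> carrier G \<Longrightarrow>
      of_nat (Coset.order G) * (\<phi> a * \<phi> b) = (\<Sum>h\<in>carrier G. \<phi> (a \<otimes> (h \<otimes> b \<otimes> inv h)))"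
  shows "\<exists>\<psi>\<in>Irr G. \<forall>a\<in>carrier G. \<phi> a * \<psi> \<one> = \<psi> a"
proof -
  let ?N = "of_nat (Coset.order G) :: complex"
  have N0: "?N \<noteq> 0" using order_pos by simp
  obtain \<psi> where psi: "\<psi> \<in> Irr G" and c0: "(\<Sum>g\<in>carrier G. \<phi> g * \<psi> (inv g)) \<noteq> 0"
    using class_fun_eq_0[OF f _ x(1)] x(2) by blast
  define c where "c = (\<Sum>g\<in>carrier G. \<phi> g * \<psi> (inv g))"
  note cf = Irr_class_fun[OF psi]
  have inv_conj: "inv (h \<otimes> b \<otimes> inv h) = h \<otimes> inv b \<otimes> inv h" if "h \<in> carrier G" "b \<in> carrier G" for h b
    using that by (simp add: inv_mult_group m_assoc)
  have "\<phi> a * \<psi> \<one> = \<psi> a" if a: "a \<in> carrier G" for a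
  proof -
    define D where "D = (\<Sum>b\<in>carrier G. \<phi> (a \<otimes> b) * \<psi> (inv b))"
    have "?N * (\<phi> a * c) = (\<Sum>b\<in>carrier G. ?N * (\<phi> a * \<phi> b) * \<psi> (inv b))"
      by (simp add: c_def sum_distrib_left mult.assoc)
    also have "\<dots> = (\<Sum>b\<in>carrier G. \<Sum>h\<in>carrier G. \<phi> (a \<otimes> (h \<otimes> b \<otimes> inv h)) * \<psi> (inv b))"
      using a by (intro sum.cong refl) (simp add: eq sum_distrib_right)
    also have "\<dots> = (\<Sum>h\<in>carrier G. \<Sum>b\<in>carrier G. \<phi> (a \<otimes> (h \<otimes> b \<otimes> inv h)) * \<psi> (inv b))"
      by (rule sum.swap)
    also have "\<dots> = (\<Sum>h\<in>carrier G. D)"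
    proof (intro sum.cong refl)
      fix h assume h: "h \<in> carrier G"
      have "(\<Sum>b\<in>carrier G. \<phi> (a \<otimes> (h \<otimes> b \<otimes> inv h)) * \<psi> (inv b)) =
          (\<Sum>b\<in>carrier G. \<phi> (a \<otimes> (h \<otimes> b \<otimes> inv h)) * \<psi> (inv (h \<otimes> b \<otimes> inv h)))"
        using h by (intro sum.cong refl) (simp add: inv_conj class_funD[OF cf])
      also have "\<dots> = D" unfolding D_def by (rule sum_conj[OF h])
      finally show "(\<Sum>b\<in>carrier G. \<phi> (a \<otimes> (h \<otimes> b \<otimes> inv h)) * \<psi> (inv b)) = D" .
    qed
    finally have 1: "\<phi> a * c = D" using N0 by (simp add: Coset.order_def)
    have "D = (\<Sum>b\<in>carrier G. \<phi> (a \<otimes> b) * \<psi> (inv (a \<otimes> b) \<otimes> a))"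
      unfolding D_def using a by (intro sum.cong refl) (simp add: inv_mult_group m_assoc)
    also have "\<dots> = (\<Sum>b\<in>carrier G. \<phi> b * \<psi> (inv b \<otimes> a))" by (rule sum_left_mult[OF a])
    also have "\<dots> = (\<Sum>b\<in>carrier G. \<phi> b * \<psi> (a \<otimes> inv b))"
      using class_fun_swap[OF cf _ a] by (intro sum.cong refl) simp
    finally have D: "D = (\<Sum>b\<in>carrier G. \<phi> b * \<psi> (a \<otimes> inv b))" .
    have "?N * D = (\<Sum>h\<in>carrier G. \<Sum>b\<in>carrier G. \<phi> b * \<psi> (a \<otimes> inv b))"
      unfolding D by (simp add: Coset.order_def)
    also have "\<dots> = (\<Sum>h\<in>carrier G. \<Sum>b\<in>carrier G. \<phi> b * \<psi> (a \<otimes> (h \<otimes> inv b \<otimes> inv h)))"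
    proof (rule sum.cong[OF refl])
      fix h assume h: "h \<in> carrier G"
      have "(\<Sum>b\<in>carrier G. \<phi> b * \<psi> (a \<otimes> inv b)) =
          (\<Sum>b\<in>carrier G. \<phi> (h \<otimes> b \<otimes> inv h) * \<psi> (a \<otimes> inv (h \<otimes> b \<otimes> inv h)))"
        by (rule sum_conj[OF h, symmetric])
      also have "\<dots> = (\<Sum>b\<in>carrier G. \<phi> b * \<psi> (a \<otimes> (h \<otimes> inv b \<otimes> inv h)))"
        using h by (intro sum.cong refl) (simp add: inv_conj class_funD[OF f])
      finally show "(\<Sum>b\<in>carrier G. \<phi> b * \<psi> (a \<otimes> inv b)) =
          (\<Sum>b\<in>carrier G. \<phi> b * \<psi> (a \<otimes> (h \<otimes> inv b \<otimes> inv h)))" .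
    qed
    also have "\<dots> = (\<Sum>b\<in>carrier G. \<phi> b * (\<Sum>h\<in>carrier G. \<psi> (a \<otimes> (h \<otimes> inv b \<otimes> inv h))))"
      by (subst sum.swap) (simp add: sum_distrib_left)
    finally have ND: "?N * D = (\<Sum>b\<in>carrier G. \<phi> b * (\<Sum>h\<in>carrier G. \<psi> (a \<otimes> (h \<otimes> inv b \<otimes> inv h))))" .
    have "?N * D * \<psi> \<one> = (\<Sum>b\<in>carrier G. \<phi> b * (\<psi> \<one> * (\<Sum>h\<in>carrier G. \<psi> (a \<otimes> (h \<otimes> inv b \<otimes> inv h)))))"
      unfolding ND sum_distrib_right by (intro sum.cong refl) (simp only: mult_ac)
    also have "\<dots> = (\<Sum>b\<in>carrier G. \<phi> b * (?N * (\<psi> a * \<psi> (inv b))))"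
      by (intro sum.cong refl) (simp add: Irr_functional_equation[OF psi a])
    also have "\<dots> = ?N * (\<psi> a * c)" by (simp add: c_def sum_distrib_left mult_ac)
    finally have "D * \<psi> \<one> = \<psi> a * c" using N0 by simp
    then have "\<phi> a * \<psi> \<one> * c = \<psi> a * c" unfolding 1[symmetric] by (simp only: mult_ac)
    then show ?thesis using c0 unfolding c_def[symmetric] by simp
  qed
  then show ?thesis using psi by blast
qed

text \<open>A ring homomorphism that fixes the natural numbers transports the functional equation.
  The conclusion only fixes the image of \<open>\<chi>\<close> up to a factor, which is enough to
  decide with which irreducible characters it has a nonzero inner product. The functional equation
  is used because \<open>\<sigma>\<close> cannot be applied to the matrices of a representation,
  whose entries need not be algebraic.\<close>

lemma ring_automorphism_Irr:
  assumes chi: "\<chi> \<in> Irr G" and F: "\<And>g. g \<in> carrier G \<Longrightarrow> \<chi> g \<in> F"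
    and rat: "\<And>n::nat. of_nat n \<in> F \<and> \<sigma> (of_nat n) = of_nat n"
    and add: "\<And>x y. x \<in> F \<Longrightarrow> y \<in> F \<Longrightarrow> x + y \<in> F \<and> \<sigma> (x + y) = \<sigma> x + \<sigma> y"
    and mult: "\<And>x y. x \<in> F \<Longrightarrow> y \<in> F \<Longrightarrow> x * y \<in> F \<and> \<sigma> (x * y) = \<sigma> x * \<sigma> y"
  shows "\<exists>\<psi>\<in>Irr G. \<exists>c. \<forall>a\<in>carrier G. \<sigma> (\<chi> a) = c * \<psi> a"
proof -
  let ?N = "of_nat (Coset.order G) :: complex"
  obtain d where d: "d > 0" "\<chi> \<one> = of_nat d" using Irr_one[OF chi] by metis
  have sum: "sum f A \<in> F \<and> \<sigma> (sum f A) = (\<Sum>x\<in>A. \<sigma> (f x))" if "finite A" "\<And>x. x \<in> A \<Longrightarrow> f x \<in> F" for f :: "'a \<Rightarrow> complex" and A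
    using that
  proof (induction A rule: finite_induct)
    case empty
    then show ?case using rat[of 0] by simp
  next
    case (insert x A)
    then show ?case using add by simp
  qed
  define \<phi> where "\<phi> a = \<sigma> (\<chi> a) / of_nat d" for a
  have "class_fun \<phi>" unfolding class_fun_def \<phi>_def
    using class_funD[OF Irr_class_fun[OF chi]] by simp
  moreover have "\<phi> \<one> \<noteq> 0" using d rat[of d] by (simp add: \<phi>_def)
  moreover have "?N * (\<phi> a * \<phi> b) = (\<Sum>h\<in>carrier G. \<phi> (a \<otimes> (h \<otimes> b \<otimes> inv h)))"
    if a: "a \<in> carrier G" and b: "b \<in> carrier G" for a b
  proof -
    have s: "(\<Sum>h\<in>carrier G. \<chi> (a \<otimes> (h \<otimes> b \<otimes> inv h))) \<in> F \<and>
        \<sigma> (\<Sum>h\<in>carrier G. \<chi> (a \<otimes> (h \<otimes> b \<otimes> inv h))) = (\<Sum>h\<in>carrier G. \<sigma> (\<chi> (a \<otimes> (h \<otimes> b \<otimes> inv h))))"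
      using a b by (intro sum F) auto
    have "?N * (\<sigma> (\<chi> a) * \<sigma> (\<chi> b)) = \<sigma> (?N * (\<chi> a * \<chi> b))"
      using mult F[OF a] F[OF b] rat[of "Coset.order G"] by simp
    also have "\<dots> = \<sigma> (of_nat d * (\<Sum>h\<in>carrier G. \<chi> (a \<otimes> (h \<otimes> b \<otimes> inv h))))"
      using Irr_functional_equation[OF chi a b] d by simp
    also have "\<dots> = of_nat d * (\<Sum>h\<in>carrier G. \<sigma> (\<chi> (a \<otimes> (h \<otimes> b \<otimes> inv h))))"
      using s mult rat[of d] by simp
    finally have "?N * (\<sigma> (\<chi> a) * \<sigma> (\<chi> b)) / (of_nat d * of_nat d) =
        (\<Sum>h\<in>carrier G. \<sigma> (\<chi> (a \<otimes> (h \<otimes> b \<otimes> inv h)))) / of_nat d"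
      using d by (simp add: field_simps)
    then show ?thesis by (simp add: \<phi>_def sum_divide_distrib)
  qed
  ultimately obtain \<psi> where psi: "\<psi> \<in> Irr G" and eq: "\<And>a. a \<in> carrier G \<Longrightarrow> \<phi> a * \<psi> \<one> = \<psi> a"
    using functional_equation_imp_Irr[of \<phi> \<one>] by auto
  obtain e where e: "e > 0" "\<psi> \<one> = of_nat e" using Irr_one[OF psi] by metis
  have "\<sigma> (\<chi> a) = (of_nat d / of_nat e) * \<psi> a" if "a \<in> carrier G" for a
    using eq[OF that, symmetric] d e by (simp add: \<phi>_def)
  then show ?thesis using psi by blast
qed

text \<open>The sum of \<open>\<rho>\<close> over \<open>M\<close> commutes with
  \<open>\<rho>\<close>, so it is a scalar \<open>c\<close>, and \<open>c\<^sup>2 = \<bar>M\<bar>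
  c\<close>. The case \<open>c = \<bar>M\<bar>\<close> says that \<open>M\<close> is contained in
  the kernel, the case \<open>c = 0\<close> that it is not.\<close>

lemma Irr_normal_sum:
  assumes chi: "\<chi> \<in> Irr G" and M: "M \<lhd> G"
  obtains c where "c = 0 \<or> c = of_nat (card M)" "\<And>a. a \<in> carrier G \<Longrightarrow> (\<Sum>m\<in>M. \<chi> (a \<otimes> m)) = c * \<chi> a"
proof -
  interpret M: Coset.normal M G by (rule M)
  obtain n \<rho> where r: "irreducible_rep G n \<rho>" and c: "\<And>g. g \<in> carrier G \<Longrightarrow> \<chi> g = mat_trace (\<rho> g)"
    using IrrE[OF chi] by metis
  note h = irreducible_repD(1)[OF r] and n = irreducible_repD(2)[OF r]
  note rc = rep_carrier[OF h]
  have Mc: "m \<in> carrier G" if "m \<in> M" for m using M.subset that by auto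
  define E where "E = msum n n \<rho> M"
  have Ec: "E \<in> carrier_mat n n" by (simp add: E_def)
  have aE: "\<rho> a * E = msum n n (\<lambda>m. \<rho> (a \<otimes> m)) M" if a: "a \<in> carrier G" for a
  proof -
    have "\<rho> a * E = msum n n (\<lambda>m. \<rho> a * \<rho> m) M"
      unfolding E_def by (rule mult_msum[OF rc[OF a]]) (rule rc[OF Mc])
    also have "\<dots> = msum n n (\<lambda>m. \<rho> (a \<otimes> m)) M"
      using a Mc by (intro msum_cong) (simp add: rep_mult[OF h])
    finally show ?thesis .
  qed
  have conj: "bij_betw (\<lambda>m. a \<otimes> m \<otimes> inv a) M M" if a: "a \<in> carrier G" for a
  proof (rule bij_betw_byWitness[where f' = "\<lambda>m. inv a \<otimes> m \<otimes> a"])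
    have cancel: "inv a \<otimes> (a \<otimes> y) = y" "a \<otimes> (inv a \<otimes> y) = y" if "y \<in> carrier G" for y
      using a that by (simp_all flip: m_assoc)
    show "\<forall>m\<in>M. inv a \<otimes> (a \<otimes> m \<otimes> inv a) \<otimes> a = m" "\<forall>m\<in>M. a \<otimes> (inv a \<otimes> m \<otimes> a) \<otimes> inv a = m"
      using a Mc by (simp_all add: m_assoc cancel)
    show "(\<lambda>m. a \<otimes> m \<otimes> inv a) ` M \<subseteq> M" "(\<lambda>m. inv a \<otimes> m \<otimes> a) ` M \<subseteq> M"
      using a M.inv_op_closed1 M.inv_op_closed2 by auto
  qed
  have comm: "\<rho> a * E = E * \<rho> a" if a: "a \<in> carrier G" for a
  proof -
    have "E * \<rho> a = msum n n (\<lambda>m. \<rho> m * \<rho> a) M"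
      unfolding E_def by (rule msum_mult[OF rc[OF a]]) (rule rc[OF Mc])
    also have "\<dots> = msum n n (\<lambda>m. \<rho> (a \<otimes> m \<otimes> inv a) * \<rho> a) M" by (rule msum_reindex[OF conj[OF a]])
    also have "\<dots> = msum n n (\<lambda>m. \<rho> (a \<otimes> m)) M"
      using a Mc by (intro msum_cong) (simp add: rep_mult[OF h, symmetric] m_assoc)
    finally show ?thesis using aE[OF a] by simp
  qed
  define k where "k = mat_trace E / of_nat n"
  have E: "E = k \<cdot>\<^sub>m 1\<^sub>m n" unfolding k_def by (rule schur_trace[OF r Ec comm])
  have sum: "(\<Sum>m\<in>M. \<chi> (a \<otimes> m)) = k * \<chi> a" if a: "a \<in> carrier G" for a
  proof -
    have "(\<Sum>m\<in>M. \<chi> (a \<otimes> m)) = (\<Sum>m\<in>M. mat_trace (\<rho> (a \<otimes> m)))"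
      using a Mc c by (intro sum.cong) auto
    also have "\<dots> = mat_trace (\<rho> a * E)"
      unfolding aE[OF a] by (rule mat_trace_msum[symmetric]) (use a Mc in \<open>auto intro: rc\<close>)
    also have "\<rho> a * E = k \<cdot>\<^sub>m \<rho> a"
      unfolding E mult_smult_distrib[OF rc[OF a] one_carrier_mat] right_mult_one_mat[OF rc[OF a]] ..
    also have "mat_trace (k \<cdot>\<^sub>m \<rho> a) = k * \<chi> a" unfolding mat_trace_smult[OF rc[OF a]] c[OF a] ..
    finally show ?thesis .
  qed
  have one: "\<chi> \<one> = of_nat n" using c rep_one[OF h] by simp
  have sM: "(\<Sum>m\<in>M. \<chi> m) = k * of_nat n" using sum[of \<one>] one Mc by simp
  have km: "k * \<chi> m = k * of_nat n" if m: "m \<in> M" for m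
  proof -
    have "bij_betw (\<lambda>x. m \<otimes> x) M M"
      by (rule bij_betw_byWitness[where f' = "\<lambda>x. inv m \<otimes> x"]) (use m Mc in \<open>auto simp: m_assoc[symmetric]\<close>)
    then have "(\<Sum>x\<in>M. \<chi> (m \<otimes> x)) = (\<Sum>x\<in>M. \<chi> x)" by (rule sum.reindex_bij_betw)
    then show ?thesis using sum[OF Mc[OF m]] sM by simp
  qed
  have "k * (k * of_nat n) = (\<Sum>m\<in>M. k * \<chi> m)" unfolding sM[symmetric] by (simp add: sum_distrib_left)
  also have "\<dots> = (\<Sum>m\<in>M. k * of_nat n)" by (rule sum.cong[OF refl km])
  also have "\<dots> = of_nat (card M) * (k * of_nat n)" by simp
  finally have "k = 0 \<or> k = of_nat (card M)" using n by simp
  then show ?thesis using sum by (rule that)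
qed

text \<open>Sum the inner products of \<open>\<chi>(g\<^sup>k)\<close> with \<open>\<chi>\<close>
  over all irreducible \<open>\<chi>\<close>, once as they are and once after summation over the
  cosets of \<open>M\<close>. Only invariant \<open>\<chi>\<close> contribute; if all of these are
  trivial on \<open>M\<close>, the second sum is \<open>\<bar>M\<bar>\<close> times the first.
  Second orthogonality rewrites both sums as numbers of pairs. Up to a common factor, the left side
  counts the classes of the quotient by \<open>M\<close>, and the right side those of
  \<open>G\<close>, that are stable under the \<open>k\<close>-th power map.\<close>

lemma fixed_Irr_class_count:
  assumes M: "M \<lhd> G"
    and gal: "\<And>\<chi>. \<chi> \<in> Irr G \<Longrightarrow> \<exists>\<psi>\<in>Irr G. \<exists>c. \<forall>a\<in>carrier G. \<chi> (a [^] (k::nat)) = c * \<psi> a"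
    and all: "\<And>\<chi>. \<chi> \<in> Irr G \<Longrightarrow> (\<And>g. g \<in> carrier G \<Longrightarrow> \<chi> (g [^] k) = \<chi> g) \<Longrightarrow> (\<Sum>m\<in>M. \<chi> m) \<noteq> 0"
  shows "(\<Sum>g\<in>carrier G. \<Sum>m\<in>M. card {h \<in> carrier G. h \<otimes> (g [^] k \<otimes> m) \<otimes> inv h = g}) =
    card M * (\<Sum>g\<in>carrier G. card {h \<in> carrier G. h \<otimes> g [^] k \<otimes> inv h = g})"
proof -
  interpret M: Coset.normal M G by (rule M)
  have Mc: "m \<in> carrier G" if "m \<in> M" for m using M.subset that by auto
  have eq: "(\<Sum>g\<in>carrier G. \<Sum>m\<in>M. \<chi> (g [^] k \<otimes> m) * \<chi> (inv g)) =
      of_nat (card M) * (\<Sum>g\<in>carrier G. \<chi> (g [^] k) * \<chi> (inv g))" if chi: "\<chi> \<in> Irr G" for \<chi>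
  proof -
    obtain c where c: "c = 0 \<or> c = of_nat (card M)"
      "\<And>a. a \<in> carrier G \<Longrightarrow> (\<Sum>m\<in>M. \<chi> (a \<otimes> m)) = c * \<chi> a"
      by (rule Irr_normal_sum[OF chi M], rule that)
    have 1: "(\<Sum>g\<in>carrier G. \<Sum>m\<in>M. \<chi> (g [^] k \<otimes> m) * \<chi> (inv g)) =
        c * (\<Sum>g\<in>carrier G. \<chi> (g [^] k) * \<chi> (inv g))"
      by (simp add: sum_distrib_right[symmetric] c(2) sum_distrib_left mult.assoc)
    show ?thesis
    proof (cases "\<forall>g\<in>carrier G. \<chi> (g [^] k) = \<chi> g")
      case True
      then have "(\<Sum>m\<in>M. \<chi> m) \<noteq> 0" using all[OF chi] by blast
      then have "c \<noteq> 0" using c(2)[of \<one>] Mc by auto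
      then show ?thesis using 1 c(1) by simp
    next
      case False
      obtain \<psi> e where psi: "\<psi> \<in> Irr G" "\<And>a. a \<in> carrier G \<Longrightarrow> \<chi> (a [^] k) = e * \<psi> a"
        using gal[OF chi] by blast
      have "\<psi> \<noteq> \<chi>"
      proof
        assume eq: "\<psi> = \<chi>"
        have "\<chi> \<one> \<noteq> 0" using Irr_one[OF chi] by (metis of_nat_eq_0_iff less_irrefl)
        then have "e = 1" using psi(2)[of \<one>] eq by simp
        then show False using psi(2) eq False by simp
      qed
      then have "(\<Sum>g\<in>carrier G. \<psi> g * \<chi> (inv g)) = 0" by (rule Irr_orthogonal[OF psi(1) chi])
      then have "(\<Sum>g\<in>carrier G. \<chi> (g [^] k) * \<chi> (inv g)) = 0"
        by (simp add: psi(2) mult.assoc flip: sum_distrib_left)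
      then show ?thesis using 1 by simp
    qed
  qed
  have "of_nat (\<Sum>g\<in>carrier G. \<Sum>m\<in>M. card {h \<in> carrier G. h \<otimes> (g [^] k \<otimes> m) \<otimes> inv h = g}) =
      (\<Sum>g\<in>carrier G. \<Sum>m\<in>M. \<Sum>\<chi>\<in>Irr G. \<chi> (g [^] k \<otimes> m) * \<chi> (inv g))"
    using Mc by (simp add: second_orthogonality)
  also have "\<dots> = (\<Sum>\<chi>\<in>Irr G. \<Sum>g\<in>carrier G. \<Sum>m\<in>M. \<chi> (g [^] k \<otimes> m) * \<chi> (inv g))"
  proof -
    have "(\<Sum>g\<in>carrier G. \<Sum>m\<in>M. \<Sum>\<chi>\<in>Irr G. \<chi> (g [^] k \<otimes> m) * \<chi> (inv g)) =
        (\<Sum>g\<in>carrier G. \<Sum>\<chi>\<in>Irr G. \<Sum>m\<in>M. \<chi> (g [^] k \<otimes> m) * \<chi> (inv g))"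
      by (intro sum.cong refl sum.swap)
    then show ?thesis by (simp add: sum.swap[of _ "Irr G" "carrier G"])
  qed
  also have "\<dots> = of_nat (card M) * (\<Sum>\<chi>\<in>Irr G. \<Sum>g\<in>carrier G. \<chi> (g [^] k) * \<chi> (inv g))"
    by (simp add: eq sum_distrib_left)
  also have "(\<Sum>\<chi>\<in>Irr G. \<Sum>g\<in>carrier G. \<chi> (g [^] k) * \<chi> (inv g)) =
      (\<Sum>g\<in>carrier G. \<Sum>\<chi>\<in>Irr G. \<chi> (g [^] k) * \<chi> (inv g))" by (rule sum.swap)
  also have "\<dots> = of_nat (\<Sum>g\<in>carrier G. card {h \<in> carrier G. h \<otimes> g [^] k \<otimes> inv h = g})"
    by (simp add: second_orthogonality)
  finally show ?thesis by (metis (no_types, lifting) of_nat_eq_iff of_nat_mult)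
qed

end

section \<open>Cyclotomic integers and actions of p-groups\<close>

text \<open>The integers of the \<open>n\<close>-th cyclotomic field, as integral combinations of
  the powers of one primitive root of unity, so that these powers can index the rows of a
  matrix.\<close>

definition cyclotomic_int :: "nat \<Rightarrow> complex set" where
  "cyclotomic_int n = {\<Sum>j<n. of_int (c j) * exp (2 * of_real pi * \<i> / of_nat n) ^ j | c :: nat \<Rightarrow> int. True}"

lemma root_of_unity_powers:
  assumes n: "n > 0" and e: "e ^ n = (1::complex)"
  obtains j where "j < n" "e = exp (2 * of_real pi * \<i> / of_nat n) ^ j"
proof -
  have "e \<in> {z. z ^ n = 1}" using e by simp
  then obtain j where j: "j < n" "e = cis (2 * pi * real j / real n)"
    using bij_betw_roots_unity[OF n] unfolding bij_betw_def by auto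
  have "e = exp (2 * of_real pi * \<i> / of_nat n) ^ j"
    unfolding j(2) by (simp add: cis_conv_exp mult_ac flip: exp_of_nat_mult)
  with j(1) show ?thesis by (rule that)
qed

lemma exp_root_of_unity: "n > 0 \<Longrightarrow> exp (2 * of_real pi * \<i> / of_nat n) ^ n = 1"
  by (simp flip: exp_of_nat_mult)

lemma cyclotomic_int_0: "0 \<in> cyclotomic_int n"
  unfolding cyclotomic_int_def by (intro CollectI exI[of _ "\<lambda>_. 0"]) simp

lemma cyclotomic_int_add: "x \<in> cyclotomic_int n \<Longrightarrow> y \<in> cyclotomic_int n \<Longrightarrow> x + y \<in> cyclotomic_int n"
proof -
  assume "x \<in> cyclotomic_int n" "y \<in> cyclotomic_int n"
  then obtain c d :: "nat \<Rightarrow> int" where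
    x: "x = (\<Sum>j<n. of_int (c j) * exp (2 * of_real pi * \<i> / of_nat n) ^ j)" and
    y: "y = (\<Sum>j<n. of_int (d j) * exp (2 * of_real pi * \<i> / of_nat n) ^ j)"
    unfolding cyclotomic_int_def by auto
  have "x + y = (\<Sum>j<n. of_int (c j + d j) * exp (2 * of_real pi * \<i> / of_nat n) ^ j)"
    unfolding x y by (simp add: algebra_simps sum.distrib)
  then show ?thesis unfolding cyclotomic_int_def by (intro CollectI exI[of _ "\<lambda>j. c j + d j"]) simp
qed

lemma cyclotomic_int_uminus: "x \<in> cyclotomic_int n \<Longrightarrow> - x \<in> cyclotomic_int n"
proof -
  assume "x \<in> cyclotomic_int n"
  then obtain c :: "nat \<Rightarrow> int" where
    x: "x = (\<Sum>j<n. of_int (c j) * exp (2 * of_real pi * \<i> / of_nat n) ^ j)"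
    unfolding cyclotomic_int_def by auto
  have "- x = (\<Sum>j<n. of_int (- c j) * exp (2 * of_real pi * \<i> / of_nat n) ^ j)"
    unfolding x by (simp add: sum_negf)
  then show ?thesis unfolding cyclotomic_int_def by (intro CollectI exI[of _ "\<lambda>j. - c j"]) simp
qed

lemma root_of_unity_cyclotomic_int:
  assumes "n > 0" "e ^ n = 1"
  shows "e \<in> cyclotomic_int n"
proof -
  obtain j where j: "j < n" "e = exp (2 * of_real pi * \<i> / of_nat n) ^ j"
    by (rule root_of_unity_powers[OF assms])
  then have "e = (\<Sum>i<n. of_int (if i = j then 1 else 0) * exp (2 * of_real pi * \<i> / of_nat n) ^ i)"
    by (simp add: if_distrib[of "\<lambda>x. x * _"] if_distrib[of of_int] cong: if_cong)
  then show ?thesis unfolding cyclotomic_int_def by (intro CollectI exI[of _ "\<lambda>i. if i = j then 1 else 0"]) simp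
qed

text \<open>Multiplication by \<open>s\<close> permutes and combines the powers of the root of unity
  with integer coefficients, so \<open>s\<close> is an eigenvalue of an integer circulant matrix,
  hence a root of its monic integral characteristic polynomial.\<close>

lemma cyclotomic_int_algebraic_int:
  assumes n: "n > 0" and s: "s \<in> cyclotomic_int n"
  shows "algebraic_int s"
proof -
  define z where "z = exp (2 * of_real pi * \<i> / of_nat n)"
  have zn: "z ^ n = 1" unfolding z_def by (rule exp_root_of_unity[OF n])
  have zmod: "z ^ (m mod n) = z ^ m" for m
  proof -
    have "z ^ m = z ^ (n * (m div n) + m mod n)" by simp
    also have "\<dots> = z ^ (m mod n)" unfolding power_add power_mult zn by simp
    finally show ?thesis by simp
  qed
  obtain c where s: "s = (\<Sum>j<n. of_int (c j) * z ^ j)"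
    using s unfolding cyclotomic_int_def z_def by auto
  define C where "C = mat n n (\<lambda>(j, l). \<Sum>i<n. if (i + j) mod n = l then c i else 0)"
  have Cc: "C \<in> carrier_mat n n" by (simp add: C_def)
  let ?D = "map_mat of_int C :: complex mat"
  have Dc: "?D \<in> carrier_mat n n" using Cc by simp
  define v where "v = vec n (\<lambda>l. z ^ l)"
  have vc: "v \<in> carrier_vec n" by (simp add: v_def)
  have "?D *\<^sub>v v = s \<cdot>\<^sub>v v"
  proof (rule eq_vecI)
    fix j assume "j < dim_vec (s \<cdot>\<^sub>v v)"
    then have j: "j < n" by (simp add: v_def)
    have "(?D *\<^sub>v v) $ j = (\<Sum>l<n. of_int (\<Sum>i<n. if (i + j) mod n = l then c i else 0) * z ^ l)"
      using j by (simp add: C_def v_def scalar_prod_def lessThan_atLeast0)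
    also have "\<dots> = (\<Sum>l<n. \<Sum>i<n. if l = (i + j) mod n then of_int (c i) * z ^ (i + j) else 0)"
      unfolding of_int_sum sum_distrib_right by (intro sum.cong refl) (auto simp: zmod)
    also have "\<dots> = (\<Sum>i<n. \<Sum>l<n. if l = (i + j) mod n then of_int (c i) * z ^ (i + j) else 0)" by (rule sum.swap)
    also have "\<dots> = (\<Sum>i<n. of_int (c i) * z ^ (i + j))" using n by simp
    also have "\<dots> = s * z ^ j" by (simp add: s power_add sum_distrib_right mult.assoc)
    finally show "(?D *\<^sub>v v) $ j = (s \<cdot>\<^sub>v v) $ j" using j by (simp add: v_def)
  qed (simp add: C_def v_def)
  moreover have "v \<noteq> 0\<^sub>v n"
  proof
    assume "v = 0\<^sub>v n"
    then have "v $ 0 = 0" using n by simp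
    then show False using n by (simp add: v_def)
  qed
  ultimately have "eigenvalue ?D s"
    unfolding eigenvalue_def eigenvector_def using vc Dc by auto
  then have root: "poly (map_poly of_int (char_poly C)) s = 0"
    unfolding eigenvalue_root_char_poly[OF Dc] of_int_hom.char_poly_hom[OF Cc] .
  moreover have "lead_coeff (char_poly C) = 1" using degree_monic_char_poly[OF Cc] by simp
  ultimately show ?thesis unfolding algebraic_int_altdef_ipoly by blast
qed

lemma dvd_of_cyclotomic_int:
  assumes n: "n > 0" and s: "s \<in> cyclotomic_int n" and eq: "of_nat d = of_nat p * s" and p: "p > 0"
  shows "p dvd d"
proof -
  have "s = of_nat d / of_nat p" using eq p by simp
  then have "s \<in> \<rat>" by simp
  then have "s \<in> \<int>" using rational_algebraic_int_is_int[OF cyclotomic_int_algebraic_int[OF n s]] by simp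
  then obtain k where "s = of_int k" by (elim Ints_cases)
  then have "(of_int (int d) :: complex) = of_int (int p * k)" using eq by simp
  then have "int d = int p * k" unfolding of_int_eq_iff .
  then have "int p dvd int d" by simp
  then show ?thesis by simp
qed

text \<open>All fibres of the orbit map are translates of the stabiliser.\<close>

lemma orbit_card_dvd:
  assumes P: "Group.group P" and fin: "finite (carrier P)"
    and one: "act \<one>\<^bsub>P\<^esub> x = x"
    and mult: "\<And>g h. g \<in> carrier P \<Longrightarrow> h \<in> carrier P \<Longrightarrow> act (g \<otimes>\<^bsub>P\<^esub> h) x = act g (act h x)"
  shows "card ((\<lambda>g. act g x) ` carrier P) dvd card (carrier P)"
proof -
  interpret P: Group.group P by (rule P)
  have fibre: "card {g\<in>carrier P. act g x = y} = card {g\<in>carrier P. act g x = x}"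
    if y: "y \<in> (\<lambda>g. act g x) ` carrier P" for y
  proof -
    obtain h where h: "h \<in> carrier P" "y = act h x" using y by auto
    have ret: "act (inv\<^bsub>P\<^esub> h) (act h x) = x" using mult[of "inv\<^bsub>P\<^esub> h" h] h one by simp
    have "bij_betw (\<lambda>g. h \<otimes>\<^bsub>P\<^esub> g) {g\<in>carrier P. act g x = x} {g\<in>carrier P. act g x = y}"
      by (rule bij_betw_byWitness[where f' = "\<lambda>g. inv\<^bsub>P\<^esub> h \<otimes>\<^bsub>P\<^esub> g"])
        (use h mult ret in \<open>auto simp: P.m_assoc[symmetric]\<close>)
    then show ?thesis by (simp add: bij_betw_same_card)
  qed
  have "card (carrier P) = (\<Sum>y\<in>(\<lambda>g. act g x) ` carrier P. card {g\<in>carrier P. act g x = y})"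
    unfolding card_eq_sum by (rule sum.image_gen[OF fin])
  also have "\<dots> = card ((\<lambda>g. act g x) ` carrier P) * card {g\<in>carrier P. act g x = x}" by (simp add: fibre)
  finally show ?thesis by simp
qed

text \<open>Orbits without fixed points have length divisible by \<open>p\<close>, and an invariant
  function is constant on them. Stating this for sums in an additive group \<open>A\<close>, rather
  than for cardinalities, yields both the fixed point theorem for \<open>p\<close>-groups (take the
  constant 1) and the divisibility of character degrees.\<close>

lemma p_group_action_sum:
  fixes f :: "'x \<Rightarrow> complex"
  assumes P: "Group.group P" "card (carrier P) = p ^ a" "Factorial_Ring.prime p"
    and \<Omega>: "finite \<Omega>"
    and act: "\<And>g x. g \<in> carrier P \<Longrightarrow> x \<in> \<Omega> \<Longrightarrow> act g x \<in> \<Omega>"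
    and one: "\<And>x. x \<in> \<Omega> \<Longrightarrow> act \<one>\<^bsub>P\<^esub> x = x"
    and mult: "\<And>g h x. g \<in> carrier P \<Longrightarrow> h \<in> carrier P \<Longrightarrow> x \<in> \<Omega> \<Longrightarrow> act (g \<otimes>\<^bsub>P\<^esub> h) x = act g (act h x)"
    and f: "\<And>g x. g \<in> carrier P \<Longrightarrow> x \<in> \<Omega> \<Longrightarrow> f (act g x) = f x"
    and A0: "0 \<in> A" and Aadd: "\<And>u v. u \<in> A \<Longrightarrow> v \<in> A \<Longrightarrow> u + v \<in> A" and fA: "\<And>x. x \<in> \<Omega> \<Longrightarrow> f x \<in> A"
  shows "\<exists>s\<in>A. (\<Sum>x\<in>\<Omega>. f x) = (\<Sum>x\<in>{x\<in>\<Omega>. \<forall>g\<in>carrier P. act g x = x}. f x) + of_nat p * s"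
  using \<Omega> act one mult f fA
proof (induction "card \<Omega>" arbitrary: \<Omega> rule: less_induct)
  case (less \<Omega>)
  interpret P: Group.group P by (rule P)
  note act = less.prems(2) and one = less.prems(3) and mult = less.prems(4) and f = less.prems(5) and fA = less.prems(6)
  have finP: "finite (carrier P)" using P(2,3) prime_gt_0_nat[of p] by (intro card_ge_0_finite) simp
  let ?F = "\<lambda>\<Omega>. {x\<in>\<Omega>. \<forall>g\<in>carrier P. act g x = x}"
  show ?case
  proof (cases "\<forall>x\<in>\<Omega>. \<forall>g\<in>carrier P. act g x = x")
    case True
    then have "?F \<Omega> = \<Omega>" by auto
    then show ?thesis using A0 by (intro bexI[of _ 0]) auto
  next
    case False
    then obtain x g0 where x: "x \<in> \<Omega>" and g0: "g0 \<in> carrier P" "act g0 x \<noteq> x" by blast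
    define Orb where "Orb = (\<lambda>g. act g x) ` carrier P"
    have OX: "Orb \<subseteq> \<Omega>" using act x by (auto simp: Orb_def)
    have xO: "x \<in> Orb" unfolding Orb_def using one[OF x] by (metis P.one_closed imageI)
    have finO: "finite Orb" using finP by (simp add: Orb_def)
    have Oact: "act g y \<in> Orb" if g: "g \<in> carrier P" and y: "y \<in> Orb" for g y
    proof -
      obtain h where h: "h \<in> carrier P" "y = act h x" using y by (auto simp: Orb_def)
      then have "act g y = act (g \<otimes>\<^bsub>P\<^esub> h) x" using mult[OF g h(1) x] by simp
      then show ?thesis unfolding Orb_def using g h(1) by (metis P.m_closed imageI)
    qed
    have ret: "act (inv\<^bsub>P\<^esub> g) (act g y) = y" if "g \<in> carrier P" "y \<in> \<Omega>" for g y
      using mult[of "inv\<^bsub>P\<^esub> g" g y] that one by simp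
    have "card Orb dvd p ^ a"
      using orbit_card_dvd[where act = act and x = x, OF P(1) finP one[OF x] mult[OF _ _ x]] P(2) by (simp add: Orb_def)
    then obtain b where b: "card Orb = p ^ b" using divides_primepow_nat[OF P(3)] by auto
    have "act g0 x \<in> Orb" using g0 by (auto simp: Orb_def)
    then have "card {x, act g0 x} \<le> card Orb" using xO finO by (intro card_mono) auto
    then have "card Orb \<noteq> 1" using g0(2) by simp
    then have "b \<noteq> 0" using b by auto
    then have "p dvd card Orb" unfolding b by simp
    then obtain q where q: "card Orb = p * q" by (elim dvdE)
    have \<Omega>': "card (\<Omega> - Orb) < card \<Omega>" using xO OX less.prems(1) by (intro psubset_card_mono) auto
    have inv': "act g y \<in> \<Omega> - Orb" if "g \<in> carrier P" "y \<in> \<Omega> - Orb" for g y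
    proof -
      have "act g y \<notin> Orb"
      proof
        assume "act g y \<in> Orb"
        then have "act (inv\<^bsub>P\<^esub> g) (act g y) \<in> Orb" by (rule Oact[OF P.inv_closed[OF that(1)]])
        then show False using ret[of g y] that by simp
      qed
      then show ?thesis using act that by simp
    qed
    have "\<exists>s\<in>A. (\<Sum>x\<in>\<Omega> - Orb. f x) = (\<Sum>x\<in>?F (\<Omega> - Orb). f x) + of_nat p * s"
      by (rule less.hyps[OF \<Omega>']) (use less.prems inv' in auto)
    then obtain s where s: "s \<in> A" "(\<Sum>x\<in>\<Omega> - Orb. f x) = (\<Sum>x\<in>?F (\<Omega> - Orb). f x) + of_nat p * s" by blast
    have nofix: "\<not> (\<forall>g\<in>carrier P. act g y = y)" if y: "y \<in> Orb" for y
    proof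
      assume a: "\<forall>g\<in>carrier P. act g y = y"
      obtain h where h: "h \<in> carrier P" "y = act h x" using y by (auto simp: Orb_def)
      have "x = act (inv\<^bsub>P\<^esub> h) y" using ret[OF h(1) x] h(2) by simp
      also have "\<dots> = y" using a h(1) by simp
      finally show False using a g0 by auto
    qed
    then have FX: "?F \<Omega> = ?F (\<Omega> - Orb)" using OX by auto
    have "(\<Sum>x\<in>\<Omega>. f x) = (\<Sum>x\<in>\<Omega> - Orb. f x) + (\<Sum>x\<in>Orb. f x)"
      by (rule sum.subset_diff[OF OX less.prems(1)])
    also have "(\<Sum>y\<in>Orb. f y) = (\<Sum>y\<in>Orb. f x)"
      using f x by (intro sum.cong refl) (auto simp: Orb_def)
    also have "\<dots> = of_nat p * (of_nat q * f x)" using q by simp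
    finally have eq: "(\<Sum>x\<in>\<Omega>. f x) = (\<Sum>x\<in>?F \<Omega>. f x) + of_nat p * (s + of_nat q * f x)"
      unfolding s(2) FX by (simp add: algebra_simps)
    have "of_nat m * f x \<in> A" for m
      by (induction m) (use A0 Aadd fA[OF x] in \<open>auto simp: algebra_simps\<close>)
    then show ?thesis using eq Aadd s(1) by blast
  qed
qed

lemma p_group_action_card:
  assumes P: "Group.group P" "card (carrier P) = p ^ a" "Factorial_Ring.prime p"
    and \<Omega>: "finite \<Omega>"
    and act: "\<And>g x. g \<in> carrier P \<Longrightarrow> x \<in> \<Omega> \<Longrightarrow> act g x \<in> \<Omega>"
    and one: "\<And>x. x \<in> \<Omega> \<Longrightarrow> act \<one>\<^bsub>P\<^esub> x = x"
    and mult: "\<And>g h x. g \<in> carrier P \<Longrightarrow> h \<in> carrier P \<Longrightarrow> x \<in> \<Omega> \<Longrightarrow> act (g \<otimes>\<^bsub>P\<^esub> h) x = act g (act h x)"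
  shows "\<exists>q. card \<Omega> = card {x\<in>\<Omega>. \<forall>g\<in>carrier P. act g x = x} + p * q"
proof -
  have "\<exists>s\<in>\<nat>. (\<Sum>x\<in>\<Omega>. 1 :: complex) = (\<Sum>x\<in>{x\<in>\<Omega>. \<forall>g\<in>carrier P. act g x = x}. 1) + of_nat p * s"
    by (rule p_group_action_sum[OF P \<Omega> act one mult]) auto
  then obtain q where "(of_nat (card \<Omega>) :: complex) = of_nat (card {x\<in>\<Omega>. \<forall>g\<in>carrier P. act g x = x} + p * q)"
    by (auto elim!: Nats_cases)
  then show ?thesis unfolding of_nat_eq_iff by blast
qed

lemma p_group_fixed_point:
  assumes "Group.group P" "card (carrier P) = p ^ a" "Factorial_Ring.prime p"
    and "finite \<Omega>"
    and "\<And>g x. g \<in> carrier P \<Longrightarrow> x \<in> \<Omega> \<Longrightarrow> act g x \<in> \<Omega>"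
    and "\<And>x. x \<in> \<Omega> \<Longrightarrow> act \<one>\<^bsub>P\<^esub> x = x"
    and "\<And>g h x. g \<in> carrier P \<Longrightarrow> h \<in> carrier P \<Longrightarrow> x \<in> \<Omega> \<Longrightarrow> act (g \<otimes>\<^bsub>P\<^esub> h) x = act g (act h x)"
    and nd: "\<not> p dvd card \<Omega>"
  obtains x where "x \<in> \<Omega>" "\<And>g. g \<in> carrier P \<Longrightarrow> act g x = x"
proof -
  obtain q where q: "card \<Omega> = card {x\<in>\<Omega>. \<forall>g\<in>carrier P. act g x = x} + p * q"
    using p_group_action_card[of P p a \<Omega> act, OF assms(1-7)] by blast
  have "{x\<in>\<Omega>. \<forall>g\<in>carrier P. act g x = x} \<noteq> {}"
  proof
    assume "{x\<in>\<Omega>. \<forall>g\<in>carrier P. act g x = x} = {}"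
    then have "card \<Omega> = p * q" using q by (simp only: card.empty add_0)
    then show False using nd by simp
  qed
  then show ?thesis using that by blast
qed

text \<open>The permutation generates an action of the cyclic group of order
  \<open>p\<^sup>a\<close>.\<close>

lemma permutation_fixed_point:
  fixes f :: "'x \<Rightarrow> 'x"
  assumes p: "Factorial_Ring.prime p" and \<Omega>: "finite \<Omega>" "\<not> p dvd card \<Omega>"
    and f: "\<And>x. x \<in> \<Omega> \<Longrightarrow> f x \<in> \<Omega>" and id: "\<And>x. x \<in> \<Omega> \<Longrightarrow> (f ^^ (p ^ a)) x = x"
  obtains x where "x \<in> \<Omega>" "f x = x"
proof -
  define n where "n = p ^ a"
  have n: "n > 0" using p prime_gt_0_nat by (simp add: n_def)
  let ?Z = "integer_mod_group n"
  have car: "carrier ?Z = {0..<int n}" using n by (simp add: carrier_integer_mod_group)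
  have iter: "(f ^^ m) x \<in> \<Omega>" if "x \<in> \<Omega>" for m x using that f by (induction m) auto
  have per: "(f ^^ (n * m)) x = x" if "x \<in> \<Omega>" for m x
    using that id by (induction m) (auto simp: funpow_add n_def)
  have fmod: "(f ^^ (m mod n)) x = (f ^^ m) x" if x: "x \<in> \<Omega>" for m x
  proof -
    have "(f ^^ m) x = (f ^^ (m mod n + n * (m div n))) x" by simp
    also have "\<dots> = (f ^^ (m mod n)) x" unfolding funpow_add o_def per[OF x] ..
    finally show ?thesis by simp
  qed
  have nm: "nat ((i + j) mod int n) = (nat i + nat j) mod n" if "i \<ge> 0" "j \<ge> 0" for i j
    using that by (simp add: nat_mod_distrib nat_add_distrib)
  obtain x where x: "x \<in> \<Omega>" "\<And>i. i \<in> carrier ?Z \<Longrightarrow> (f ^^ nat i) x = x"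
  proof (rule p_group_fixed_point[of ?Z p a \<Omega> "\<lambda>i x. (f ^^ nat i) x"])
    show "card (carrier ?Z) = p ^ a" unfolding n_def[symmetric] by (simp add: car)
    fix g h x assume "g \<in> carrier ?Z" "h \<in> carrier ?Z" "x \<in> \<Omega>"
    then show "(f ^^ nat (g \<otimes>\<^bsub>?Z\<^esub> h)) x = (f ^^ nat g) ((f ^^ nat h) x)"
      using nm[of g h] fmod by (simp add: car funpow_add)
  qed (use assms iter in auto)
  have "f x = x"
  proof (cases "n = 1")
    case True
    then show ?thesis using id[OF x(1)] by (simp add: n_def[symmetric])
  next
    case False
    then have "1 \<in> carrier ?Z" using n by (simp add: car)
    then show ?thesis using x(2)[of 1] by simp
  qed
  with x(1) show ?thesis by (rule that)
qed

section \<open>Degrees divisible by p\<close>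

context finite_group
begin

lemma Irr_cyclotomic_int:
  assumes "\<chi> \<in> Irr G" "g \<in> carrier G"
  shows "\<chi> g \<in> cyclotomic_int (Coset.order G)"
proof -
  obtain es where es: "\<And>e. e \<in> set es \<Longrightarrow> e ^ Coset.order G = 1"
    and tr: "\<And>k::nat. \<chi> (g [^] k) = (\<Sum>e\<leftarrow>es. e ^ k)"
    using Irr_power_trace[OF assms] by blast
  have "\<chi> g = sum_list es" using tr[of 1] assms(2) by simp
  moreover have "sum_list es \<in> cyclotomic_int (Coset.order G)" using es
    by (induction es) (simp_all add: cyclotomic_int_0 cyclotomic_int_add root_of_unity_cyclotomic_int[OF order_pos])
  ultimately show ?thesis by simp
qed

text \<open>The identity is the only fixed point of \<open>Q\<close> on \<open>M\<close>, so modulo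
  \<open>p\<close> the sum of \<open>\<chi>\<close> over \<open>M\<close> is
  \<open>\<chi>(1)\<close>.\<close>

lemma dvd_degree_of_no_fixed_points:
  assumes chi: "\<chi> \<in> Irr G" and d: "\<chi> \<one> = of_nat d"
    and M: "M \<lhd> G" and s0: "(\<Sum>m\<in>M. \<chi> m) = 0"
    and Q: "subgroup Q G" "card Q = p ^ a" and p: "Factorial_Ring.prime p"
    and fix1: "\<And>m. m \<in> M \<Longrightarrow> (\<And>u. u \<in> Q \<Longrightarrow> u \<otimes> m \<otimes> inv u = m) \<Longrightarrow> m = \<one>"
  shows "p dvd d"
proof -
  interpret M: Coset.normal M G by (rule M)
  interpret Q: Group.subgroup Q G by (rule Q)
  have Mc: "m \<in> carrier G" if "m \<in> M" for m using M.subset that by auto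
  have Qc: "m \<in> carrier G" if "m \<in> Q" for m using Q.subset that by auto
  have finM: "finite M" using M.subset fin finite_subset by blast
  have "\<exists>s\<in>cyclotomic_int (Coset.order G). (\<Sum>m\<in>M. \<chi> m) =
      (\<Sum>m\<in>{m\<in>M. \<forall>u\<in>carrier (G\<lparr>carrier := Q\<rparr>). u \<otimes> m \<otimes> inv u = m}. \<chi> m) + of_nat p * s"
  proof (rule p_group_action_sum[OF subgroup_imp_group[OF Q(1)] _ p finM, where act = "\<lambda>u m. u \<otimes> m \<otimes> inv u"])
    show "card (carrier (G\<lparr>carrier := Q\<rparr>)) = p ^ a" using Q(2) by simp
    show "\<chi> m \<in> cyclotomic_int (Coset.order G)" if "m \<in> M" for m
      using Irr_cyclotomic_int[OF chi] Mc that by simp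
    show "\<chi> (u \<otimes> m \<otimes> inv u) = \<chi> m" if "u \<in> carrier (G\<lparr>carrier := Q\<rparr>)" "m \<in> M" for u m
      using class_funD[OF Irr_class_fun[OF chi]] Qc Mc that by simp
    show "u \<otimes> m \<otimes> inv u \<in> M" if "u \<in> carrier (G\<lparr>carrier := Q\<rparr>)" "m \<in> M" for u m
      using M.inv_op_closed2 Qc that by simp
    show "\<one>\<^bsub>G\<lparr>carrier := Q\<rparr>\<^esub> \<otimes> m \<otimes> inv \<one>\<^bsub>G\<lparr>carrier := Q\<rparr>\<^esub> = m" if "m \<in> M" for m
      using Mc that by simp
    show "(u \<otimes>\<^bsub>G\<lparr>carrier := Q\<rparr>\<^esub> v) \<otimes> m \<otimes> inv (u \<otimes>\<^bsub>G\<lparr>carrier := Q\<rparr>\<^esub> v) = u \<otimes> (v \<otimes> m \<otimes> inv v) \<otimes> inv u"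
      if "u \<in> carrier (G\<lparr>carrier := Q\<rparr>)" "v \<in> carrier (G\<lparr>carrier := Q\<rparr>)" "m \<in> M" for u v m
      using Mc Qc that by (simp add: inv_mult_group m_assoc)
  qed (auto intro: cyclotomic_int_0 cyclotomic_int_add)
  moreover have "{m\<in>M. \<forall>u\<in>carrier (G\<lparr>carrier := Q\<rparr>). u \<otimes> m \<otimes> inv u = m} = {\<one>}"
    using fix1 Qc by auto
  ultimately obtain s where s: "s \<in> cyclotomic_int (Coset.order G)" "0 = of_nat d + of_nat p * s"
    using s0 d by auto
  have "of_nat d = of_nat p * (- s)" using s(2) by (simp add: eq_neg_iff_add_eq_0)
  from dvd_of_cyclotomic_int[OF order_pos cyclotomic_int_uminus[OF s(1)] this] show ?thesis
    using p prime_gt_0_nat by blast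
qed

text \<open>Let \<open>A\<close> act on the cosets of \<open>B\<close> by right multiplication; a
  fixed coset \<open>B g\<close> gives the conclusion.\<close>

lemma p_subgroup_conjugate_into:
  assumes A: "subgroup A G" "card A = p ^ a" and p: "Factorial_Ring.prime p"
    and B: "subgroup B G" and idx: "\<not> p dvd card (rcosets B)"
  obtains g where "g \<in> carrier G" "\<And>u. u \<in> A \<Longrightarrow> g \<otimes> u \<otimes> inv g \<in> B"
proof -
  interpret A: Group.subgroup A G by (rule A)
  interpret B: Group.subgroup B G by (rule B)
  have Ac: "u \<in> carrier G" if "u \<in> A" for u using A.subset that by auto
  have finR: "finite (rcosets B)" unfolding RCOSETS_def using fin by simp
  obtain C where C: "C \<in> rcosets B" and fx: "\<And>u. u \<in> carrier (G\<lparr>carrier := A\<rparr>) \<Longrightarrow> C #> inv u = C"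
  proof (rule p_group_fixed_point[OF subgroup_imp_group[OF A(1)] _ p finR, where act = "\<lambda>u C. C #> inv u"])
    show "card (carrier (G\<lparr>carrier := A\<rparr>)) = p ^ a" using A(2) by simp
    show "C #> inv u \<in> rcosets B" if "u \<in> carrier (G\<lparr>carrier := A\<rparr>)" "C \<in> rcosets B" for u C
    proof -
      obtain g where "g \<in> carrier G" "C = B #> g" using \<open>C \<in> rcosets B\<close> by (auto simp: RCOSETS_def)
      then show ?thesis using that Ac B.subset coset_mult_assoc[of B g "inv u"] by (auto simp: RCOSETS_def)
    qed
    show "C #> inv \<one>\<^bsub>G\<lparr>carrier := A\<rparr>\<^esub> = C" if "C \<in> rcosets B" for C
      using that B.subset by (auto simp: RCOSETS_def coset_mult_assoc)
    show "C #> inv (u \<otimes>\<^bsub>G\<lparr>carrier := A\<rparr>\<^esub> v) = C #> inv v #> inv u"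
      if "u \<in> carrier (G\<lparr>carrier := A\<rparr>)" "v \<in> carrier (G\<lparr>carrier := A\<rparr>)" "C \<in> rcosets B" for u v C
    proof -
      have "C \<subseteq> carrier G" using that(3) B.subset r_coset_subset_G by (auto simp: RCOSETS_def)
      then show ?thesis using that Ac by (simp add: inv_mult_group coset_mult_assoc)
    qed
  qed (use idx in auto)
  obtain g where g: "g \<in> carrier G" "C = B #> g" using C by (auto simp: RCOSETS_def)
  have "g \<otimes> u \<otimes> inv g \<in> B" if u: "u \<in> A" for u
  proof -
    have uc: "u \<in> carrier G" using Ac u by simp
    have "C #> inv (inv u) = C" using fx[of "inv u"] u by simp
    then have eq: "B #> (g \<otimes> u) = B #> g" using g uc B.subset by (simp add: coset_mult_assoc)
    have "g \<otimes> u \<in> B #> (g \<otimes> u)" using rcos_self[OF m_closed[OF g(1) uc] B] .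
    then obtain b where b: "b \<in> B" "g \<otimes> u = b \<otimes> g" unfolding eq by (auto simp: r_coset_def)
    have "g \<otimes> u \<otimes> inv g = b" unfolding b(2) using b(1) g B.subset by (auto simp: m_assoc)
    then show ?thesis using b(1) by simp
  qed
  with g(1) show ?thesis by (rule that)
qed

end

context Group.group
begin

lemma conj_pow:
  assumes "u \<in> carrier G" "x \<in> carrier G"
  shows "(u \<otimes> x \<otimes> inv u) [^] (n::nat) = u \<otimes> x [^] n \<otimes> inv u"
proof (induction n)
  case 0
  then show ?case using assms by simp
next
  case (Suc n)
  have "inv u \<otimes> (u \<otimes> y) = y" if "y \<in> carrier G" for y using assms that by (simp flip: m_assoc)
  then show ?case using assms Suc by (simp add: m_assoc)
qed

lemma pow_mod_order:
  assumes x: "x \<in> carrier G" and xn: "x [^] (n::nat) = \<one>" and eq: "[a = b] (mod n)"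
  shows "x [^] a = x [^] b"
proof -
  have red: "x [^] c = x [^] (c mod n)" for c
  proof -
    have "x [^] c = x [^] (n * (c div n) + c mod n)" by simp
    also have "\<dots> = x [^] (n * (c div n)) \<otimes> x [^] (c mod n)" using x by (simp add: nat_pow_mult)
    also have "x [^] (n * (c div n)) = \<one>" using x xn by (simp flip: nat_pow_pow)
    finally show ?thesis using x by simp
  qed
  show ?thesis using red[of a] red[of b] eq by (simp add: cong_def)
qed

lemma conj_power_iterate:
  assumes "v \<in> carrier G" "g \<in> carrier G" "v \<otimes> g \<otimes> inv v = g [^] (k::nat)"
  shows "v [^] (i::nat) \<otimes> g \<otimes> inv (v [^] i) = g [^] (k ^ i)"
proof (induction i)
  case 0
  then show ?case using assms by simp
next
  case (Suc i)
  have "v [^] Suc i \<otimes> g \<otimes> inv (v [^] Suc i) = v [^] i \<otimes> (v \<otimes> g \<otimes> inv v) \<otimes> inv (v [^] i)"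
    using assms(1,2) by (simp add: inv_mult_group m_assoc)
  also have "\<dots> = (v [^] i \<otimes> g \<otimes> inv (v [^] i)) [^] k"
    unfolding assms(3) using assms by (intro conj_pow[symmetric]) auto
  also have "\<dots> = g [^] (k ^ Suc i)"
    unfolding Suc using assms by (simp add: nat_pow_pow mult.commute)
  finally show ?case .
qed

end

lemma cong_pow_prime_power:
  assumes "[k ^ p = 1] (mod (n::nat))" "b > 0"
  shows "[k ^ (p ^ b) = 1] (mod n)"
proof -
  obtain c where c: "b = Suc c" using assms(2) by (cases b) auto
  have "[(k ^ p) ^ (p ^ c) = 1 ^ (p ^ c)] (mod n)" by (rule cong_pow[OF assms(1)])
  then show ?thesis unfolding c by (simp add: power_mult)
qed

section \<open>Counting pairs that realise a power map\<close>

context finite_group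
begin

text \<open>A coset \<open>g M\<close> that is conjugate to its \<open>k\<close>-th power contains
  an element conjugate to its \<open>k\<close>-th power. Replace the conjugating element
  \<open>v\<close> by a power \<open>u\<close> that is a \<open>p\<close>-element and still induces
  the \<open>k\<close>-th power on the coset, which is possible as \<open>k\<close> has order
  dividing \<open>p\<close>. With \<open>k'\<close> inverse to \<open>k\<close>, the map \<open>y
  \<mapsto> u y\<^bsup>k'\<^esup> u\<^sup>-\<^sup>1\<close> permutes the coset with order a power of
  \<open>p\<close>, and the size of the coset is prime to \<open>p\<close>; the element sought is a
  fixed point.\<close>

lemma lift_power_conjugate:
  assumes M: "M \<lhd> G" and p: "Factorial_Ring.prime p" and pM: "\<not> p dvd card M"
    and k: "[k ^ p = 1] (mod Coset.order G)"
    and g: "g \<in> carrier G" and v: "v \<in> carrier G" and m: "m \<in> M" and eq: "v \<otimes> g \<otimes> inv v = g [^] (k::nat) \<otimes> m"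
  obtains m0 u where "m0 \<in> M" "u \<in> carrier G" "u \<otimes> (g \<otimes> m0) \<otimes> inv u = (g \<otimes> m0) [^] k"
proof -
  interpret M: Coset.normal M G by (rule M)
  interpret Q: Group.group "G Mod M" by (rule M.factorgroup_is_group)
  interpret pi: group_hom G "G Mod M" "\<lambda>x. M #> x"
    by (unfold_locales) (rule M.r_coset_hom_Mod)
  have p1: "p > 1" using p prime_gt_1_nat by simp
  have Mc: "x \<in> carrier G" if "x \<in> M" for x using M.subset that by auto
  have same: "M #> y = M #> x \<longleftrightarrow> y \<in> M #> x" if "x \<in> carrier G" "y \<in> carrier G" for x y
    using repr_independence[OF _ that(1) M.subgroup_axioms, of y] rcos_self[OF that(2) M.subgroup_axioms] by auto
  let ?t = "Coset.order G"
  define c where "c = multiplicity p ?t"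
  obtain r where r: "?t = p ^ c * r" "\<not> p dvd r"
    using multiplicity_decompose'[of ?t p] order_pos p1 unfolding c_def by (metis less_irrefl nat_dvd_1_iff_1)
  have "coprime r p" using r(2) p by (metis coprime_commute prime_imp_coprime)
  then obtain x where x: "[r * x = 1] (mod p)" using cong_solve_coprime_nat[of r p] by auto
  (* j is 1 modulo p and divisible by the p'-part of the group order. *)
  define j where "j = r * x"
  have j1: "j mod p = 1" using x p1 by (simp add: cong_def j_def)
  then obtain s where s: "j = 1 + p * s" using mod_mult_div_eq[of j p] by (intro that[of "j div p"]) simp
  define u where "u = v [^] j"
  have u: "u \<in> carrier G" using v by (simp add: u_def)
  have vt: "v [^] ?t = \<one>" by (rule pow_order_one[OF v])
  have upc: "u [^] (p ^ Suc c) = \<one>"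
  proof -
    have "u [^] (p ^ Suc c) = v [^] (?t * (x * p))" using v by (simp add: u_def nat_pow_pow j_def r(1) mult_ac)
    also have "\<dots> = \<one>" using v vt by (simp flip: nat_pow_pow)
    finally show ?thesis .
  qed
  have kj: "[k ^ j = k] (mod ?t)"
  proof -
    have "[k * (k ^ p) ^ s = k * 1 ^ s] (mod ?t)" by (intro cong_mult cong_pow k) simp
    then show ?thesis by (simp add: s power_add power_mult)
  qed
  have "(M #> v) \<otimes>\<^bsub>G Mod M\<^esub> (M #> g) \<otimes>\<^bsub>G Mod M\<^esub> inv\<^bsub>G Mod M\<^esub> (M #> v) = M #> (v \<otimes> g \<otimes> inv v)"
    using v g by (simp only: pi.hom_mult pi.hom_inv m_closed inv_closed)
  also have "\<dots> = (M #> g [^] k) \<otimes>\<^bsub>G Mod M\<^esub> (M #> m)"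
    unfolding eq using g Mc[OF m] by (simp only: pi.hom_mult nat_pow_closed)
  also have "M #> m = \<one>\<^bsub>G Mod M\<^esub>" using m by (simp add: FactGroup_def M.rcos_const[OF is_group])
  also have "(M #> g [^] k) \<otimes>\<^bsub>G Mod M\<^esub> \<one>\<^bsub>G Mod M\<^esub> = M #> g [^] k"
    using g by (simp only: Q.r_one pi.hom_closed nat_pow_closed)
  also have "\<dots> = (M #> g) [^]\<^bsub>G Mod M\<^esub> k" by (rule pi.hom_nat_pow[OF g])
  finally have piv: "(M #> v) \<otimes>\<^bsub>G Mod M\<^esub> (M #> g) \<otimes>\<^bsub>G Mod M\<^esub> inv\<^bsub>G Mod M\<^esub> (M #> v) = (M #> g) [^]\<^bsub>G Mod M\<^esub> k" .
  have piu: "(M #> u) \<otimes>\<^bsub>G Mod M\<^esub> (M #> g) \<otimes>\<^bsub>G Mod M\<^esub> inv\<^bsub>G Mod M\<^esub> (M #> u) = M #> g [^] k"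
  proof -
    have "(M #> u) \<otimes>\<^bsub>G Mod M\<^esub> (M #> g) \<otimes>\<^bsub>G Mod M\<^esub> inv\<^bsub>G Mod M\<^esub> (M #> u) = (M #> g) [^]\<^bsub>G Mod M\<^esub> (k ^ j)"
      unfolding u_def pi.hom_nat_pow[OF v]
      by (rule Q.conj_power_iterate[OF pi.hom_closed[OF v] pi.hom_closed[OF g] piv])
    also have "\<dots> = M #> g [^] (k ^ j)" by (rule pi.hom_nat_pow[OF g, symmetric])
    also have "g [^] (k ^ j) = g [^] k" by (rule pow_mod_order[OF g pow_order_one[OF g] kj])
    finally show ?thesis .
  qed
  define k' where "k' = k ^ (p - 1)"
  have kk': "k * k' = k ^ p" unfolding k'_def using p1 by (simp flip: power_Suc)
  define f where "f y = u \<otimes> y [^] k' \<otimes> inv u" for y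
  have iter: "(f ^^ i) y = u [^] i \<otimes> y [^] (k' ^ i) \<otimes> inv (u [^] i)" if y: "y \<in> carrier G" for i y
  proof (induction i)
    case 0
    then show ?case using y by simp
  next
    case (Suc i)
    have "(f ^^ Suc i) y = u \<otimes> (u [^] i \<otimes> y [^] (k' ^ i) \<otimes> inv (u [^] i)) [^] k' \<otimes> inv u"
      by (simp add: Suc f_def)
    also have "\<dots> = u \<otimes> (u [^] i \<otimes> (y [^] (k' ^ i)) [^] k' \<otimes> inv (u [^] i)) \<otimes> inv u"
      using u y by (subst conj_pow) auto
    also have "\<dots> = (u \<otimes> u [^] i) \<otimes> y [^] (k' ^ Suc i) \<otimes> inv (u \<otimes> u [^] i)"
      using u y by (simp add: nat_pow_pow m_assoc inv_mult_group mult.commute)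
    finally show ?case using u by (simp flip: nat_pow_Suc2)
  qed
  define \<Omega> where "\<Omega> = M #> g"
  have Oc: "y \<in> carrier G" if "y \<in> \<Omega>" for y using that g M.subset r_coset_subset_G unfolding \<Omega>_def by blast
  have finM: "finite M" using M.subset fin finite_subset by blast
  have finO: "finite \<Omega>" by (rule finite_subset[OF _ fin]) (use Oc in auto)
  have cardO: "card \<Omega> = card M"
  proof -
    have "\<Omega> = (\<lambda>x. x \<otimes> g) ` M" by (auto simp: \<Omega>_def r_coset_def)
    then show ?thesis using g Mc by (simp add: card_image inj_on_def)
  qed
  have fO: "f y \<in> \<Omega>" if y: "y \<in> \<Omega>" for y
  proof -
    have yc: "y \<in> carrier G" by (rule Oc[OF y])
    have yg: "M #> y = M #> g" using same[OF g yc] y by (simp add: \<Omega>_def)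
    have "M #> f y = (M #> u) \<otimes>\<^bsub>G Mod M\<^esub> (M #> g) [^]\<^bsub>G Mod M\<^esub> k' \<otimes>\<^bsub>G Mod M\<^esub> inv\<^bsub>G Mod M\<^esub> (M #> u)"
      unfolding f_def yg[symmetric] using u yc
      by (simp only: pi.hom_mult pi.hom_inv pi.hom_nat_pow m_closed inv_closed nat_pow_closed)
    also have "\<dots> = ((M #> u) \<otimes>\<^bsub>G Mod M\<^esub> (M #> g) \<otimes>\<^bsub>G Mod M\<^esub> inv\<^bsub>G Mod M\<^esub> (M #> u)) [^]\<^bsub>G Mod M\<^esub> k'"
      by (rule Q.conj_pow[symmetric]) (use u g in auto)
    also have "\<dots> = M #> (g [^] k) [^] k'"
      unfolding piu using g by (intro pi.hom_nat_pow[symmetric]) auto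
    also have "(g [^] k) [^] k' = g"
      using pow_mod_order[OF g pow_order_one[OF g] k] g by (simp add: nat_pow_pow kk')
    finally have "M #> f y = M #> g" .
    moreover have "f y \<in> carrier G" using u yc by (simp add: f_def)
    ultimately show ?thesis using same[OF g] by (simp add: \<Omega>_def)
  qed
  have fid: "(f ^^ (p ^ Suc c)) y = y" if y: "y \<in> \<Omega>" for y
  proof -
    have yc: "y \<in> carrier G" by (rule Oc[OF y])
    have "[(k ^ p) ^ (p - 1) = 1 ^ (p - 1)] (mod ?t)" by (rule cong_pow[OF k])
    then have "[k' ^ p = 1] (mod ?t)" by (simp add: k'_def mult.commute flip: power_mult)
    then have "[k' ^ (p ^ Suc c) = 1] (mod ?t)" by (rule cong_pow_prime_power) simp
    from pow_mod_order[OF yc pow_order_one[OF yc] this]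
    show ?thesis unfolding iter[OF yc] upc using yc by simp
  qed
  obtain y where y: "y \<in> \<Omega>" "f y = y"
    by (rule permutation_fixed_point[OF p finO _ fO fid]; (simp add: cardO pM)?; rule that)
  have yc: "y \<in> carrier G" by (rule Oc[OF y(1)])
  obtain m' where m': "m' \<in> M" "y = m' \<otimes> g" using y(1) by (auto simp: \<Omega>_def r_coset_def)
  define m0 where "m0 = inv g \<otimes> m' \<otimes> g"
  have m0: "m0 \<in> M" unfolding m0_def by (rule M.inv_op_closed1[OF g m'(1)])
  have "g \<otimes> m0 = y" using g Mc[OF m'(1)] by (simp add: m0_def m'(2) m_assoc[symmetric])
  moreover have "u \<otimes> y \<otimes> inv u = y [^] k"
  proof -
    have "y [^] k = (u \<otimes> y [^] k' \<otimes> inv u) [^] k" using y(2) by (simp add: f_def)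
    also have "\<dots> = u \<otimes> (y [^] k') [^] k \<otimes> inv u" using u yc by (intro conj_pow) auto
    also have "(y [^] k') [^] k = y"
      using pow_mod_order[OF yc pow_order_one[OF yc] k] yc by (simp add: nat_pow_pow mult.commute[of k'] kk')
    finally show ?thesis by simp
  qed
  ultimately show ?thesis using m0 u that by blast
qed

text \<open>The inequality holds coset by coset: for fixed \<open>g\<close> the pairs \<open>(m,
  h)\<close> counted on the left are mapped injectively to the pairs \<open>(m, h)\<close> such that
  \<open>h\<close> conjugates \<open>(g m)\<^sup>k\<close> to \<open>g m\<close>. The injection is
  built from an element \<open>y0\<close> of \<open>g M\<close> that is conjugate to its
  \<open>k\<close>-th power. For \<open>g = 1\<close> the element \<open>x\<close> makes the
  inequality strict.\<close>

lemma power_class_count_less: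
  assumes M: "M \<lhd> G" and p: "Factorial_Ring.prime p" and pM: "\<not> p dvd card M"
    and k: "[k ^ p = 1] (mod Coset.order G)"
    and x: "x \<in> M" "x \<noteq> \<one>" "w \<in> carrier G" "w \<otimes> x \<otimes> inv w = x [^] (k::nat)"
  shows "(\<Sum>g\<in>carrier G. \<Sum>m\<in>M. card {h \<in> carrier G. h \<otimes> (g [^] k \<otimes> m) \<otimes> inv h = g}) <
    card M * (\<Sum>g\<in>carrier G. card {h \<in> carrier G. h \<otimes> g [^] k \<otimes> inv h = g})"
proof -
  interpret M: Coset.normal M G by (rule M)
  have Mc: "m \<in> carrier G" if "m \<in> M" for m using M.subset that by auto
  have finM: "finite M" using M.subset fin finite_subset by blast
  define C where "C g = {h \<in> carrier G. h \<otimes> g [^] k \<otimes> inv h = g}" for g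
  define B where "B g m = {h \<in> carrier G. h \<otimes> (g [^] k \<otimes> m) \<otimes> inv h = g}" for g m
  have finC: "finite (C g)" and finB: "finite (B g m)" for g m by (auto simp: C_def B_def)
  have le: "(\<Sum>m\<in>M. card (B g m)) \<le> (\<Sum>m\<in>M. card (C (g \<otimes> m)))" if g: "g \<in> carrier G" for g
  proof (cases "\<exists>m\<in>M. B g m \<noteq> {}")
    case False
    then show ?thesis by simp
  next
    case True
    then obtain m v where m: "m \<in> M" and v: "v \<in> carrier G" "v \<otimes> (g [^] k \<otimes> m) \<otimes> inv v = g"
      by (auto simp: B_def)
    have flip: "inv a \<otimes> b \<otimes> a = c" if "a \<in> carrier G" "c \<in> carrier G" "a \<otimes> c \<otimes> inv a = b" for a b c
    proof -
      have "inv a \<otimes> (a \<otimes> d) = d" if "d \<in> carrier G" for d using that \<open>a \<in> carrier G\<close> by (simp flip: m_assoc)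
      then show ?thesis using that(1,2) by (simp add: that(3)[symmetric] m_assoc)
    qed
    have "inv v \<otimes> g \<otimes> inv (inv v) = g [^] k \<otimes> m" using flip[OF v(1) _ v(2)] v g Mc[OF m] by simp
    from lift_power_conjugate[OF M p pM k g inv_closed[OF v(1)] m this]
    obtain m0 u where m0: "m0 \<in> M" and u: "u \<in> carrier G"
      and eq: "u \<otimes> (g \<otimes> m0) \<otimes> inv u = (g \<otimes> m0) [^] k" by blast
    define y0 where "y0 = g \<otimes> m0"
    have y0: "y0 \<in> carrier G" using g Mc[OF m0] by (simp add: y0_def)
    have equ: "u \<otimes> y0 \<otimes> inv u = y0 [^] k" using eq by (simp add: y0_def)
    (* A conjugating element chosen for each conjugate y of y0, so that h can be recovered from
    its image. *)
    define e where "e y = (SOME d. d \<in> carrier G \<and> d \<otimes> y0 \<otimes> inv d = y)" for y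
    define Y where "Y h = h \<otimes> y0 [^] k \<otimes> inv h" for h
    have Yc: "Y h \<in> carrier G" if "h \<in> carrier G" for h using that y0 by (simp add: Y_def)
    have e: "e (Y h) \<in> carrier G \<and> e (Y h) \<otimes> y0 \<otimes> inv (e (Y h)) = Y h" if h: "h \<in> carrier G" for h
      unfolding e_def
    proof (rule someI[of _ "h \<otimes> u"])
      show "h \<otimes> u \<in> carrier G \<and> h \<otimes> u \<otimes> y0 \<otimes> inv (h \<otimes> u) = Y h"
        using h u y0 by (simp add: Y_def equ[symmetric] inv_mult_group m_assoc)
    qed
    define \<Phi> where "\<Phi> = (\<lambda>(m :: 'a, h). (inv g \<otimes> Y h, h \<otimes> inv (e (Y h))))"
    have cancel: "inv g \<otimes> (g \<otimes> a) = a" "g \<otimes> (inv g \<otimes> a) = a" if "a \<in> carrier G" for a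
      using g that by (simp_all flip: m_assoc)
    have "inj_on \<Phi> (SIGMA m:M. B g m)"
    proof (rule inj_onI)
      fix a b assume a: "a \<in> (SIGMA m:M. B g m)" and b: "b \<in> (SIGMA m:M. B g m)" and ab: "\<Phi> a = \<Phi> b"
      obtain m1 h1 where a': "a = (m1, h1)" "m1 \<in> M" "h1 \<in> B g m1" using a by auto
      obtain m2 h2 where b': "b = (m2, h2)" "m2 \<in> M" "h2 \<in> B g m2" using b by auto
      have h: "h1 \<in> carrier G" "h2 \<in> carrier G" using a' b' by (auto simp: B_def)
      have ab': "inv g \<otimes> Y h1 = inv g \<otimes> Y h2 \<and> h1 \<otimes> inv (e (Y h1)) = h2 \<otimes> inv (e (Y h2))"
        using ab unfolding a'(1) b'(1) \<Phi>_def prod.case prod.inject .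
      have YY: "Y h1 = Y h2"
        using arg_cong[OF conjunct1[OF ab'], of "\<lambda>z. g \<otimes> z"]
        unfolding cancel(2)[OF Yc[OF h(1)]] cancel(2)[OF Yc[OF h(2)]] .
      have "h1 \<otimes> inv (e (Y h2)) = h2 \<otimes> inv (e (Y h2))" using conjunct2[OF ab'] unfolding YY .
      then have hh: "h1 = h2" using h conjunct1[OF e[OF h(2)]] by simp
      have "g [^] k \<otimes> m1 = inv h1 \<otimes> g \<otimes> h1"
        using flip[of h1 "g [^] k \<otimes> m1" g] a' g Mc h by (simp add: B_def)
      also have "\<dots> = g [^] k \<otimes> m2"
        using flip[of h2 "g [^] k \<otimes> m2" g] b' g Mc h hh by (simp add: B_def)
      finally have "m1 = m2" using g Mc a' b' by simp
      then show "a = b" using a' b' hh by simp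
    qed
    moreover have "\<Phi> ` (SIGMA m:M. B g m) \<subseteq> (SIGMA m:M. C (g \<otimes> m))"
    proof
      fix z assume "z \<in> \<Phi> ` (SIGMA m:M. B g m)"
      then obtain m1 h where m1: "m1 \<in> M" and hB: "h \<in> B g m1" and z: "z = (inv g \<otimes> Y h, h \<otimes> inv (e (Y h)))"
        by (auto simp: \<Phi>_def)
      have h: "h \<in> carrier G" and hg: "h \<otimes> (g [^] k \<otimes> m1) \<otimes> inv h = g" using hB by (auto simp: B_def)
      note eh = conjunct1[OF e[OF h]] and eY = conjunct2[OF e[OF h]]
      have "inv g \<otimes> Y h \<in> M"
      proof -
        have "M #> y0 [^] k = M #> g [^] k"
        proof -
          interpret pi: group_hom G "G Mod M" "\<lambda>x. M #> x"
            by (intro group_hom.intro group_hom_axioms.intro is_group M.factorgroup_is_group M.r_coset_hom_Mod)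
          have "y0 = g \<otimes> m0 \<otimes> inv g \<otimes> g" using g Mc[OF m0] by (simp add: y0_def m_assoc)
          then have "y0 \<in> M #> g" using M.inv_op_closed2[OF g m0] by (auto simp: r_coset_def)
          then have "M #> g = M #> y0" by (rule repr_independence[OF _ g M.subgroup_axioms])
          then show ?thesis by (simp only: pi.hom_nat_pow[OF g] pi.hom_nat_pow[OF y0])
        qed
        moreover have "y0 [^] k \<in> M #> y0 [^] k" using y0 by (intro rcos_self M.subgroup_axioms) auto
        ultimately obtain m2 where m2: "m2 \<in> M" "y0 [^] k = m2 \<otimes> g [^] k" by (auto simp: r_coset_def)
        have gk: "g [^] k = inv h \<otimes> g \<otimes> h \<otimes> inv m1"
          using flip[OF h _ hg] g Mc[OF m1] h by (simp add: m_assoc)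
        have "inv g \<otimes> Y h = (inv g \<otimes> (h \<otimes> m2 \<otimes> inv h) \<otimes> g) \<otimes> (h \<otimes> inv m1 \<otimes> inv h)"
          unfolding Y_def m2(2) gk using h g Mc[OF m1] Mc[OF m2(1)] by (simp add: m_assoc)
        also have "\<dots> \<in> M"
          by (rule M.m_closed[OF M.inv_op_closed1[OF g M.inv_op_closed2[OF h m2(1)]]
                M.inv_op_closed2[OF h M.m_inv_closed[OF m1]]])
        finally show ?thesis .
      qed
      moreover have "h \<otimes> inv (e (Y h)) \<in> C (Y h)"
      proof -
        have "Y h [^] k = e (Y h) \<otimes> y0 [^] k \<otimes> inv (e (Y h))"
          by (subst eY[symmetric]) (rule conj_pow[OF eh y0])
        then have "h \<otimes> inv (e (Y h)) \<otimes> Y h [^] k \<otimes> inv (h \<otimes> inv (e (Y h))) = h \<otimes> y0 [^] k \<otimes> inv h"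
          using h eh y0 inv_solve_left by (simp add: inv_mult_group m_assoc) (simp flip: m_assoc)
        then show ?thesis using h eh by (simp add: C_def Y_def[of h])
      qed
      ultimately show "z \<in> (SIGMA m:M. C (g \<otimes> m))" unfolding z using cancel(2)[OF Yc[OF h]] by simp
    qed
    ultimately have "card (SIGMA m:M. B g m) \<le> card (SIGMA m:M. C (g \<otimes> m))"
      using finM finC by (intro card_inj_on_le) auto
    then show ?thesis using finM finB finC by (simp add: card_SigmaI)
  qed
  have lt: "(\<Sum>m\<in>M. card (B \<one> m)) < (\<Sum>m\<in>M. card (C (\<one> \<otimes> m)))"
  proof -
    have "B \<one> m = (if m = \<one> then carrier G else {})" if m: "m \<in> M" for m
    proof -
      have "m = \<one>" if "h \<in> carrier G" "h \<otimes> m \<otimes> inv h = \<one>" for h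
      proof -
        have "h \<otimes> m = h" using that Mc[OF m] by (metis inv_equality inv_inv inv_closed m_closed)
        then show ?thesis using that(1) Mc[OF m] by (simp add: l_cancel_one)
      qed
      then show ?thesis using Mc[OF m] by (auto simp: B_def)
    qed
    then have "(\<Sum>m\<in>M. card (B \<one> m)) = (\<Sum>m\<in>M. if m = \<one> then card (carrier G) else 0)"
      by (intro sum.cong) auto
    also have "\<dots> = card (carrier G)" using finM M.one_closed by simp
    also have "\<dots> = card (C \<one>)"
    proof -
      have "C \<one> = carrier G" by (auto simp: C_def)
      then show ?thesis by simp
    qed
    also have "\<dots> < card (C \<one>) + card (C x)"
    proof -
      have "inv w \<otimes> x [^] k \<otimes> inv (inv w) = x"
        using x(3) Mc[OF x(1)] by (simp add: x(4)[symmetric] m_assoc) (simp flip: m_assoc)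
      then have "inv w \<in> C x" using x(3) by (simp add: C_def)
      then show ?thesis using finC[of x] by (auto simp: card_gt_0_iff)
    qed
    also have "\<dots> = (\<Sum>m\<in>{\<one>, x}. card (C m))" using x(2) by simp
    also have "\<dots> \<le> (\<Sum>m\<in>M. card (C m))" using finM x(1) by (intro sum_mono2) auto
    also have "\<dots> = (\<Sum>m\<in>M. card (C (\<one> \<otimes> m)))" using Mc by (intro sum.cong) auto
    finally show ?thesis .
  qed
  have "(\<Sum>g\<in>carrier G. \<Sum>m\<in>M. card (B g m)) < (\<Sum>g\<in>carrier G. \<Sum>m\<in>M. card (C (g \<otimes> m)))"
  proof (rule sum_strict_mono_ex1)
    show "\<exists>g\<in>carrier G. (\<Sum>m\<in>M. card (B g m)) < (\<Sum>m\<in>M. card (C (g \<otimes> m)))"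
      using lt by (rule bexI) simp
  qed (use le in auto)
  also have "\<dots> = (\<Sum>m\<in>M. \<Sum>g\<in>carrier G. card (C (g \<otimes> m)))" by (rule sum.swap)
  also have "\<dots> = (\<Sum>m\<in>M. \<Sum>g\<in>carrier G. card (C g))"
  proof (rule sum.cong[OF refl])
    fix m assume "m \<in> M"
    show "(\<Sum>g\<in>carrier G. card (C (g \<otimes> m))) = (\<Sum>g\<in>carrier G. card (C g))"
      by (rule sum_right_mult[OF Mc[OF \<open>m \<in> M\<close>], of "\<lambda>g. card (C g)"])
  qed
  also have "\<dots> = card M * (\<Sum>g\<in>carrier G. card (C g))" by simp
  finally show ?thesis unfolding B_def C_def .
qed

end

section \<open>Eigenvectors of an automorphism of prime order\<close>

context comm_monoid
begin

lemma finprod_lessThan_Suc: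
  assumes "f \<in> {..<Suc n} \<rightarrow> carrier G"
  shows "finprod G f {..<Suc n} = finprod G f {..<n} \<otimes> f n"
proof -
  have 1: "f \<in> {..<n} \<rightarrow> carrier G" and 2: "f n \<in> carrier G" using assms by (auto simp: Pi_def)
  show ?thesis
    unfolding lessThan_Suc using finprod_insert[of "{..<n}" n f] 1 2 by (simp add: m_comm)
qed

lemma finprod_lessThan_shift:
  assumes "f \<in> UNIV \<rightarrow> carrier G"
  shows "finprod G f {..<Suc n} = f 0 \<otimes> finprod G (\<lambda>i. f (Suc i)) {..<n}"
proof (induction n)
  case 0
  have "f 0 \<in> carrier G" using assms by auto
  then show ?case using assms by (subst finprod_lessThan_Suc) auto
next
  case (Suc n)
  have c: "f i \<in> carrier G" for i using assms by auto
  have "finprod G f {..<Suc (Suc n)} = f 0 \<otimes> finprod G (\<lambda>i. f (Suc i)) {..<n} \<otimes> f (Suc n)"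
    using c by (subst finprod_lessThan_Suc) (auto simp: Suc)
  also have "\<dots> = f 0 \<otimes> finprod G (\<lambda>i. f (Suc i)) {..<Suc n}"
    using c by (subst finprod_lessThan_Suc) (auto simp: m_assoc)
  finally show ?case .
qed

lemma finprod_nat_pow:
  assumes "f \<in> UNIV \<rightarrow> carrier G"
  shows "finprod G f {..<(n::nat)} [^] (k::nat) = finprod G (\<lambda>i. f i [^] k) {..<n}"
proof (induction n)
  case 0
  then show ?case by simp
next
  case (Suc n)
  have c: "f i \<in> carrier G" for i using assms by auto
  then show ?case using Suc by (simp add: finprod_lessThan_Suc nat_pow_distrib)
qed

lemma nat_pow_finprod_sum:
  assumes "x \<in> carrier G"
  shows "finprod G (\<lambda>i. x [^] (e i :: nat)) {..<(n::nat)} = x [^] (\<Sum>i<n. e i)"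
  by (induction n) (simp_all add: finprod_lessThan_Suc assms nat_pow_mult)

lemma finprod_lessThan_swap:
  assumes "\<And>i j. f i j \<in> carrier G"
  shows "finprod G (\<lambda>i. finprod G (f i) {..<(m::nat)}) {..<(n::nat)} = finprod G (\<lambda>j. finprod G (\<lambda>i. f i j) {..<n}) {..<m}"
proof (induction n)
  case 0
  then show ?case by simp
next
  case (Suc n)
  have "finprod G (\<lambda>i. finprod G (f i) {..<m}) {..<Suc n} =
      finprod G (\<lambda>j. finprod G (\<lambda>i. f i j) {..<n}) {..<m} \<otimes> finprod G (f n) {..<m}"
    using assms by (simp add: finprod_lessThan_Suc Suc)
  also have "\<dots> = finprod G (\<lambda>j. finprod G (\<lambda>i. f i j) {..<n} \<otimes> f n j) {..<m}"
    using assms by (intro finprod_multf[symmetric]) auto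
  also have "\<dots> = finprod G (\<lambda>j. finprod G (\<lambda>i. f i j) {..<Suc n}) {..<m}"
    using assms by (simp add: finprod_lessThan_Suc)
  finally show ?case .
qed

end

text \<open>The sum is annihilated by \<open>y\<^sup>i - 1\<close>, which is prime to
  \<open>q\<close>: otherwise the order of \<open>y\<close> modulo \<open>q\<close> would divide
  both \<open>i\<close> and \<open>p\<close>.\<close>

lemma cong_geometric_sum_0:
  fixes q p b y :: nat
  assumes q: "Factorial_Ring.prime q" and p: "Factorial_Ring.prime p" and y: "[y ^ p = 1] (mod q ^ b)" and b: "b > 0"
    and ne: "\<not> [y = 1] (mod q)" and i: "0 < i" "i < p"
  shows "q ^ b dvd (\<Sum>j<p. y ^ (i * j))"
proof -
  have p1: "p > 1" using p prime_gt_1_nat by simp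
  have q1: "q > 1" using q prime_gt_1_nat by simp
  have yq: "[y ^ p = 1] (mod q)" by (rule cong_dvd_modulus_nat[OF y]) (use b in \<open>simp add: dvd_power\<close>)
  have nd: "\<not> [y ^ i = 1] (mod q)"
  proof
    assume a: "[y ^ i = 1] (mod q)"
    have "coprime i p" using i p by (metis coprime_commute prime_imp_coprime nat_dvd_not_less)
    then obtain x where x: "[i * x = 1] (mod p)" using cong_solve_coprime_nat[of i p] by auto
    then have "(i * x) mod p = 1" using p1 by (simp add: cong_def)
    then have s: "i * x = 1 + p * ((i * x) div p)" using mod_mult_div_eq[of "i * x" p] by simp
    have "[(y ^ i) ^ x = 1 ^ x] (mod q)" by (rule cong_pow[OF a])
    moreover have "[y * (y ^ p) ^ ((i * x) div p) = y * 1 ^ ((i * x) div p)] (mod q)"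
      by (intro cong_mult cong_pow yq) simp
    moreover have "(y ^ i) ^ x = y * (y ^ p) ^ ((i * x) div p)"
      by (subst power_mult[symmetric], subst s) (simp add: power_add power_mult)
    ultimately have "[y = 1] (mod q)" by (simp add: cong_def)
    then show False using ne by simp
  qed
  let ?S = "\<Sum>j<p. (int y ^ i) ^ j"
  have "[(y ^ p) ^ i = 1 ^ i] (mod q ^ b)" by (rule cong_pow[OF y])
  then have "[int ((y ^ p) ^ i) = int 1] (mod int (q ^ b))" by (simp only: cong_int_iff power_one)
  then have "int (q ^ b) dvd (int y ^ i) ^ p - 1"
    by (simp add: cong_iff_dvd_diff mult.commute flip: power_mult)
  also have "(int y ^ i) ^ p - 1 = (int y ^ i - 1) * ?S" by (rule power_diff_1_eq)
  finally have d: "int q ^ b dvd (int y ^ i - 1) * ?S" by simp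
  have "\<not> int q dvd int y ^ i - 1"
  proof
    assume "int q dvd int y ^ i - 1"
    then have "[int (y ^ i) = int 1] (mod int q)" by (simp add: cong_iff_dvd_diff)
    then show False using nd by (simp only: cong_int_iff)
  qed
  then have "coprime (int q) (int y ^ i - 1)" using q by (intro prime_imp_coprime) auto
  then have "coprime (int q ^ b) (int y ^ i - 1)" by simp
  then have "int q ^ b dvd ?S" using d by (simp add: coprime_dvd_mult_right_iff)
  moreover have "?S = int (\<Sum>j<p. y ^ (i * j))" by (simp add: power_mult)
  ultimately show ?thesis by (metis of_nat_dvd_iff of_nat_power)
qed

context finite_group
begin

text \<open>Conjugation by \<open>w\<close> is an automorphism \<open>\<theta>\<close> of
  \<open>A\<close> of order \<open>p\<close>, and the powers of \<open>k\<close> are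
  \<open>p\<close>-th roots of unity modulo the exponent \<open>q\<^sup>b\<close>. With
  \<open>y\<close> inverse to \<open>k\<close> and in additive notation, \<open>e j\<close> is the
  sum \<open>\<Sum>\<^sub>i y\<^bsup>ij\<^esup> \<theta>\<^sup>i(a)\<close>, an eigenvector for
  \<open>k\<^sup>j\<close> if it is not 0. These sums add up to \<open>p a\<close>, so if all of
  them with \<open>j \<noteq> 0\<close> vanished, \<open>p a\<close> and hence \<open>a\<close>
  would be fixed. A power of \<open>w\<close> turns the eigenvalue \<open>k\<^sup>j\<close> into
  \<open>k\<close>.\<close>

lemma power_eigenvector:
  assumes A: "subgroup A G" and comm: "\<And>x y. x \<in> A \<Longrightarrow> y \<in> A \<Longrightarrow> x \<otimes> y = y \<otimes> x"
    and w: "w \<in> carrier G" and wA: "\<And>x. x \<in> A \<Longrightarrow> w \<otimes> x \<otimes> inv w \<in> A"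
    and wp: "\<And>x. x \<in> A \<Longrightarrow> w [^] p \<otimes> x \<otimes> inv (w [^] p) = x"
    and a: "a \<in> A" "w \<otimes> a \<otimes> inv w \<noteq> a"
    and p: "Factorial_Ring.prime p" and q: "Factorial_Ring.prime q" "p \<noteq> q" "b > 0"
    and n: "\<And>x. x \<in> A \<Longrightarrow> x [^] (q ^ b) = \<one>"
    and k: "[k ^ p = 1] (mod q ^ b)" "\<not> [k = 1] (mod q)"
  obtains x i where "x \<in> A" "x \<noteq> \<one>" "w [^] (i::nat) \<otimes> x \<otimes> inv (w [^] i) = x [^] (k::nat)"
proof -
  interpret A: Group.subgroup A G by (rule A)
  let ?C = "G\<lparr>carrier := A\<rparr>"
  let ?n = "q ^ b"
  have p1: "p > 1" using p prime_gt_1_nat by simp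
  have Ac: "x \<in> carrier G" if "x \<in> A" for x using A.subset that by auto
  interpret C: comm_group ?C
    by (rule group.group_comm_groupI[OF subgroup_imp_group[OF A]]) (use comm in auto)
  have pow: "x [^]\<^bsub>?C\<^esub> m = x [^] m" for x and m :: nat by (rule nat_pow_consistent[symmetric])
  have powA: "x [^] m \<in> A" if "x \<in> A" for x and m :: nat using C.nat_pow_closed[of x m] that pow by simp
  define \<theta> where "\<theta> x = w \<otimes> x \<otimes> inv w" for x
  have tA: "\<theta> x \<in> A" if "x \<in> A" for x using wA that by (simp add: \<theta>_def)
  have iter: "(\<theta> ^^ i) x = w [^] i \<otimes> x \<otimes> inv (w [^] i)" if "x \<in> A" for i x
  proof (induction i)
    case 0
    then show ?case using Ac[OF that] by simp
  next
    case (Suc i)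
    have "(\<theta> ^^ Suc i) x = w \<otimes> (\<theta> ^^ i) x \<otimes> inv w" by (simp add: \<theta>_def)
    also have "\<dots> = (w \<otimes> w [^] i) \<otimes> x \<otimes> inv (w \<otimes> w [^] i)"
      unfolding Suc using Ac[OF that] w by (simp add: m_assoc inv_mult_group)
    finally have "(\<theta> ^^ Suc i) x = (w \<otimes> w [^] i) \<otimes> x \<otimes> inv (w \<otimes> w [^] i)" .
    then show ?case using w by (simp flip: nat_pow_Suc2)
  qed
  have itA: "(\<theta> ^^ i) x \<in> A" if "x \<in> A" for i x using that tA by (induction i) auto
  have tpow: "\<theta> (x [^] m) = \<theta> x [^] m" if "x \<in> A" for x and m :: nat
    unfolding \<theta>_def using conj_pow[OF w Ac[OF that]] by simp
  have tmult: "\<theta> (x \<otimes> y) = \<theta> x \<otimes> \<theta> y" if "x \<in> A" "y \<in> A" for x y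
  proof -
    have "inv w \<otimes> (w \<otimes> z) = z" if "z \<in> carrier G" for z using w that by (simp flip: m_assoc)
    then show ?thesis unfolding \<theta>_def using w Ac that by (simp add: m_assoc)
  qed
  have tone: "\<theta> \<one> = \<one>" using w by (simp add: \<theta>_def)
  have tprod: "\<theta> (finprod ?C f {..<m}) = finprod ?C (\<lambda>i. \<theta> (f i)) {..<m}" if f: "\<And>i. f i \<in> A" for f :: "nat \<Rightarrow> 'a" and m
  proof (induction m)
    case 0
    then show ?case by (simp add: tone)
  next
    case (Suc m)
    have "finprod ?C f {..<m} \<in> carrier ?C" using f by (intro C.finprod_closed) auto
    then show ?case using f tA Suc tmult by (simp add: C.finprod_lessThan_Suc Pi_def)
  qed
  have cong: "x [^] c = x [^] d" if "x \<in> A" "[c = d] (mod ?n)" for x c d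
    by (rule pow_mod_order[OF Ac[OF that(1)] n[OF that(1)] that(2)])
  define y where "y = k ^ (p - 1)"
  have yk: "[y * k = 1] (mod ?n)" using k(1) p1 by (simp add: y_def flip: power_Suc2)
  have yp: "[y ^ p = 1] (mod ?n)"
  proof -
    have "[(k ^ p) ^ (p - 1) = 1 ^ (p - 1)] (mod ?n)" by (rule cong_pow[OF k(1)])
    then show ?thesis by (simp add: y_def mult.commute flip: power_mult)
  qed
  have y1: "\<not> [y = 1] (mod q)"
  proof
    assume "[y = 1] (mod q)"
    then have "[y * k = 1 * k] (mod q)" by (intro cong_mult) auto
    moreover have "[y * k = 1] (mod q)" by (rule cong_dvd_modulus_nat[OF yk]) (use q(3) in \<open>simp add: dvd_power\<close>)
    ultimately have "[k = 1] (mod q)" by (simp add: cong_def)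
    then show False using k(2) by simp
  qed
  define t where "t j i = (\<theta> ^^ i) a [^] (y ^ (i * j))" for j i
  have tc: "t j i \<in> A" for j i unfolding t_def by (intro powA itA a)
  define e where "e j = finprod ?C (t j) {..<p}" for j
  have ec: "e j \<in> A" for j unfolding e_def using C.finprod_closed[of "t j" "{..<p}"] tc by auto
  have eig: "\<theta> (e j) = e j [^] (k ^ j)" for j
  proof -
    (* The factors of e j ^ (k ^ j). Applying \<theta> to the i-th factor of e j gives h (i + 1),
    and h p = h 0. *)
    define h where "h i = t j i [^] (k ^ j)" for i
    have hc: "h i \<in> A" for i unfolding h_def by (intro powA tc)
    have hS: "h (Suc i) = \<theta> (t j i)" for i
    proof -
      have "[y ^ (i * j) * (y * k) ^ j = y ^ (i * j) * 1 ^ j] (mod ?n)" by (intro cong_mult cong_pow yk) simp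
      then have "[y ^ (Suc i * j) * k ^ j = y ^ (i * j)] (mod ?n)"
        by (simp add: power_mult_distrib power_add mult_ac)
      from cong[OF itA[OF a(1), of "Suc i"] this] have "h (Suc i) = (\<theta> ^^ Suc i) a [^] (y ^ (i * j))"
        using Ac[OF itA[OF a(1), of "Suc i"]] unfolding h_def t_def by (simp add: nat_pow_pow)
      also have "\<dots> = \<theta> (t j i)" unfolding t_def tpow[OF itA[OF a(1)]] by simp
      finally show ?thesis .
    qed
    have hp: "h p = h 0"
    proof -
      have ip: "(\<theta> ^^ p) a = a" using iter[OF a(1), of p] wp[OF a(1)] by simp
      have "[(y ^ p) ^ j * k ^ j = 1 ^ j * k ^ j] (mod ?n)" by (intro cong_mult cong_pow yp) simp
      then have "[y ^ (p * j) * k ^ j = k ^ j] (mod ?n)" by (simp add: power_mult)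
      from cong[OF a(1) this] show ?thesis using Ac[OF a(1)] by (simp add: h_def t_def ip nat_pow_pow)
    qed
    have "e j [^] (k ^ j) = finprod ?C h {..<p}"
      unfolding e_def h_def using C.finprod_nat_pow[of "t j" p "k ^ j"] tc by (simp add: pow Pi_def)
    moreover have "\<theta> (e j) = finprod ?C (\<lambda>i. h (Suc i)) {..<p}"
      unfolding e_def tprod[OF tc] by (simp add: hS)
    moreover have "finprod ?C h {..<p} \<otimes> h 0 = h 0 \<otimes> finprod ?C (\<lambda>i. h (Suc i)) {..<p}"
      using C.finprod_lessThan_Suc[of h p] C.finprod_lessThan_shift[of h p] hc hp by (simp add: Pi_def)
    moreover have "finprod ?C h {..<p} \<in> A" "finprod ?C (\<lambda>i. h (Suc i)) {..<p} \<in> A"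
      using C.finprod_closed[of h "{..<p}"] C.finprod_closed[of "\<lambda>i. h (Suc i)" "{..<p}"] hc by auto
    ultimately show ?thesis using comm hc Ac by (metis l_cancel)
  qed
  have "\<exists>j. 0 < j \<and> j < p \<and> e j \<noteq> \<one>"
  proof (rule ccontr)
    assume none: "\<not> ?thesis"
    have e1: "e (Suc j) = \<one>" if "j < p - 1" for j
    proof -
      have "Suc j < p" using that by simp
      then show ?thesis using none by blast
    qed
    have "finprod ?C e {..<Suc (p - 1)} = e 0 \<otimes> finprod ?C (\<lambda>j. e (Suc j)) {..<p - 1}"
      using C.finprod_lessThan_shift[of e "p - 1"] ec by (simp add: Pi_def)
    also have "finprod ?C (\<lambda>j. e (Suc j)) {..<p - 1} = \<one>"
      using C.finprod_one_eqI[of "{..<p - 1}" "\<lambda>j. e (Suc j)"] e1 by simp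
    finally have E0: "finprod ?C e {..<p} = e 0" using p1 Ac[OF ec] by simp
    have "finprod ?C e {..<p} = finprod ?C (\<lambda>i. finprod ?C (\<lambda>j. t j i) {..<p}) {..<p}"
      unfolding e_def by (rule C.finprod_lessThan_swap) (use tc in simp)
    also have "\<dots> = finprod ?C (\<lambda>i. (\<theta> ^^ i) a [^] (\<Sum>j<p. y ^ (i * j))) {..<p}"
      unfolding t_def using C.nat_pow_finprod_sum[of "(\<theta> ^^ i) a" for i] itA[OF a(1)] by (simp add: pow)
    also have "\<dots> = finprod ?C (\<lambda>i. (\<theta> ^^ i) a [^] (\<Sum>j<p. y ^ (i * j))) {..<Suc (p - 1)}" using p1 by simp
    also have "\<dots> = a [^] p \<otimes> finprod ?C (\<lambda>i. (\<theta> ^^ Suc i) a [^] (\<Sum>j<p. y ^ (Suc i * j))) {..<p - 1}"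
      using C.finprod_lessThan_shift[of "\<lambda>i. (\<theta> ^^ i) a [^] (\<Sum>j<p. y ^ (i * j))" "p - 1"] powA[OF itA[OF a(1)]]
      by (simp add: Pi_def)
    also have "finprod ?C (\<lambda>i. (\<theta> ^^ Suc i) a [^] (\<Sum>j<p. y ^ (Suc i * j))) {..<p - 1} = \<one>"
    proof -
      have "(\<theta> ^^ Suc i) a [^] (\<Sum>j<p. y ^ (Suc i * j)) = \<one>" if "i < p - 1" for i
      proof -
        have "?n dvd (\<Sum>j<p. y ^ (Suc i * j))"
          by (rule cong_geometric_sum_0[OF q(1) p yp q(3) y1]) (use that in auto)
        then have "[(\<Sum>j<p. y ^ (Suc i * j)) = 0] (mod ?n)" by (simp add: cong_0_iff)
        from cong[OF itA[OF a(1)] this] show ?thesis by (simp only: nat_pow_0)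
      qed
      then show ?thesis using C.finprod_one_eqI[of "{..<p - 1}" "\<lambda>i. (\<theta> ^^ Suc i) a [^] (\<Sum>j<p. y ^ (Suc i * j))"] by simp
    qed
    finally have e0: "e 0 = a [^] p" using E0 Ac[OF powA[OF a(1)]] by simp
    have "\<theta> (a [^] p) = a [^] p" using eig[of 0] Ac[OF ec[of 0]] by (simp add: e0)
    then have ta: "\<theta> a [^] p = a [^] p" using tpow[OF a(1)] by simp
    have "coprime p ?n" using p q by (simp add: primes_coprime)
    then obtain s where s: "[p * s = 1] (mod ?n)" using cong_solve_coprime_nat[of p ?n] by auto
    have "\<theta> a = (\<theta> a [^] p) [^] s"
      using cong[OF tA[OF a(1)] s] Ac[OF tA[OF a(1)]] by (simp add: nat_pow_pow)
    also have "\<dots> = a" unfolding ta using cong[OF a(1) s] Ac[OF a(1)] by (simp add: nat_pow_pow)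
    finally show False using a(2) by (simp add: \<theta>_def)
  qed
  then obtain j where j: "0 < j" "j < p" "e j \<noteq> \<one>" by blast
  have "coprime j p" using j p by (metis coprime_commute prime_imp_coprime nat_dvd_not_less)
  then obtain r where r: "[j * r = 1] (mod p)" using cong_solve_coprime_nat[of j p] by auto
  then have "(j * r) mod p = 1" using p1 by (simp add: cong_def)
  then have s: "j * r = 1 + p * ((j * r) div p)" using mod_mult_div_eq[of "j * r" p] by simp
  have pw: "(\<theta> ^^ i) (e j) = e j [^] (k ^ (j * i))" for i
  proof (induction i)
    case 0
    then show ?case using Ac[OF ec] by simp
  next
    case (Suc i)
    have "(\<theta> ^^ Suc i) (e j) = (e j [^] (k ^ j)) [^] (k ^ (j * i))"
      by (simp add: Suc tpow[OF ec] eig)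
    then show ?case using Ac[OF ec] by (simp add: nat_pow_pow power_add)
  qed
  have "[k * (k ^ p) ^ ((j * r) div p) = k * 1 ^ ((j * r) div p)] (mod ?n)" by (intro cong_mult cong_pow k(1)) simp
  then have "[k ^ (j * r) = k] (mod ?n)" by (subst s) (simp add: power_add power_mult)
  from cong[OF ec this] have "w [^] r \<otimes> e j \<otimes> inv (w [^] r) = e j [^] k"
    using pw[of r] iter[OF ec] by simp
  with ec j(3) show ?thesis by (rule that)
qed

end

section \<open>Elements conjugate to a power of themselves\<close>

context finite_group
begin

text \<open>The maximality of \<open>p ^ b\<close> makes the index of \<open>B\<close> in
  \<open>L\<close> prime to \<open>p\<close>.\<close>

lemma sylow_conjugate_within:
  assumes L: "subgroup L G" and A: "subgroup A G" "A \<subseteq> L" "card A = p ^ a"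
    and B: "subgroup B G" "B \<subseteq> L" "card B = p ^ b" and p: "Factorial_Ring.prime p"
    and max: "\<not> p ^ Suc b dvd card L"
  obtains l where "l \<in> L" "\<And>u. u \<in> A \<Longrightarrow> l \<otimes> u \<otimes> inv l \<in> B"
proof -
  interpret L: Group.subgroup L G by (rule L)
  interpret GL: finite_group "G\<lparr>carrier := L\<rparr>"
    using subgroup_imp_group[OF L] L.subset fin
    by (intro finite_group.intro finite_group_axioms.intro) (auto intro: finite_subset)
  have "card (rcosets\<^bsub>G\<lparr>carrier := L\<rparr>\<^esub> B) * card B = card L"
    using GL.lagrange[OF subgroup_incl[OF B(1) L B(2)]] by (simp add: Coset.order_def)
  then have "\<not> p dvd card (rcosets\<^bsub>G\<lparr>carrier := L\<rparr>\<^esub> B)"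
    using max mult_dvd_mono[of p _ "p ^ b" "card B"] B(3) by (metis dvd_refl power_Suc)
  from GL.p_subgroup_conjugate_into[OF subgroup_incl[OF A(1) L A(2)] A(3) p subgroup_incl[OF B(1) L B(2)] this]
  obtain l where l: "l \<in> L" "\<And>u. u \<in> A \<Longrightarrow> l \<otimes> u \<otimes> inv\<^bsub>G\<lparr>carrier := L\<rparr>\<^esub> l \<in> B" by auto
  have "l \<otimes> u \<otimes> inv l \<in> B" if "u \<in> A" for u using l(2)[OF that] l(1) L by simp
  with l(1) show ?thesis by (rule that)
qed

lemma subgroup_conj:
  assumes Q: "subgroup Q G" and u: "u \<in> carrier G"
  shows "subgroup ((\<lambda>x. u \<otimes> x \<otimes> inv u) ` Q) G" "card ((\<lambda>x. u \<otimes> x \<otimes> inv u) ` Q) = card Q"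
proof -
  interpret Q: Group.subgroup Q G by (rule Q)
  have Qc: "x \<in> carrier G" if "x \<in> Q" for x using Q.subset that by auto
  have cancel: "inv u \<otimes> (u \<otimes> z) = z" if "z \<in> carrier G" for z using u that by (simp flip: m_assoc)
  show "subgroup ((\<lambda>x. u \<otimes> x \<otimes> inv u) ` Q) G"
  proof (rule subgroupI)
    show "(\<lambda>x. u \<otimes> x \<otimes> inv u) ` Q \<subseteq> carrier G" using Qc u by auto
    show "(\<lambda>x. u \<otimes> x \<otimes> inv u) ` Q \<noteq> {}" using Q.one_closed by blast
    fix a assume "a \<in> (\<lambda>x. u \<otimes> x \<otimes> inv u) ` Q"
    then obtain x where x: "x \<in> Q" "a = u \<otimes> x \<otimes> inv u" by auto
    then have "inv a = u \<otimes> inv x \<otimes> inv u" using u Qc by (simp add: inv_mult_group m_assoc)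
    then show "inv a \<in> (\<lambda>x. u \<otimes> x \<otimes> inv u) ` Q" using x(1) by auto
    fix b assume "b \<in> (\<lambda>x. u \<otimes> x \<otimes> inv u) ` Q"
    then obtain y where y: "y \<in> Q" "b = u \<otimes> y \<otimes> inv u" by auto
    have "a \<otimes> b = u \<otimes> (x \<otimes> y) \<otimes> inv u" using x y u Qc by (simp add: m_assoc cancel)
    then show "a \<otimes> b \<in> (\<lambda>x. u \<otimes> x \<otimes> inv u) ` Q" using x(1) y(1) by auto
  qed
  have "inj_on (\<lambda>x. u \<otimes> x \<otimes> inv u) Q" using u Qc by (auto simp: inj_on_def)
  then show "card ((\<lambda>x. u \<otimes> x \<otimes> inv u) ` Q) = card Q" by (rule card_image)
qed

text \<open>The Sylow \<open>q\<close>-subgroups of \<open>M\<close> form one orbit under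
  \<open>M\<close>, so their number divides \<open>\<bar>M\<bar>\<close> and is prime to
  \<open>p\<close>; the \<open>p\<close>-group \<open>P\<close> fixes one of them.\<close>

lemma invariant_sylow:
  assumes M: "M \<lhd> G" and P: "subgroup P G" "card P = p ^ a" and p: "Factorial_Ring.prime p"
    and pM: "\<not> p dvd card M" and q: "Factorial_Ring.prime q"
  obtains Q where "subgroup Q G" "Q \<subseteq> M" "card Q = q ^ multiplicity q (card M)"
    "\<And>u x. u \<in> P \<Longrightarrow> x \<in> Q \<Longrightarrow> u \<otimes> x \<otimes> inv u \<in> Q"
proof -
  interpret M: Coset.normal M G by (rule M)
  interpret P: Group.subgroup P G by (rule P)
  have Mc: "x \<in> carrier G" if "x \<in> M" for x using M.subset that by auto
  have Pc: "x \<in> carrier G" if "x \<in> P" for x using P.subset that by auto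
  have finM: "finite M" by (rule finite_subset[OF M.subset fin])
  have cM: "card M > 0" using finM M.one_closed card_gt_0_iff by blast
  have gM: "Group.group (G\<lparr>carrier := M\<rparr>)" by (rule subgroup_imp_group[OF M.subgroup_axioms])
  define b where "b = multiplicity q (card M)"
  obtain r where r: "card M = q ^ b * r" "\<not> q dvd r"
    using multiplicity_decompose'[of "card M" q] cM q prime_gt_1_nat[OF q] unfolding b_def
    by (metis less_irrefl nat_dvd_1_iff_1)
  have max: "\<not> q ^ Suc b dvd card M" using r q prime_gt_0_nat[OF q] by simp
  have "\<exists>H. subgroup H (G\<lparr>carrier := M\<rparr>) \<and> card H = q ^ b"
    by (rule Sylow.sylow_thm[OF q gM, of b r]) (use r(1) finM in \<open>auto simp: Coset.order_def\<close>)
  then obtain Q0 where "subgroup Q0 (G\<lparr>carrier := M\<rparr>)" and Qcard: "card Q0 = q ^ b" by blast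
  then have Q0: "subgroup Q0 G" and Q0M: "Q0 \<subseteq> M"
    using incl_subgroup[OF M.subgroup_axioms] subgroup.subset[of Q0 "G\<lparr>carrier := M\<rparr>"] by auto
  have Qc: "x \<in> carrier G" if "x \<in> Q0" for x using Q0M Mc that by auto
  define cj where "cj u S = (\<lambda>x. u \<otimes> x \<otimes> inv u) ` S" for u S
  have cj_mult: "cj (u \<otimes> v) S = cj u (cj v S)" if "u \<in> carrier G" "v \<in> carrier G" "S \<subseteq> carrier G" for u v S
    unfolding cj_def image_image using that by (intro image_cong refl) (auto simp: m_assoc inv_mult_group)
  have cj_one: "cj \<one> S = S" if "S \<subseteq> carrier G" for S
  proof -
    have "cj \<one> S = (\<lambda>x. x) ` S" unfolding cj_def using that by (intro image_cong refl) auto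
    then show ?thesis by simp
  qed
  have Q0c: "Q0 \<subseteq> carrier G" using Qc by auto
  define \<Omega> where "\<Omega> = (\<lambda>m. cj m Q0) ` M"
  have cjM: "cj u S \<subseteq> M" if "u \<in> carrier G" "S \<subseteq> M" for u S
    using that M.inv_op_closed2 by (auto simp: cj_def)
  have "card ((\<lambda>g. cj g Q0) ` carrier (G\<lparr>carrier := M\<rparr>)) dvd card (carrier (G\<lparr>carrier := M\<rparr>))"
    by (rule orbit_card_dvd[OF gM]) (use finM Mc cj_mult[OF _ _ Q0c] cj_one[OF Q0c] in auto)
  then have "card \<Omega> dvd card M" by (simp add: \<Omega>_def)
  then have pO: "\<not> p dvd card \<Omega>" using pM dvd_trans by blast
  have closed: "cj u S \<in> \<Omega>" if u: "u \<in> carrier G" and S: "S \<in> \<Omega>" for u S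
  proof -
    obtain m where m: "m \<in> M" "S = cj m Q0" using S by (auto simp: \<Omega>_def)
    have A: "subgroup (cj u Q0) G" "card (cj u Q0) = q ^ b"
      using subgroup_conj[OF Q0 u] Qcard by (auto simp: cj_def)
    have AM: "cj u Q0 \<subseteq> M" by (rule cjM[OF u Q0M])
    then have Ac: "cj u Q0 \<subseteq> carrier G" using Mc by auto
    obtain l where l: "l \<in> M" "\<And>y. y \<in> cj u Q0 \<Longrightarrow> l \<otimes> y \<otimes> inv l \<in> Q0"
      by (rule sylow_conjugate_within[OF M.subgroup_axioms A(1) AM A(2) Q0 Q0M Qcard q max], rule that)
    have "cj l (cj u Q0) \<subseteq> Q0" using l(2) by (auto simp: cj_def[of l])
    moreover have "card (cj l (cj u Q0)) = card Q0"
      using subgroup_conj(2)[OF A(1) Mc[OF l(1)]] A(2) Qcard by (simp add: cj_def)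
    ultimately have "cj l (cj u Q0) = Q0"
      using finite_subset[OF Q0M finM] by (intro card_subset_eq) auto
    then have "cj (inv l) Q0 = cj (inv l \<otimes> l) (cj u Q0)" using cj_mult[of "inv l" l "cj u Q0"] l(1) Mc Ac by simp
    then have inv_l: "cj u Q0 = cj (inv l) Q0" using l(1) Mc cj_one[OF Ac] by simp
    have "cj u S = cj (u \<otimes> m) Q0" using cj_mult[OF u Mc[OF m(1)] Q0c] m(2) by simp
    also have "u \<otimes> m = (u \<otimes> m \<otimes> inv u) \<otimes> u" using u Mc[OF m(1)] by (simp add: m_assoc)
    also have "cj \<dots> Q0 = cj (u \<otimes> m \<otimes> inv u) (cj (inv l) Q0)"
      using cj_mult[of "u \<otimes> m \<otimes> inv u" u Q0] u Mc[OF m(1)] Q0c inv_l by simp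
    also have "\<dots> = cj ((u \<otimes> m \<otimes> inv u) \<otimes> inv l) Q0"
      using cj_mult[of "u \<otimes> m \<otimes> inv u" "inv l" Q0] u Mc[OF m(1)] Mc[OF l(1)] Q0c by simp
    finally have "cj u S = cj ((u \<otimes> m \<otimes> inv u) \<otimes> inv l) Q0" .
    then show ?thesis unfolding \<Omega>_def
      by (rule image_eqI) (rule M.m_closed[OF M.inv_op_closed2[OF u m(1)] M.m_inv_closed[OF l(1)]])
  qed
  have Oc: "S \<subseteq> carrier G" if "S \<in> \<Omega>" for S
  proof -
    obtain m where "m \<in> M" "S = cj m Q0" using \<open>S \<in> \<Omega>\<close> unfolding \<Omega>_def by blast
    then show ?thesis using cjM[OF Mc Q0M, of m] M.subset by simp
  qed
  have finO: "finite \<Omega>" using finM by (simp add: \<Omega>_def)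
  obtain S where S: "S \<in> \<Omega>" and fx: "\<And>u. u \<in> carrier (G\<lparr>carrier := P\<rparr>) \<Longrightarrow> cj u S = S"
  proof (rule p_group_fixed_point[OF subgroup_imp_group[OF P(1)] _ p finO, where act = cj])
    show "card (carrier (G\<lparr>carrier := P\<rparr>)) = p ^ a" using P(2) by simp
  qed (use closed Pc Oc cj_one cj_mult pO in auto)
  obtain m where m: "m \<in> M" "S = cj m Q0" using S by (auto simp: \<Omega>_def)
  have S1: "subgroup S G" and S2: "card S = q ^ multiplicity q (card M)"
    using subgroup_conj[OF Q0 Mc[OF m(1)]] Qcard m(2) by (auto simp: cj_def b_def)
  have S3: "S \<subseteq> M" using cjM[OF Mc[OF m(1)] Q0M] m(2) by simp
  have S4: "u \<otimes> x \<otimes> inv u \<in> S" if "u \<in> P" "x \<in> S" for u x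
  proof -
    have "u \<otimes> x \<otimes> inv u \<in> cj u S" using that(2) by (simp add: cj_def)
    then show ?thesis using fx[of u] that(1) by simp
  qed
  from that[OF S1 S3 S2 S4] show ?thesis .
qed

text \<open>Let \<open>Z\<close> be the centre of a \<open>P\<close>-invariant Sylow
  \<open>q\<close>-subgroup of \<open>M\<close>. If \<open>k\<close> is 1 modulo \<open>q\<close>,
  any \<open>x\<close> of order \<open>q\<close> in \<open>Z\<close> equals
  \<open>x\<^sup>k\<close>. Otherwise some element of \<open>P\<close> acts nontrivially on
  \<open>Z\<close>, a suitable power of it acts with order exactly \<open>p\<close>, and
  \<open>power_eigenvector\<close> applies.\<close>

lemma exists_power_conjugate:
  assumes M: "M \<lhd> G" "M \<noteq> {\<one>}" and P: "subgroup P G" "card P = p ^ a" and p: "Factorial_Ring.prime p"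
    and pM: "\<not> p dvd card M"
    and fix1: "\<And>m. m \<in> M \<Longrightarrow> (\<And>u. u \<in> P \<Longrightarrow> u \<otimes> m \<otimes> inv u = m) \<Longrightarrow> m = \<one>"
    and k: "[k ^ p = 1] (mod Coset.order G)"
  obtains x w where "x \<in> M" "x \<noteq> \<one>" "w \<in> carrier G" "w \<otimes> x \<otimes> inv w = x [^] (k::nat)"
proof -
  interpret M: Coset.normal M G by (rule M)
  interpret P: Group.subgroup P G by (rule P)
  have Mc: "x \<in> carrier G" if "x \<in> M" for x using M.subset that by auto
  have Pc: "x \<in> carrier G" if "x \<in> P" for x using P.subset that by auto
  have finM: "finite M" by (rule finite_subset[OF M.subset fin])
  have "card M \<noteq> 1" using M(2) M.one_closed by (metis card_1_singletonE singletonD)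
  then obtain q where q: "Factorial_Ring.prime q" "q dvd card M" using prime_factor_nat by blast
  have q1: "q > 1" using q(1) prime_gt_1_nat by simp
  have pq: "p \<noteq> q" using pM q(2) by auto
  define b where "b = multiplicity q (card M)"
  have cM: "card M > 0" using finM M.one_closed card_gt_0_iff by blast
  have b0: "b > 0" unfolding b_def using q cM q1 by (intro multiplicity_gt_zero_iff[THEN iffD2]) auto
  obtain Q where Q: "subgroup Q G" "Q \<subseteq> M" "card Q = q ^ b"
    and Qinv: "\<And>u x. u \<in> P \<Longrightarrow> x \<in> Q \<Longrightarrow> u \<otimes> x \<otimes> inv u \<in> Q"
    by (rule invariant_sylow[OF M(1) P p pM q(1)], rule that) (simp_all add: b_def)
  interpret Q: Group.subgroup Q G by (rule Q)
  have Qc: "x \<in> carrier G" if "x \<in> Q" for x using Q.subset that by auto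
  have finQ: "finite Q" by (rule finite_subset[OF Q(2) finM])
  have qG: "q ^ b dvd Coset.order G" using lagrange[OF Q(1)] Q(3) by (metis dvd_triv_right)
  have kq: "[k ^ p = 1] (mod q ^ b)" by (rule cong_dvd_modulus_nat[OF k qG])
  define Z where "Z = {z \<in> Q. \<forall>x\<in>Q. z \<otimes> x = x \<otimes> z}"
  have ZQ: "Z \<subseteq> Q" by (auto simp: Z_def)
  have Zc: "x \<in> carrier G" if "x \<in> Z" for x using ZQ Qc that by auto
  have Z: "subgroup Z G"
  proof (rule subgroupI)
    show "Z \<subseteq> carrier G" using Zc by auto
    have "\<one> \<in> Z" using Q.one_closed Qc by (simp add: Z_def)
    then show "Z \<noteq> {}" by blast
    fix a assume a: "a \<in> Z"
    show "inv a \<in> Z"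
      unfolding Z_def
    proof (intro CollectI conjI ballI)
      show "inv a \<in> Q" using ZQ a by auto
      fix x assume x: "x \<in> Q"
      have ax: "a \<otimes> x = x \<otimes> a" using a x unfolding Z_def by blast
      have "inv a \<otimes> x = inv a \<otimes> (x \<otimes> a) \<otimes> inv a" using Zc[OF a] Qc[OF x] by (simp add: m_assoc)
      also have "\<dots> = x \<otimes> inv a"
        unfolding ax[symmetric] using Zc[OF a] Qc[OF x] by (simp add: m_assoc[symmetric])
      finally show "inv a \<otimes> x = x \<otimes> inv a" .
    qed
    fix b assume b: "b \<in> Z"
    show "a \<otimes> b \<in> Z"
      unfolding Z_def
    proof (intro CollectI conjI ballI)
      show "a \<otimes> b \<in> Q" using ZQ a b by auto
      fix x assume x: "x \<in> Q"
      have ax: "a \<otimes> x = x \<otimes> a" and bx: "b \<otimes> x = x \<otimes> b" using a b x unfolding Z_def by blast+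
      have "a \<otimes> b \<otimes> x = a \<otimes> x \<otimes> b" using Zc[OF a] Zc[OF b] Qc[OF x] by (simp add: m_assoc bx)
      also have "\<dots> = x \<otimes> (a \<otimes> b)" unfolding ax using Zc[OF a] Zc[OF b] Qc[OF x] by (simp add: m_assoc)
      finally show "a \<otimes> b \<otimes> x = x \<otimes> (a \<otimes> b)" .
    qed
  qed
  interpret Z: Group.subgroup Z G by (rule Z)
  have comm: "x \<otimes> y = y \<otimes> x" if "x \<in> Z" "y \<in> Z" for x y using that unfolding Z_def by blast
  have Zn: "x [^] (q ^ b) = \<one>" if "x \<in> Z" for x
  proof -
    interpret GQ: Group.group "G\<lparr>carrier := Q\<rparr>" by (rule subgroup_imp_group[OF Q(1)])
    have "x [^]\<^bsub>G\<lparr>carrier := Q\<rparr>\<^esub> Coset.order (G\<lparr>carrier := Q\<rparr>) = \<one>\<^bsub>G\<lparr>carrier := Q\<rparr>\<^esub>"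
      using that ZQ by (intro GQ.pow_order_eq_1) auto
    then show ?thesis using Q(3) nat_pow_consistent[of x _ Q] by (simp add: Coset.order_def)
  qed
  have Zinv: "u \<otimes> z \<otimes> inv u \<in> Z" if u: "u \<in> P" and z: "z \<in> Z" for u z
    unfolding Z_def
  proof (intro CollectI conjI ballI)
    show "u \<otimes> z \<otimes> inv u \<in> Q" using Qinv[OF u] z ZQ by auto
    fix x assume x: "x \<in> Q"
    have cancel: "inv u \<otimes> (u \<otimes> y) = y" "u \<otimes> (inv u \<otimes> y) = y" if "y \<in> carrier G" for y
      using Pc[OF u] that by (simp_all flip: m_assoc)
    have "inv u \<otimes> x \<otimes> u \<in> Q" using Qinv[OF P.m_inv_closed[OF u] x] Pc[OF u] by simp
    then have "z \<otimes> (inv u \<otimes> x \<otimes> u) = (inv u \<otimes> x \<otimes> u) \<otimes> z" using z unfolding Z_def by blast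
    then have "u \<otimes> (z \<otimes> (inv u \<otimes> x \<otimes> u)) \<otimes> inv u = u \<otimes> ((inv u \<otimes> x \<otimes> u) \<otimes> z) \<otimes> inv u" by simp
    then show "u \<otimes> z \<otimes> inv u \<otimes> x = x \<otimes> (u \<otimes> z \<otimes> inv u)"
      using Pc[OF u] Zc[OF z] Qc[OF x] by (simp add: m_assoc cancel)
  qed
  have "\<exists>z\<in>Z. z \<noteq> \<one>"
  proof -
    have "\<exists>t. card Q = card {x\<in>Q. \<forall>g\<in>carrier (G\<lparr>carrier := Q\<rparr>). g \<otimes> x \<otimes> inv g = x} + q * t"
      by (rule p_group_action_card[OF subgroup_imp_group[OF Q(1)] _ q(1) finQ, where a = b])
        (use Q(3) Qc in \<open>auto simp: m_assoc inv_mult_group\<close>)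
    moreover have "{x\<in>Q. \<forall>g\<in>carrier (G\<lparr>carrier := Q\<rparr>). g \<otimes> x \<otimes> inv g = x} = Z"
    proof -
      have iff: "g \<otimes> x \<otimes> inv g = x \<longleftrightarrow> x \<otimes> g = g \<otimes> x" if "g \<in> Q" "x \<in> Q" for g x
      proof
        assume eq: "g \<otimes> x \<otimes> inv g = x"
        have "g \<otimes> x \<otimes> inv g \<otimes> g = g \<otimes> x" using Qc[OF that(1)] Qc[OF that(2)] by (simp add: m_assoc)
        then show "x \<otimes> g = g \<otimes> x" unfolding eq .
      next
        assume eq: "x \<otimes> g = g \<otimes> x"
        show "g \<otimes> x \<otimes> inv g = x"
          unfolding eq[symmetric] using Qc[OF that(1)] Qc[OF that(2)] by (simp add: m_assoc)
      qed
      have "(\<forall>g\<in>Q. g \<otimes> x \<otimes> inv g = x) \<longleftrightarrow> (\<forall>g\<in>Q. x \<otimes> g = g \<otimes> x)" if "x \<in> Q" for x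
        by (rule ball_cong[OF refl iff[OF _ that]])
      then show ?thesis unfolding Z_def by (simp cong: conj_cong)
    qed
    ultimately obtain t where "card Q = card Z + q * t" by auto
    moreover have "q dvd card Q" using Q(3) b0 by (simp add: dvd_power)
    ultimately have "q dvd card Z" by (metis dvd_add_left_iff dvd_triv_left)
    then have "Z \<noteq> {\<one>}" using q1 by auto
    then show ?thesis using Z.one_closed by blast
  qed
  then obtain z where z: "z \<in> Z" "z \<noteq> \<one>" by blast
  show ?thesis
  proof (cases "[k = 1] (mod q)")
    case True
    define e where "e = (LEAST e. z [^] (q ^ e) = \<one>)"
    have e: "z [^] (q ^ e) = \<one>" unfolding e_def by (rule LeastI[of _ b]) (rule Zn[OF z(1)])
    have e0: "e \<noteq> 0" using e z(2) Zc[OF z(1)] by (metis nat_pow_eone power_0)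
    define x where "x = z [^] (q ^ (e - 1))"
    have x1: "x \<noteq> \<one>" unfolding x_def e_def using e0 not_less_Least[of "e - 1" "\<lambda>e. z [^] (q ^ e) = \<one>"] by (auto simp: e_def)
    have xM: "x \<in> M"
    proof -
      have "x \<in> carrier (G\<lparr>carrier := Z\<rparr>)"
        using group.is_monoid[OF subgroup_imp_group[OF Z], THEN monoid.nat_pow_closed, of z "q ^ (e - 1)"] z(1)
          nat_pow_consistent[of z _ Z] by (simp add: x_def)
      then show ?thesis using ZQ Q(2) by auto
    qed
    have "x [^] q = \<one>" using e e0 Zc[OF z(1)] by (cases e) (auto simp: x_def nat_pow_pow mult.commute)
    then have "x [^] k = x [^] (1::nat)" using Mc[OF \<open>x \<in> M\<close>] True by (intro pow_mod_order) auto
    then have "\<one> \<otimes> x \<otimes> inv \<one> = x [^] k" using Mc[OF \<open>x \<in> M\<close>] by simp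
    from that[OF xM x1 one_closed this] show ?thesis .
  next
    case False
    have "\<exists>u\<in>P. u \<otimes> z \<otimes> inv u \<noteq> z" using fix1[of z] z ZQ Q(2) by blast
    then obtain u where u: "u \<in> P" "u \<otimes> z \<otimes> inv u \<noteq> z" by blast
    define E where "E e \<longleftrightarrow> (\<forall>x\<in>Z. u [^] (p ^ e) \<otimes> x \<otimes> inv (u [^] (p ^ e)) = x)" for e
    have uP: "u [^] m \<in> P" for m :: nat
      using group.is_monoid[OF subgroup_imp_group[OF P(1)], THEN monoid.nat_pow_closed, of u m] u(1)
        nat_pow_consistent[of u _ P] by simp
    have "u [^] (p ^ a) = \<one>"
    proof -
      interpret GP: Group.group "G\<lparr>carrier := P\<rparr>" by (rule subgroup_imp_group[OF P(1)])
      have "u [^]\<^bsub>G\<lparr>carrier := P\<rparr>\<^esub> Coset.order (G\<lparr>carrier := P\<rparr>) = \<one>\<^bsub>G\<lparr>carrier := P\<rparr>\<^esub>"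
        using u(1) by (intro GP.pow_order_eq_1) auto
      then show ?thesis using P(2) nat_pow_consistent[of u _ P] by (simp add: Coset.order_def)
    qed
    then have "E a" using Zc by (simp add: E_def)
    define e where "e = (LEAST e. E e)"
    have Ee: "E e" unfolding e_def by (rule LeastI) fact
    have "\<not> E 0" using u z(1) Pc[OF u(1)] by (auto simp: E_def)
    then have e0: "e \<noteq> 0" using Ee by metis
    then have "\<not> E (e - 1)" using not_less_Least[of "e - 1" E] by (simp add: e_def)
    define w where "w = u [^] (p ^ (e - 1))"
    have wP: "w \<in> P" unfolding w_def by (rule uP)
    obtain a' where a': "a' \<in> Z" "w \<otimes> a' \<otimes> inv w \<noteq> a'" using \<open>\<not> E (e - 1)\<close> by (auto simp: E_def w_def)
    have "w [^] p = u [^] (p ^ e)" using e0 Pc[OF u(1)] by (cases e) (auto simp: w_def nat_pow_pow mult.commute)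
    then have wp: "w [^] p \<otimes> x \<otimes> inv (w [^] p) = x" if "x \<in> Z" for x using Ee that by (simp add: E_def)
    obtain x i where x: "x \<in> Z" "x \<noteq> \<one>" "w [^] (i::nat) \<otimes> x \<otimes> inv (w [^] i) = x [^] k"
      by (rule power_eigenvector[OF Z comm Pc[OF wP] Zinv[OF wP] wp a' p q(1) pq b0 Zn kq False]; assumption?; rule that)
    show ?thesis
      by (rule that[of x "w [^] i"]) (use x ZQ Q(2) Pc[OF wP] in auto)
  qed
qed

text \<open>By the two counting results some invariant character is nontrivial on \<open>M\<close>,
  and its degree is divisible by \<open>p\<close>.\<close>

lemma exists_invariant_Irr_dvd_degree:
  assumes M: "M \<lhd> G" "M \<noteq> {\<one>}" and P: "subgroup P G" "card P = p ^ a" and p: "Factorial_Ring.prime p"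
    and fix1: "\<And>m. m \<in> M \<Longrightarrow> (\<And>u. u \<in> P \<Longrightarrow> u \<otimes> m \<otimes> inv u = m) \<Longrightarrow> m = \<one>"
    and k: "[k ^ p = 1] (mod Coset.order G)"
    and gal: "\<And>\<chi>. \<chi> \<in> Irr G \<Longrightarrow> \<exists>\<psi>\<in>Irr G. \<exists>c. \<forall>g\<in>carrier G. \<chi> (g [^] (k::nat)) = c * \<psi> g"
  obtains \<chi> d where "\<chi> \<in> Irr G" "\<And>g. g \<in> carrier G \<Longrightarrow> \<chi> (g [^] k) = \<chi> g" "\<chi> \<one> = of_nat d" "p dvd d"
proof -
  interpret M: Coset.normal M G by (rule M)
  interpret P: Group.subgroup P G by (rule P)
  have Mc: "x \<in> carrier G" if "x \<in> M" for x using M.subset that by auto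
  have Pc: "x \<in> carrier G" if "x \<in> P" for x using P.subset that by auto
  have finM: "finite M" by (rule finite_subset[OF M.subset fin])
  have "\<exists>t. card M = card {x\<in>M. \<forall>g\<in>carrier (G\<lparr>carrier := P\<rparr>). g \<otimes> x \<otimes> inv g = x} + p * t"
    by (rule p_group_action_card[OF subgroup_imp_group[OF P(1)] _ p finM, where a = a])
      (use P(2) Mc Pc M.inv_op_closed2 in \<open>auto simp: m_assoc inv_mult_group\<close>)
  moreover have "{x\<in>M. \<forall>g\<in>carrier (G\<lparr>carrier := P\<rparr>). g \<otimes> x \<otimes> inv g = x} = {\<one>}"
    using fix1 Pc by auto
  ultimately obtain t where "card M = 1 + p * t" by auto
  then have pM: "\<not> p dvd card M" using prime_gt_1_nat[OF p] by (metis dvd_add_left_iff dvd_triv_left nat_dvd_1_iff_1 less_irrefl)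
  obtain x w where x: "x \<in> M" "x \<noteq> \<one>" "w \<in> carrier G" "w \<otimes> x \<otimes> inv w = x [^] k"
    by (rule exists_power_conjugate[OF M P p pM fix1 k]; assumption?; rule that)
  have "\<exists>\<chi>\<in>Irr G. (\<forall>g\<in>carrier G. \<chi> (g [^] k) = \<chi> g) \<and> (\<Sum>m\<in>M. \<chi> m) = 0"
  proof (rule ccontr)
    assume none: "\<not> ?thesis"
    have "(\<Sum>g\<in>carrier G. \<Sum>m\<in>M. card {h \<in> carrier G. h \<otimes> (g [^] k \<otimes> m) \<otimes> inv h = g}) =
        card M * (\<Sum>g\<in>carrier G. card {h \<in> carrier G. h \<otimes> g [^] k \<otimes> inv h = g})"
      by (rule fixed_Irr_class_count[OF M(1) gal]) (use none in auto)
    then show False using power_class_count_less[OF M(1) p pM k x] by simp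
  qed
  then obtain \<chi> where chi: "\<chi> \<in> Irr G" "\<And>g. g \<in> carrier G \<Longrightarrow> \<chi> (g [^] k) = \<chi> g" "(\<Sum>m\<in>M. \<chi> m) = 0" by blast
  obtain d where d: "\<chi> \<one> = of_nat d" using Irr_one[OF chi(1)] by metis
  have "p dvd d" by (rule dvd_degree_of_no_fixed_points[OF chi(1) d M(1) chi(3) P p fix1])
  with chi(1,2) d show ?thesis by (rule that)
qed

end

section \<open>The cyclotomic Galois group and reduction to a quotient\<close>

lemma cyclotomic_field_root: "exp (2 * of_real pi * \<i> / of_nat n) \<in> cyclotomic_field n"
  unfolding cyclotomic_field_def by (rule generate_field.incl) simp

lemma cyclotomic_field_power:
  assumes "x \<in> cyclotomic_field n" shows "x ^ j \<in> cyclotomic_field n"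
proof (induction j)
  case 0
  then show ?case using subsetD[OF cyclotomic_field_closed(1) Rats_1] by simp
next
  case (Suc j)
  then show ?case using cyclotomic_field_closed(3)[OF assms Suc] by simp
qed

lemma Gal_iff:
  "\<sigma> \<in> carrier (Gal F) \<longleftrightarrow> \<sigma> \<in> Bij F \<and> (\<forall>x\<in>F. \<sigma> x \<in> F) \<and> (\<forall>x\<in>F. \<forall>y\<in>F. \<sigma> (x * y) = \<sigma> x * \<sigma> y) \<and>
      (\<forall>x\<in>F. \<forall>y\<in>F. \<sigma> (x + y) = \<sigma> x + \<sigma> y) \<and> \<sigma> 1 = 1 \<and> (\<forall>q\<in>\<rat>. \<sigma> q = q)"
  by (auto simp: Gal_def Ring.ring_hom_def class_ring_simps)

lemma exp_root_power_eq_iff: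
  assumes n: "n > 0"
  shows "exp (2 * of_real pi * \<i> / of_nat n) ^ a = exp (2 * of_real pi * \<i> / of_nat n) ^ b \<longleftrightarrow> [a = b] (mod n)"
proof -
  define z where "z = exp (2 * of_real pi * \<i> / of_nat n)"
  have zn: "z ^ n = 1" unfolding z_def by (rule exp_root_of_unity[OF n])
  have zmod: "z ^ m = z ^ (m mod n)" for m
  proof -
    have "z ^ m = z ^ (n * (m div n) + m mod n)" by simp
    also have "\<dots> = z ^ (m mod n)" unfolding power_add power_mult zn by simp
    finally show ?thesis .
  qed
  have cis: "z ^ k = cis (2 * pi * real k / real n)" for k
    unfolding z_def by (simp add: cis_conv_exp mult_ac flip: exp_of_nat_mult)
  have inj: "inj_on (\<lambda>k. z ^ k) {..<n}"
    unfolding cis using bij_betw_roots_unity[OF n] by (simp add: bij_betw_def)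
  have "z ^ a = z ^ b \<longleftrightarrow> z ^ (a mod n) = z ^ (b mod n)" by (simp only: zmod[of a] zmod[of b])
  also have "\<dots> \<longleftrightarrow> a mod n = b mod n" using inj n by (auto simp: inj_on_def)
  finally show ?thesis unfolding z_def cong_def .
qed

text \<open>An automorphism is determined by the power to which it raises a primitive root of unity,
  and composition multiplies the exponents.\<close>

lemma Gal_cyclotomic_power:
  assumes n: "n > 0" and s: "\<sigma> \<in> carrier (Gal (cyclotomic_field n))"
  obtains k where "\<And>e. e ^ n = 1 \<Longrightarrow> e \<in> cyclotomic_field n \<and> \<sigma> e = e ^ k"
    "[k ^ group.ord (Gal (cyclotomic_field n)) \<sigma> = 1] (mod n)"
proof -
  let ?F = "cyclotomic_field n"
  define z where "z = exp (2 * of_real pi * \<i> / of_nat n)"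
  have zF: "z \<in> ?F" unfolding z_def by (rule cyclotomic_field_root)
  have zjF: "z ^ j \<in> ?F" for j by (rule cyclotomic_field_power[OF zF])
  have zn: "z ^ n = 1" unfolding z_def by (rule exp_root_of_unity[OF n])
  interpret Gal: Group.group "Gal ?F" by (rule group_Gal_cyclotomic_field)
  have pow: "\<tau> (x ^ j) = \<tau> x ^ j" if "\<tau> \<in> carrier (Gal ?F)" "x \<in> ?F" for \<tau> x j
    using that cyclotomic_field_power[OF that(2)] unfolding Gal_iff by (induction j) auto
  have "\<sigma> z ^ n = \<sigma> 1" using pow[OF s zF, of n] zn by simp
  then have "\<sigma> z ^ n = 1" using s unfolding Gal_iff by simp
  then obtain k where k: "\<sigma> z = z ^ k" unfolding z_def using root_of_unity_powers[OF n] by metis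
  have "e \<in> ?F \<and> \<sigma> e = e ^ k" if e: "e ^ n = 1" for e
  proof -
    obtain j where "e = z ^ j" unfolding z_def using root_of_unity_powers[OF n e] by metis
    then show ?thesis using zjF pow[OF s zF] k by (simp add: mult.commute flip: power_mult)
  qed
  moreover have "[k ^ group.ord (Gal ?F) \<sigma> = 1] (mod n)"
  proof -
    have it: "(\<sigma> [^]\<^bsub>Gal ?F\<^esub> i) z = z ^ (k ^ i)" for i :: nat
    proof (induction i)
      case 0
      have "\<one>\<^bsub>Gal ?F\<^esub> = (\<lambda>x\<in>?F. x)" by (simp add: Gal_def BijGroup_def)
      then show ?case using zF by simp
    next
      case (Suc i)
      have si: "\<sigma> [^]\<^bsub>Gal ?F\<^esub> i \<in> carrier (Gal ?F)" using s by simp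
      have mult: "\<tau> \<otimes>\<^bsub>Gal ?F\<^esub> \<tau>' = compose ?F \<tau> \<tau>'" if "\<tau> \<in> carrier (Gal ?F)" "\<tau>' \<in> carrier (Gal ?F)" for \<tau> \<tau>'
        using that by (simp add: Gal_def BijGroup_def)
      have "(\<sigma> [^]\<^bsub>Gal ?F\<^esub> Suc i) z = (\<sigma> \<otimes>\<^bsub>Gal ?F\<^esub> \<sigma> [^]\<^bsub>Gal ?F\<^esub> i) z"
        using s by (simp only: Gal.nat_pow_Suc2)
      also have "\<dots> = \<sigma> ((\<sigma> [^]\<^bsub>Gal ?F\<^esub> i) z)" unfolding mult[OF s si] using zF by (simp add: compose_eq)
      also have "\<dots> = z ^ (k ^ Suc i)"
        unfolding Suc pow[OF s zF] k by (simp flip: power_mult)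
      finally show ?case .
    qed
    let ?o = "Gal.ord \<sigma>"
    have "\<one>\<^bsub>Gal ?F\<^esub> z = z" using it[of 0] by simp
    then have "z ^ (k ^ ?o) = z ^ 1" using it[of ?o] Gal.pow_ord_eq_1[OF s] by simp
    then show ?thesis unfolding z_def exp_root_power_eq_iff[OF n] by simp
  qed
  ultimately show ?thesis by (rule that)
qed

text \<open>Here \<open>G\<close> may be a quotient of the group whose order defines the cyclotomic
  field, whence \<open>n\<close> is only a multiple of its order.\<close>

lemma (in finite_group) Gal_conj_Irr:
  assumes n: "n > 0" "Coset.order G dvd n" and s: "\<sigma> \<in> carrier (Gal (cyclotomic_field n))"
    and k: "\<And>e. e ^ n = 1 \<Longrightarrow> e \<in> cyclotomic_field n \<and> \<sigma> e = e ^ (k::nat)"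
    and chi: "\<chi> \<in> Irr G"
  shows "g \<in> carrier G \<Longrightarrow> \<sigma> (\<chi> g) = \<chi> (g [^] k)"
    and "\<exists>\<psi>\<in>Irr G. \<exists>c. \<forall>g\<in>carrier G. \<chi> (g [^] k) = c * \<psi> g"
proof -
  let ?F = "cyclotomic_field n"
  have rat: "q \<in> ?F \<and> \<sigma> q = q" if "q \<in> \<rat>" for q
    using that s cyclotomic_field_closed(1) unfolding Gal_iff by auto
  have add: "x + y \<in> ?F \<and> \<sigma> (x + y) = \<sigma> x + \<sigma> y" if "x \<in> ?F" "y \<in> ?F" for x y
    using that s cyclotomic_field_closed(2) unfolding Gal_iff by auto
  have mult: "x * y \<in> ?F \<and> \<sigma> (x * y) = \<sigma> x * \<sigma> y" if "x \<in> ?F" "y \<in> ?F" for x y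
    using that s cyclotomic_field_closed(3) unfolding Gal_iff by auto
  have val: "\<chi> g \<in> ?F \<and> \<sigma> (\<chi> g) = \<chi> (g [^] k)" if g: "g \<in> carrier G" for g
  proof -
    obtain es where es: "\<And>e. e \<in> set es \<Longrightarrow> e ^ Coset.order G = 1"
      and tr: "\<And>k::nat. \<chi> (g [^] k) = (\<Sum>e\<leftarrow>es. e ^ k)"
      using Irr_power_trace[OF chi g] by blast
    have e1: "e ^ n = 1" if "e \<in> set es" for e
      using es[OF that] n(2) by (auto simp: power_mult elim!: dvdE)
    have "sum_list es \<in> ?F \<and> \<sigma> (sum_list es) = (\<Sum>e\<leftarrow>es. e ^ k)"
      using e1
    proof (induction es)
      case Nil
      then show ?case using rat[of 0] by simp
    next
      case (Cons e es)
      then show ?case using k[of e] add[of e "sum_list es"] by simp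
    qed
    then show ?thesis using tr[of 1] tr[of k] g by simp
  qed
  show "g \<in> carrier G \<Longrightarrow> \<sigma> (\<chi> g) = \<chi> (g [^] k)" using val by blast
  have "\<exists>\<psi>\<in>Irr G. \<exists>c. \<forall>a\<in>carrier G. \<sigma> (\<chi> a) = c * \<psi> a"
    by (rule ring_automorphism_Irr[OF chi, of ?F]) (use val rat add mult in auto)
  then show "\<exists>\<psi>\<in>Irr G. \<exists>c. \<forall>g\<in>carrier G. \<chi> (g [^] k) = c * \<psi> g" using val by simp
qed

lemma Irr_inflate:
  assumes hom: "group_hom G H \<pi>" and surj: "\<pi> ` carrier G = carrier H" and chi: "\<chi> \<in> Irr H"
  shows "(\<lambda>g\<in>carrier G. \<chi> (\<pi> g)) \<in> Irr G"
proof -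
  interpret group_hom G H \<pi> by (rule hom)
  obtain n \<rho> where c: "\<chi> = character_of H \<rho>" and r: "irreducible_rep H n \<rho>" using chi by (auto simp: Irr_def)
  have hc: "\<pi> g \<in> carrier H" if "g \<in> carrier G" for g using that by simp
  have "(\<lambda>g. \<rho> (\<pi> g)) \<in> hom G (GL n)"
    using irreducible_repD(1)[OF r] by (auto simp: hom_def Pi_def)
  moreover have "W = {0\<^sub>v n} \<or> W = carrier_vec n"
    if W: "VectorSpace.subspace class_ring W (module_vec TYPE(complex) n)"
      and inv: "\<forall>g\<in>carrier G. \<forall>w\<in>W. \<rho> (\<pi> g) *\<^sub>v w \<in> W" for W
  proof (rule irreducible_repD(3)[OF r W])
    fix h w assume "h \<in> carrier H" "w \<in> W"
    then show "\<rho> h *\<^sub>v w \<in> W" using inv surj by (metis imageE)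
  qed
  ultimately have "irreducible_rep G n (\<lambda>g. \<rho> (\<pi> g))"
    unfolding irreducible_rep_def using irreducible_repD(2)[OF r] by blast
  moreover have "(\<lambda>g\<in>carrier G. \<chi> (\<pi> g)) = character_of G (\<lambda>g. \<rho> (\<pi> g))"
    unfolding c character_of_def using hc by (intro restrict_ext) simp
  ultimately show ?thesis by (auto simp: Irr_def)
qed

lemma (in finite_group) normalizer_memI:
  assumes P: "subgroup P G" and x: "x \<in> carrier G" and conj: "\<And>u. u \<in> P \<Longrightarrow> x \<otimes> u \<otimes> inv x \<in> P"
  shows "x \<in> normalizer G P"
proof -
  interpret P: Group.subgroup P G by (rule P)
  have "x <# P #> inv x = (\<lambda>u. x \<otimes> u \<otimes> inv x) ` P" by (auto simp: l_coset_def r_coset_def)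
  also have "\<dots> = P"
    using subgroup_conj(2)[OF P x] conj finite_subset[OF P.subset fin] by (intro card_subset_eq) auto
  finally show ?thesis using x P.subset by (simp add: normalizer_def stabilizer_def)
qed

text \<open>Frattini argument. The hypothesis says that the coset of \<open>m\<close> commutes with
  the image of \<open>P\<close> modulo \<open>K\<close>; so \<open>m P m\<^sup>-\<^sup>1\<close>
  lies in the preimage \<open>L\<close> of that image, and is conjugate to the Sylow subgroup
  \<open>P\<close> by some \<open>l\<close> in \<open>L\<close>. Modulo \<open>K\<close>,
  \<open>l\<close> agrees with some \<open>v\<close> in \<open>P\<close>, and
  \<open>v\<^sup>-\<^sup>1 l m\<close> is the element sought.\<close>

lemma (in finite_group) frattini_fixed_coset:
  assumes p: "Factorial_Ring.prime p" and P: "sylow_subgroup p P G" and K: "K \<lhd> G"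
    and m: "m \<in> carrier G"
    and fx: "\<And>u. u \<in> P \<Longrightarrow> K #> (u \<otimes> m \<otimes> inv u) = K #> m"
  obtains x where "x \<in> normalizer G P" "x \<in> K #> m"
proof -
  interpret K: Coset.normal K G by (rule K)
  let ?H = "G Mod K"
  interpret pi: group_hom G ?H "\<lambda>x. K #> x"
    by (intro group_hom.intro group_hom_axioms.intro is_group K.factorgroup_is_group K.r_coset_hom_Mod)
  define b where "b = multiplicity p (Coset.order G)"
  have sP: "subgroup P G" and cP: "card P = p ^ b" using P by (auto simp: sylow_subgroup_def b_def)
  interpret P: Group.subgroup P G by (rule sP)
  have Pc: "u \<in> carrier G" if "u \<in> P" for u using P.subset that by auto
  have img: "subgroup ((\<lambda>x. K #> x) ` P) ?H" by (rule pi.subgroup_img_is_subgroup[OF sP])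
  define L where "L = {x \<in> carrier G. K #> x \<in> (\<lambda>x. K #> x) ` P}"
  have L: "subgroup L G"
  proof (rule subgroupI)
    show "L \<subseteq> carrier G" by (auto simp: L_def)
    have "\<one> \<in> L" unfolding L_def using imageI[OF P.one_closed] by blast
    then show "L \<noteq> {}" by blast
    fix a assume a: "a \<in> L"
    then show "inv a \<in> L" using subgroup.m_inv_closed[OF img, of "K #> a"] pi.hom_inv[of a] by (simp add: L_def)
    fix c assume c: "c \<in> L"
    show "a \<otimes> c \<in> L" using a c subgroup.m_closed[OF img, of "K #> a" "K #> c"] pi.hom_mult[of a c] by (simp add: L_def)
  qed
  have PL: "P \<subseteq> L" using Pc by (auto simp: L_def)
  have "card L dvd Coset.order G" using lagrange[OF L] by (metis dvd_triv_right)
  moreover have "\<not> p ^ Suc b dvd Coset.order G"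
    using power_dvd_iff_le_multiplicity[of "Coset.order G" p "Suc b"] order_pos prime_gt_1_nat[OF p] by (simp add: b_def)
  ultimately have max: "\<not> p ^ Suc b dvd card L" using dvd_trans by blast
  have A: "subgroup ((\<lambda>u. m \<otimes> u \<otimes> inv m) ` P) G" "card ((\<lambda>u. m \<otimes> u \<otimes> inv m) ` P) = p ^ b"
    using subgroup_conj[OF sP m] cP by auto
  have pim: "K #> (m \<otimes> u \<otimes> inv m) = K #> u" if u: "u \<in> P" for u
  proof -
    have "K #> (u \<otimes> m) = K #> (u \<otimes> m \<otimes> inv u \<otimes> u)" using Pc[OF u] m by (simp add: m_assoc)
    also have "\<dots> = (K #> m) \<otimes>\<^bsub>?H\<^esub> (K #> u)"
      using fx[OF u] Pc[OF u] m pi.hom_mult[of "u \<otimes> m \<otimes> inv u" u] by simp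
    also have "\<dots> = K #> (m \<otimes> u)" using Pc[OF u] m by (simp only: pi.hom_mult)
    finally have eq: "K #> (m \<otimes> u) = K #> (u \<otimes> m)" ..
    have "K #> (m \<otimes> u \<otimes> inv m) = (K #> (m \<otimes> u)) \<otimes>\<^bsub>?H\<^esub> (K #> inv m)"
      using Pc[OF u] m by (intro pi.hom_mult) auto
    also have "\<dots> = K #> (u \<otimes> m \<otimes> inv m)"
      unfolding eq using Pc[OF u] m by (intro pi.hom_mult[symmetric]) auto
    finally show ?thesis using Pc[OF u] m by (simp add: m_assoc)
  qed
  have AL: "(\<lambda>u. m \<otimes> u \<otimes> inv m) ` P \<subseteq> L" using pim Pc m by (auto simp: L_def)
  obtain l where l: "l \<in> L" "\<And>y. y \<in> (\<lambda>u. m \<otimes> u \<otimes> inv m) ` P \<Longrightarrow> l \<otimes> y \<otimes> inv l \<in> P"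
    by (rule sylow_conjugate_within[OF L A(1) AL A(2) sP PL cP p max], rule that)
  then obtain v where v: "v \<in> P" "K #> l = K #> v" and lc: "l \<in> carrier G" by (auto simp: L_def)
  define x where "x = inv v \<otimes> l \<otimes> m"
  have x: "x \<in> carrier G" using lc m Pc[OF v(1)] by (simp add: x_def)
  have "x \<in> normalizer G P"
  proof (rule normalizer_memI[OF sP x])
    fix u assume u: "u \<in> P"
    have "x \<otimes> u \<otimes> inv x = inv v \<otimes> (l \<otimes> (m \<otimes> u \<otimes> inv m) \<otimes> inv l) \<otimes> v"
      unfolding x_def using lc m Pc[OF v(1)] Pc[OF u] by (simp add: inv_mult_group m_assoc)
    also have "\<dots> \<in> P" using l(2)[of "m \<otimes> u \<otimes> inv m"] u v(1) by simp
    finally show "x \<otimes> u \<otimes> inv x \<in> P" .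
  qed
  moreover have "x \<in> K #> m"
  proof -
    have "K #> x = (K #> inv v) \<otimes>\<^bsub>?H\<^esub> (K #> l) \<otimes>\<^bsub>?H\<^esub> (K #> m)"
      unfolding x_def using lc m Pc[OF v(1)] by (simp only: pi.hom_mult m_closed inv_closed)
    also have "\<dots> = K #> (inv v \<otimes> v \<otimes> m)"
      unfolding v(2) using m Pc[OF v(1)] by (simp only: pi.hom_mult m_closed inv_closed)
    also have "\<dots> = K #> m" using m Pc[OF v(1)] by simp
    finally show ?thesis using rcos_self[OF x K.subgroup_axioms] by simp
  qed
  ultimately show ?thesis by (rule that)
qed

text \<open>Passage to \<open>G/K\<close>: the hypothesis on the normalizer becomes, by the Frattini
  argument, that the image of \<open>P\<close> fixes only the identity of
  \<open>M/K\<close>.\<close>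

lemma (in finite_group) exists_Galois_invariant_Irr:
  assumes p: "Factorial_Ring.prime p" and \<sigma>: "\<sigma> \<in> carrier (Gal (cyclotomic_field (Coset.order G)))"
    and ord: "group.ord (Gal (cyclotomic_field (Coset.order G))) \<sigma> = p"
    and syl: "sylow_subgroup p P G"
    and cf: "chief_factor G M K" and sub: "normalizer G P \<inter> M \<subseteq> K"
  shows "\<exists>\<chi>\<in>Irr G. galois_conj G \<sigma> \<chi> = \<chi> \<and> p dvd char_degree G \<chi>"
proof -
  let ?n = "Coset.order G" and ?H = "G Mod K"
  let ?N = "carrier (G\<lparr>carrier := M\<rparr> Mod K)"
  have K: "K \<lhd> G" and M: "M \<lhd> G" and KM: "K \<subset> M" and N: "?N \<lhd> ?H" "?N \<noteq> {\<one>\<^bsub>?H\<^esub>}"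
    using cf unfolding chief_factor_def minimal_normal_def by blast+
  interpret K: Coset.normal K G by (rule K)
  interpret M: Coset.normal M G by (rule M)
  interpret pi: group_hom G ?H "\<lambda>x. K #> x"
    by (intro group_hom.intro group_hom_axioms.intro is_group K.factorgroup_is_group K.r_coset_hom_Mod)
  have carH: "carrier ?H = (\<lambda>x. K #> x) ` carrier G" by (auto simp: FactGroup_def RCOSETS_def)
  have NE: "?N = (\<lambda>x. K #> x) ` M" by (auto simp: FactGroup_def RCOSETS_def r_coset_def)
  interpret H: finite_group ?H
    using carH fin by (intro finite_group.intro finite_group_axioms.intro K.factorgroup_is_group) simp
  have dvd: "Coset.order ?H dvd ?n"
    using lagrange[OF K.subgroup_axioms] by (simp add: Coset.order_def FactGroup_def dvd_def) metis
  obtain k where k: "\<And>e. e ^ ?n = 1 \<Longrightarrow> e \<in> cyclotomic_field ?n \<and> \<sigma> e = e ^ k" and kp: "[k ^ p = 1] (mod ?n)"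
    using Gal_cyclotomic_power[OF order_pos \<sigma>] ord by metis
  have kpH: "[k ^ p = 1] (mod Coset.order ?H)" by (rule cong_dvd_modulus_nat[OF kp dvd])
  have sP: "subgroup P G" and cP: "card P = p ^ multiplicity p ?n" using syl by (auto simp: sylow_subgroup_def)
  interpret P: Group.subgroup P G by (rule sP)
  have Pc: "u \<in> carrier G" if "u \<in> P" for u using P.subset that by auto
  let ?P = "(\<lambda>x. K #> x) ` P"
  have imgP: "subgroup ?P ?H" by (rule pi.subgroup_img_is_subgroup[OF sP])
  have "card ((\<lambda>u. (K #> u) \<otimes>\<^bsub>?H\<^esub> \<one>\<^bsub>?H\<^esub>) ` carrier (G\<lparr>carrier := P\<rparr>)) dvd card (carrier (G\<lparr>carrier := P\<rparr>))"
  proof (rule orbit_card_dvd[OF subgroup_imp_group[OF sP], where act = "\<lambda>u c. (K #> u) \<otimes>\<^bsub>?H\<^esub> c" and x = "\<one>\<^bsub>?H\<^esub>"])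
    have ops: "\<one>\<^bsub>G\<lparr>carrier := P\<rparr>\<^esub> = \<one>" "u \<otimes>\<^bsub>G\<lparr>carrier := P\<rparr>\<^esub> v = u \<otimes> v" for u v by simp_all
    show "finite (carrier (G\<lparr>carrier := P\<rparr>))" using finite_subset[OF P.subset fin] by simp
    have "(K #> \<one>) \<otimes>\<^bsub>?H\<^esub> \<one>\<^bsub>?H\<^esub> = \<one>\<^bsub>?H\<^esub>" by (simp only: pi.hom_one pi.H.r_one pi.H.one_closed)
    then show "(K #> \<one>\<^bsub>G\<lparr>carrier := P\<rparr>\<^esub>) \<otimes>\<^bsub>?H\<^esub> \<one>\<^bsub>?H\<^esub> = \<one>\<^bsub>?H\<^esub>" unfolding ops .
    fix u v assume "u \<in> carrier (G\<lparr>carrier := P\<rparr>)" "v \<in> carrier (G\<lparr>carrier := P\<rparr>)"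
    then have "u \<in> carrier G" "v \<in> carrier G" using Pc by auto
    then have "(K #> (u \<otimes> v)) \<otimes>\<^bsub>?H\<^esub> \<one>\<^bsub>?H\<^esub> = (K #> u) \<otimes>\<^bsub>?H\<^esub> ((K #> v) \<otimes>\<^bsub>?H\<^esub> \<one>\<^bsub>?H\<^esub>)"
      by (simp only: pi.hom_mult pi.H.m_assoc pi.hom_closed pi.H.one_closed)
    then show "(K #> (u \<otimes>\<^bsub>G\<lparr>carrier := P\<rparr>\<^esub> v)) \<otimes>\<^bsub>?H\<^esub> \<one>\<^bsub>?H\<^esub> = (K #> u) \<otimes>\<^bsub>?H\<^esub> ((K #> v) \<otimes>\<^bsub>?H\<^esub> \<one>\<^bsub>?H\<^esub>)"
      unfolding ops .
  qed
  moreover have "(\<lambda>u. (K #> u) \<otimes>\<^bsub>?H\<^esub> \<one>\<^bsub>?H\<^esub>) ` P = ?P"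
    by (rule image_cong[OF refl pi.H.r_one[OF pi.hom_closed[OF Pc]]])
  ultimately have "card ?P dvd p ^ multiplicity p ?n" using cP by simp
  then obtain a where a: "card ?P = p ^ a" using divides_primepow_nat[OF p] by auto
  have fix1: "c = \<one>\<^bsub>?H\<^esub>" if c: "c \<in> ?N" and fx: "\<And>u. u \<in> ?P \<Longrightarrow> u \<otimes>\<^bsub>?H\<^esub> c \<otimes>\<^bsub>?H\<^esub> inv\<^bsub>?H\<^esub> u = c" for c
  proof -
    obtain m where m: "m \<in> M" "c = K #> m" using c NE by auto
    have mc: "m \<in> carrier G" using m(1) M.subset by auto
    have fx': "K #> (u \<otimes> m \<otimes> inv u) = K #> m" if u: "u \<in> P" for u
      using fx[of "K #> u"] u Pc[OF u] mc m(2) by (simp add: pi.hom_mult pi.hom_inv)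
    obtain x where x: "x \<in> normalizer G P" "x \<in> K #> m"
      by (rule frattini_fixed_coset[OF p syl K mc fx'], assumption, rule that)
    have "x \<in> M" using x(2) m(1) KM by (auto simp: r_coset_def)
    then have "x \<in> K" using x(1) sub by auto
    then have "K #> x = K" by (rule K.rcos_const[OF is_group])
    moreover have "K #> m = K #> x" by (rule repr_independence[OF x(2) mc K.subgroup_axioms])
    ultimately show ?thesis using m(2) by (simp add: FactGroup_def)
  qed
  have gal: "\<exists>\<psi>\<in>Irr ?H. \<exists>c. \<forall>g\<in>carrier ?H. \<chi> (g [^]\<^bsub>?H\<^esub> k) = c * \<psi> g" if "\<chi> \<in> Irr ?H" for \<chi>
    by (rule H.Gal_conj_Irr(2)[OF order_pos dvd \<sigma> k that])
  obtain \<chi> d where chi: "\<chi> \<in> Irr ?H" "\<And>g. g \<in> carrier ?H \<Longrightarrow> \<chi> (g [^]\<^bsub>?H\<^esub> k) = \<chi> g"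
    "\<chi> \<one>\<^bsub>?H\<^esub> = of_nat d" "p dvd d"
    by (rule H.exists_invariant_Irr_dvd_degree[OF N imgP a p fix1 kpH gal]; assumption?; rule that)
  define \<chi>' where "\<chi>' = (\<lambda>g\<in>carrier G. \<chi> (K #> g))"
  have "\<chi>' \<in> Irr G"
    unfolding \<chi>'_def by (rule Irr_inflate[OF pi.group_hom_axioms carH[symmetric] chi(1)])
  moreover have "galois_conj G \<sigma> \<chi>' = \<chi>'"
    unfolding galois_conj_def \<chi>'_def
    using H.Gal_conj_Irr(1)[OF order_pos dvd \<sigma> k chi(1)] chi(2) by (intro restrict_ext) simp
  moreover have "char_degree G \<chi>' = d"
    using chi(3) unfolding char_degree_def \<chi>'_def by simp
  ultimately show ?thesis using chi(4) by blast
qed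

theorem theorem2:
  fixes G :: "('a, 'b) monoid_scheme" and p :: nat
    and \<sigma> :: "complex \<Rightarrow> complex" and P :: "'a set"
  assumes "Group.group G" and "finite (carrier G)"
    and "Factorial_Ring.prime p"
    and "\<sigma> \<in> carrier (Gal (cyclotomic_field (Coset.order G)))"
    and "group.ord (Gal (cyclotomic_field (Coset.order G))) \<sigma> = p"
    and "sylow_subgroup p P G"
    and "\<forall>\<chi>\<in>Irr G. galois_conj G \<sigma> \<chi> = \<chi> \<longrightarrow> \<not> p dvd char_degree G \<chi>"
  shows "\<forall>M K. chief_factor G M K \<longrightarrow> \<not> normalizer G P \<inter> M \<subseteq> K"
proof (intro allI impI notI)
  fix M K assume "chief_factor G M K" "normalizer G P \<inter> M \<subseteq> K"
  moreover have "finite_group G"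
    using assms(1,2) by (intro finite_group.intro finite_group_axioms.intro)
  ultimately show False
    using finite_group.exists_Galois_invariant_Irr[OF _ assms(3-6)] assms(7) by blast
qed

end
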